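(* Suppose that $\mathscr{B}\subset\mathbb{N}$ is taut. Then $(S,X_\eta,\nu_\eta)$ is (measure-theoretically) isomorphic to $(T,G,\mathbb{P})$, where $G$ is the closure of $\{(n \bmod b)_{b\in\mathscr{B}} : n\in\mathbb{Z}\}$ in $\prod_{b\in\mathscr{B}}\mathbb{Z}/b\mathbb{Z}$, $Tg=g+(1,1,\dots)$ and $\mathbb{P}$ is Haar measure of $G$. In particular, $(S,X_\eta,\nu_\eta)$ has zero entropy.
   Context: $\mathbb{N}=\{1,2,\dots\}$. For $\mathscr{B}\subset\mathbb{N}$ let $\mathcal{M}_{\mathscr{B}}:=\bigcup_{b\in\mathscr{B}}b\mathbb{Z}$, $\mathcal{F}_{\mathscr{B}}:=\mathbb{Z}\setminus\mathcal{M}_{\mathscr{B}}$; $\eta\in\{0,1\}^{\mathbb{Z}}$ is the characteristic function of $\mathcal{F}_{\mathscr{B}}$. $S$ is the left shift on $\{0,1\}^{\mathbb{Z}}$ (product topology), and $X_\eta$ is the closure of $\{S^m\eta : m\in\mathbb{Z}\}$. Define $\varphi\colon G\to\{0,1\}^{\mathbb{Z}}$ by $\varphi(g)(n)=1$ iff $n\not\equiv -g_b \bmod b$ for all $b\in\mathscr{B}$ (and $0$ otherwise); the Mirsky measure is $\nu_\eta:=\varphi_*(\mathbb{P})$, with $\mathbb{P}$ the normalized Haar measure of $G$; it is $S$-invariant and satisfies $\nu_\eta(X_\eta)=1$. The logarithmic density of $A\subset\mathbb{Z}$ is $\boldsymbol{\delta}(A)=\lim_{N\to\infty}\frac{1}{\log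 N}\sum_{a\in A,1\le a\le N}\frac1a$ when the limit exists; it always exists for $A=\mathcal{M}_{\mathscr{B}}$ (Davenport–Erdős). $\mathscr{B}$ is taut if $\boldsymbol{\delta}(\mathcal{M}_{\mathscr{B}\setminus\{b\}})<\boldsymbol{\delta}(\mathcal{M}_{\mathscr{B}})$ for each $b\in\mathscr{B}$. Entropy is the Kolmogorov (measure-theoretic) entropy. *)

theory Defs
  imports "HOL-Algebra.Product_Groups" "HOL-Number_Theory.Cong" "HOL-Probability.Probability"
begin

section \<open>Sets of multiples, logarithmic density, tautness\<close>

definition multiples_of :: "nat set \<Rightarrow> int set" where
  "multiples_of B = (\<Union>b\<in>B. range (\<lambda>k. int b * k))"

definition free_numbers :: "nat set \<Rightarrow> int set" where
  "free_numbers B = UNIV - multiples_of B"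

text \<open>Only meaningful if the limit exists; for sets of multiples it does, by the
  Davenport-Erdos theorem.\<close>

definition log_density :: "int set \<Rightarrow> real" where
  "log_density A =
     lim (\<lambda>N::nat. (\<Sum>a | a \<in> A \<and> 1 \<le> a \<and> a \<le> int N. 1 / real_of_int a) / ln (real N))"

definition taut :: "nat set \<Rightarrow> bool" where
  "taut B \<longleftrightarrow>
     (\<forall>b\<in>B. log_density (multiples_of (B - {b})) < log_density (multiples_of B))"


section \<open>The subshift\<close>

text \<open>The full shift is the type \<^typ>\<open>int \<Rightarrow> bool\<close>, with \<^const>\<open>True\<close> in the role of 1. Its
  type class topology is the product topology over the discrete two-point space.\<close>

definition shift_by :: "int \<Rightarrow> (int \<Rightarrow> bool) \<Rightarrow> (int \<Rightarrow> bool)" where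
  "shift_by m x = (\<lambda>n. x (n + m))"

abbreviation left_shift :: "(int \<Rightarrow> bool) \<Rightarrow> (int \<Rightarrow> bool)" where
  "left_shift \<equiv> shift_by 1"

text \<open>\<^term>\<open>shift_by m\<close> is the \<open>m\<close>-th iterate of \<^term>\<open>left_shift\<close>, for negative \<open>m\<close> as well.\<close>

lemma left_shift_funpow: "(left_shift ^^ k) = shift_by (int k)"
  by (induction k) (auto simp: shift_by_def fun_eq_iff algebra_simps)

lemma shift_by_uminus: "shift_by (- m) (shift_by m x) = x" "shift_by m (shift_by (- m) x) = x"
  by (simp_all add: shift_by_def)

definition free_seq :: "nat set \<Rightarrow> int \<Rightarrow> bool" where
  "free_seq B = (\<lambda>n. n \<in> free_numbers B)"

definition free_subshift :: "nat set \<Rightarrow> (int \<Rightarrow> bool) set" where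
  "free_subshift B = closure (range (\<lambda>m. shift_by m (free_seq B)))"


section \<open>The odometer\<close>

text \<open>Residue classes modulo \<open>b\<close> are represented by \<open>0, \<dots>, b - 1\<close>.\<close>

abbreviation residue_product :: "nat set \<Rightarrow> (nat \<Rightarrow> int) monoid" where
  "residue_product B \<equiv> product_group B integer_mod_group"

definition residue_topology :: "nat set \<Rightarrow> (nat \<Rightarrow> int) topology" where
  "residue_topology B =
     product_topology (\<lambda>b. discrete_topology (carrier (integer_mod_group b))) B"

definition residues_of :: "nat set \<Rightarrow> int \<Rightarrow> (nat \<Rightarrow> int)" where
  "residues_of B n = (\<lambda>b\<in>B. n mod int b)"

definition odometer_carrier :: "nat set \<Rightarrow> (nat \<Rightarrow> int) set" where
  "odometer_carrier B = residue_topology B closure_of range (residues_of B)"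

definition odometer_group :: "nat set \<Rightarrow> (nat \<Rightarrow> int) monoid" where
  "odometer_group B = residue_product B \<lparr>carrier := odometer_carrier B\<rparr>"

definition odometer_topology :: "nat set \<Rightarrow> (nat \<Rightarrow> int) topology" where
  "odometer_topology B = subtopology (residue_topology B) (odometer_carrier B)"

definition odometer_rotation :: "nat set \<Rightarrow> (nat \<Rightarrow> int) \<Rightarrow> (nat \<Rightarrow> int)" where
  "odometer_rotation B g = g \<otimes>\<^bsub>odometer_group B\<^esub> residues_of B 1"


section \<open>Haar measure and Mirsky measure\<close>

text \<open>Normalised Haar measure of a compact group: the translation invariant Borel probability
  measure. Regularity is not required: it is automatic in a metrizable group, such as a closed
  subgroup of a countable product of finite groups.\<close>

definition normalized_haar ::
    "('a, 'm) monoid_scheme \<Rightarrow> 'a topology \<Rightarrow> 'a measure \<Rightarrow> bool" where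
  "normalized_haar G \<tau> P \<longleftrightarrow>
     prob_space P \<and>
     space P = carrier G \<and>
     sets P = sigma_sets (carrier G) {U. openin \<tau> U} \<and>
     (\<forall>g\<in>carrier G. \<forall>A\<in>sets P. emeasure P ((\<lambda>x. g \<otimes>\<^bsub>G\<^esub> x) ` A) = emeasure P A)"

definition window_coding :: "nat set \<Rightarrow> (nat \<Rightarrow> int) \<Rightarrow> (int \<Rightarrow> bool)" where
  "window_coding B g = (\<lambda>n. \<forall>b\<in>B. \<not> [n = - g b] (mod int b))"

definition mirsky_measure :: "nat set \<Rightarrow> (nat \<Rightarrow> int) measure \<Rightarrow> (int \<Rightarrow> bool) measure" where
  "mirsky_measure B P = distr P borel (window_coding B)"

definition mirsky_on_subshift :: "nat set \<Rightarrow> (nat \<Rightarrow> int) measure \<Rightarrow> (int \<Rightarrow> bool) measure" where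
  "mirsky_on_subshift B P = restrict_space (mirsky_measure B P) (free_subshift B)"


section \<open>Measure-preserving systems, isomorphism and entropy\<close>

definition measure_preserving_system :: "'a measure \<Rightarrow> ('a \<Rightarrow> 'a) \<Rightarrow> bool" where
  "measure_preserving_system M T \<longleftrightarrow> prob_space M \<and> T \<in> measurable M M \<and> distr M M T = M"

definition mps_isomorphic ::
    "'a measure \<Rightarrow> ('a \<Rightarrow> 'a) \<Rightarrow> 'b measure \<Rightarrow> ('b \<Rightarrow> 'b) \<Rightarrow> bool" where
  "mps_isomorphic M S N T \<longleftrightarrow>
     measure_preserving_system M S \<and>
     measure_preserving_system N T \<and>
     (\<exists>M' N' f.
        M' \<in> sets M \<and> emeasure M M' = 1 \<and> S ` M' \<subseteq> M' \<and>
        N' \<in> sets N \<and> emeasure N N' = 1 \<and> T ` N' \<subseteq> N' \<and>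
        bij_betw f M' N' \<and>
        f \<in> measurable (restrict_space M M') (restrict_space N N') \<and>
        the_inv_into M' f \<in> measurable (restrict_space N N') (restrict_space M M') \<and>
        distr (restrict_space M M') (restrict_space N N') f = restrict_space N N' \<and>
        (\<forall>x\<in>M'. f (S x) = T (f x)))"

definition finite_measurable_partition :: "'a measure \<Rightarrow> 'a set set \<Rightarrow> bool" where
  "finite_measurable_partition M Q \<longleftrightarrow> finite Q \<and> Q \<subseteq> sets M \<and> partition_on (space M) Q"

definition partition_entropy :: "'a measure \<Rightarrow> 'a set set \<Rightarrow> real" where
  "partition_entropy M Q = - (\<Sum>A\<in>Q. measure M A * ln (measure M A))"

text \<open>The join of the preimages of \<open>Q\<close> under the first \<open>n\<close> iterates of \<open>T\<close>, for \<open>n \<ge> 1\<close>.\<close>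

definition dynamical_join :: "'a measure \<Rightarrow> ('a \<Rightarrow> 'a) \<Rightarrow> 'a set set \<Rightarrow> nat \<Rightarrow> 'a set set" where
  "dynamical_join M T Q n =
     common_refinement ((\<lambda>k. (\<lambda>A. (T ^^ k) -` A \<inter> space M) ` Q) ` {..<n})"

definition entropy_wrt_partition :: "'a measure \<Rightarrow> ('a \<Rightarrow> 'a) \<Rightarrow> 'a set set \<Rightarrow> real" where
  "entropy_wrt_partition M T Q =
     lim (\<lambda>n. partition_entropy M (dynamical_join M T Q n) / real n)"

definition kolmogorov_entropy :: "'a measure \<Rightarrow> ('a \<Rightarrow> 'a) \<Rightarrow> ereal" where
  "kolmogorov_entropy M T =
     (SUP Q \<in> {Q. finite_measurable_partition M Q}. ereal (entropy_wrt_partition M T Q))"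

end

theory Submission
  imports Defs "HOL-Number_Theory.Number_Theory" "HOL-Real_Asymp.Real_Asymp"
begin

text \<open>
  Why the theorem holds. Let \<open>G\<close> be the odometer and let \<open>W\<close> be the set of all \<open>g\<close> in \<open>G\<close> with
  no zero coordinate. The coding of \<open>g\<close> has a one at \<open>n\<close> exactly when the rotation of \<open>g\<close> by \<open>n\<close>
  lies in \<open>W\<close>, so coding intertwines the rotation with the shift, and by definition it carries
  Haar measure to the Mirsky measure. Two things remain for an isomorphism: the coding must be
  injective on a set of full measure with a measurable inverse, and it must take its values in the
  subshift almost surely.

  Injectivity. The support of the coding of \<open>g\<close> misses the class of \<open>- g b\<close> modulo \<open>b\<close>. If this is the
  only missed class for every \<open>b\<close>, then \<open>g\<close> is read off from its coding one coordinate at a time,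
  each time by a Borel condition. Suppose that another class is missed. After a rotation this
  says that the points \<open>g + b k\<close> all avoid \<open>W\<close>, where \<open>g b = s\<close> is not zero. The set of such \<open>g\<close> is
  invariant under rotation by \<open>b\<close>, and the rotation by \<open>b\<close> acts ergodically on the class
  \<open>g b = s\<close>; so it is null as soon as \<open>W\<close> meets that class in positive measure
  (\<open>AE_class_hits_free_set\<close>). Positivity is where tautness enters. Tautness at \<open>b\<close> says that the
  multiples of \<open>b\<close> that are divisible by no other element of \<open>B\<close> have positive density, which
  is a statement about the class \<open>g b = 0\<close>. A translation by a suitable integer moves this class
  to the class of \<open>s\<close> without creating new divisibilities (\<open>translation_into_class\<close>), so the
  positivity carries over.

  Densities. Tautness speaks of logarithmic densities, Haar measure of limits over finite subsets
  of \<open>B\<close>. The bridge is the theorem of Davenport and Erdos: the logarithmic density of the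
  multiples of \<open>B\<close> exists and is the supremum over finite subsets of \<open>B\<close>. It follows from Harris's
  correlation inequality. Under the uniform measure on residues modulo a large integer \<open>L\<close>, being
  free of divisors in \<open>B\<close> and having \<open>gcd n L \<le> N\<close> are both decreasing events for divisibility,
  hence positively correlated, and conditioning on the second one produces the weights \<open>1 / n\<close> on
  \<open>{1..N}\<close>. This gives an upper bound for the logarithmic sum over multiples that is uniform
  in \<open>N\<close> (\<open>log_sum_multiples_le\<close>).

  Support. The same theorem shows that a finite pattern which occurs nowhere in the
  characteristic sequence of the free numbers has Mirsky measure zero (\<open>absent_pattern_null\<close>): the
  pattern computed from a finite part of \<open>B\<close> differs from the true one only on a set of integers of
  small density.

  Entropy. The condition that the support misses a given class modulo \<open>b\<close> is invariant under the
  \<open>b\<close>-th power of the shift, and up to null sets these conditions generate the Borel sets. So every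
  event is approximated by events periodic under the shift. A name of length \<open>n\<close> with respect to a
  periodic partition takes boundedly many values, and the error made by the approximation costs
  an arbitrarily small amount of entropy per step (\<open>zero_entropy_of_periodic_approximation\<close>).
\<close>

section \<open>Harris's inequality for residues\<close>

definition antitone_wrt :: "('a \<Rightarrow> 'a \<Rightarrow> bool) \<Rightarrow> 'a set \<Rightarrow> ('a \<Rightarrow> real) \<Rightarrow> bool" where
  "antitone_wrt R X f \<longleftrightarrow> (\<forall>x\<in>X. \<forall>y\<in>X. R x y \<longrightarrow> f y \<le> f x)"

text \<open>
  Positive correlation of decreasing functions under the uniform measure on \<open>X\<close>, with
  the normalising factors cleared.
\<close>

definition harris :: "('a \<Rightarrow> 'a \<Rightarrow> bool) \<Rightarrow> 'a set \<Rightarrow> bool" where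
  "harris R X \<longleftrightarrow> (\<forall>f g. antitone_wrt R X f \<longrightarrow> antitone_wrt R X g \<longrightarrow>
     sum f X * sum g X \<le> real (card X) * (\<Sum>x\<in>X. f x * g x))"

text \<open>
  Chebyshev's sum inequality: on a chain two decreasing functions are ordered alike, so all
  products \<open>(f x - f y) * (g x - g y)\<close> are nonnegative, and their sum is twice the
  difference of the two sides.
\<close>

lemma harris_total:
  assumes "\<And>x y. x \<in> X \<Longrightarrow> y \<in> X \<Longrightarrow> R x y \<or> R y x"
  shows "harris R X"
  unfolding harris_def
proof (intro allI impI)
  fix f g assume f: "antitone_wrt R X f" and g: "antitone_wrt R X g"
  have "0 \<le> (\<Sum>x\<in>X. \<Sum>y\<in>X. (f x - f y) * (g x - g y))"
  proof (intro sum_nonneg)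
    fix x y assume xy: "x \<in> X" "y \<in> X"
    with assms[OF xy] f g show "0 \<le> (f x - f y) * (g x - g y)"
      unfolding antitone_wrt_def by (auto intro: mult_nonneg_nonneg mult_nonpos_nonpos)
  qed
  also have "\<dots> = (\<Sum>x\<in>X. \<Sum>y\<in>X. f x * g x) - (\<Sum>x\<in>X. \<Sum>y\<in>X. f x * g y)
      - (\<Sum>x\<in>X. \<Sum>y\<in>X. f y * g x) + (\<Sum>x\<in>X. \<Sum>y\<in>X. f y * g y)"
    by (simp add: algebra_simps sum.distrib sum_subtractf)
  also have "\<dots> = 2 * (real (card X) * (\<Sum>x\<in>X. f x * g x) - sum f X * sum g X)"
    by (simp add: sum_product sum.swap[of "\<lambda>x y. f y * g x"] sum_distrib_left algebra_simps)
  finally show "sum f X * sum g X \<le> real (card X) * (\<Sum>x\<in>X. f x * g x)" by simp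
qed

text \<open>
  The partial sums over the second factor are again decreasing in the first one; apply the
  inequality on every slice and then to the partial sums.
\<close>

lemma harris_product:
  assumes X: "harris R X" and Y: "harris Q Y"
    and refl: "\<And>x. x \<in> X \<Longrightarrow> R x x" "\<And>y. y \<in> Y \<Longrightarrow> Q y y"
  shows "harris (\<lambda>p q. R (fst p) (fst q) \<and> Q (snd p) (snd q)) (X \<times> Y)"
  unfolding harris_def
proof (intro allI impI)
  let ?S = "\<lambda>p q. R (fst p) (fst q) \<and> Q (snd p) (snd q)"
  fix f g :: "'a \<times> 'b \<Rightarrow> real"
  assume f: "antitone_wrt ?S (X \<times> Y) f" and g: "antitone_wrt ?S (X \<times> Y) g"
  define F where "F = (\<lambda>x. \<Sum>y\<in>Y. f (x, y))"
  define G where "G = (\<lambda>x. \<Sum>y\<in>Y. g (x, y))"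
  have slice: "F x * G x \<le> real (card Y) * (\<Sum>y\<in>Y. f (x, y) * g (x, y))" if "x \<in> X" for x
  proof -
    have "antitone_wrt Q Y (\<lambda>y. f (x, y))" "antitone_wrt Q Y (\<lambda>y. g (x, y))"
      using f g that refl(1) by (auto simp: antitone_wrt_def)
    with Y show ?thesis unfolding harris_def F_def G_def by blast
  qed
  have "antitone_wrt R X F" "antitone_wrt R X G"
    using f g refl(2) by (auto simp: antitone_wrt_def F_def G_def intro!: sum_mono)
  with X have "sum F X * sum G X \<le> real (card X) * (\<Sum>x\<in>X. F x * G x)"
    unfolding harris_def by blast
  also have "\<dots> \<le> real (card X) * (\<Sum>x\<in>X. real (card Y) * (\<Sum>y\<in>Y. f (x, y) * g (x, y)))"
    by (intro mult_left_mono sum_mono slice) auto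
  also have "\<dots> = real (card (X \<times> Y)) * (\<Sum>p\<in>X \<times> Y. f p * g p)"
    by (simp add: sum.cartesian_product' card_cartesian_product sum_distrib_left mult_ac)
  finally show "sum f (X \<times> Y) * sum g (X \<times> Y) \<le> real (card (X \<times> Y)) * (\<Sum>p\<in>X \<times> Y. f p * g p)"
    by (simp add: sum.cartesian_product' F_def G_def)
qed

lemma harris_transport:
  assumes h: "bij_betw h X Y" and Y: "harris Q Y"
    and R: "\<And>x y. x \<in> X \<Longrightarrow> y \<in> X \<Longrightarrow> Q (h x) (h y) \<Longrightarrow> R x y"
  shows "harris R X"
  unfolding harris_def
proof (intro allI impI)
  fix f g :: "'a \<Rightarrow> real"
  assume f: "antitone_wrt R X f" and g: "antitone_wrt R X g"
  define k where "k = the_inv_into X h"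
  have k: "bij_betw k Y X" "\<And>y. y \<in> Y \<Longrightarrow> h (k y) = y" "\<And>y. y \<in> Y \<Longrightarrow> k y \<in> X"
    using h bij_betw_the_inv_into[OF h] f_the_inv_into_f_bij_betw[OF h]
    unfolding k_def by (auto dest: bij_betwE)
  have "antitone_wrt Q Y (f \<circ> k)" "antitone_wrt Q Y (g \<circ> k)"
    using f g R k(2,3) by (auto simp: antitone_wrt_def)
  with Y have "sum (f \<circ> k) Y * sum (g \<circ> k) Y \<le> real (card Y) * (\<Sum>y\<in>Y. (f \<circ> k) y * (g \<circ> k) y)"
    unfolding harris_def by blast
  moreover have "sum f X = sum (f \<circ> k) Y" "sum g X = sum (g \<circ> k) Y"
    "(\<Sum>x\<in>X. f x * g x) = (\<Sum>y\<in>Y. (f \<circ> k) y * (g \<circ> k) y)" "card X = card Y"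
    using k(1) by (simp_all add: bij_betw_same_card[OF h]
        sum.reindex_bij_betw[symmetric, OF k(1)])
  ultimately show "sum f X * sum g X \<le> real (card X) * (\<Sum>x\<in>X. f x * g x)" by simp
qed

text \<open>
  The order compares the divisors that \<open>n\<close> shares with \<open>L\<close>. By the
  Chinese remainder theorem it is a product of the orders for the prime powers in
  \<open>L\<close>, and for a prime power the possible values of the gcd form a chain.
\<close>

lemma harris_residues:
  fixes L :: nat
  assumes "L > 0"
  shows "harris (\<lambda>m n. gcd m L dvd gcd n L) {..<L}"
  using assms
proof (induction L rule: less_induct)
  case (less L)
  show ?case
  proof (cases "L = 1")
    case True
    then show ?thesis by (intro harris_total) auto
  next
    case False
    then obtain p where p: "prime p" "p dvd L" using prime_factor_nat by blast
    define k where "k = multiplicity p L"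
    obtain L' where L': "L = p ^ k * L'" "\<not> p dvd L'"
      using multiplicity_decompose'[of L p] p(1) less.prems unfolding k_def
      by (metis not_prime_unit neq0_conv)
    have cop: "coprime (p ^ k) L'" using L'(2) p(1) by (simp add: prime_imp_coprime)
    have "k > 0" using p less.prems by (simp add: k_def prime_multiplicity_gt_zero_iff)
    then have pk: "p ^ k > 1" using prime_gt_1_nat[OF p(1)] by (intro one_less_power)
    have L'0: "L' > 0" using L' less.prems by (metis mult_0_right neq0_conv)
    then have "L' < L" using L'(1) pk by simp
    with less.IH L'0 have H1: "harris (\<lambda>m n. gcd m L' dvd gcd n L') {..<L'}" by blast
    have H2: "harris (\<lambda>m n. gcd m (p ^ k) dvd gcd n (p ^ k)) {..<p ^ k}"
    proof (rule harris_total)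
      fix x y
      obtain i j where "gcd x (p ^ k) = p ^ i" "gcd y (p ^ k) = p ^ j"
        using divides_primepow_nat[OF p(1)] by (metis gcd_dvd2)
      then show "gcd x (p ^ k) dvd gcd y (p ^ k) \<or> gcd y (p ^ k) dvd gcd x (p ^ k)"
        by (metis le_imp_power_dvd nat_le_linear)
    qed
    \<comment> \<open>the Chinese remainder map\<close>
    define h where "h = (\<lambda>n. (n mod p ^ k, n mod L'))"
    have inj: "inj_on h {..<L}"
    proof (rule inj_onI)
      fix x y assume "x \<in> {..<L}" "y \<in> {..<L}" "h x = h y"
      then have "[x = y] (mod p ^ k)" "[x = y] (mod L')" by (auto simp: h_def Cong.cong_def)
      then have "[x = y] (mod L)" using cop L'(1) coprime_cong_mult_nat by blast
      with \<open>x \<in> {..<L}\<close> \<open>y \<in> {..<L}\<close> show "x = y" by (simp add: cong_less_modulus_unique_nat)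
    qed
    have sub: "h ` {..<L} \<subseteq> {..<p ^ k} \<times> {..<L'}" using L'0 prime_gt_0_nat[OF p(1)] by (auto simp: h_def)
    have "bij_betw h {..<L} ({..<p ^ k} \<times> {..<L'})"
      unfolding bij_betw_def
    proof (intro conjI inj card_subset_eq sub)
      show "card (h ` {..<L}) = card ({..<p ^ k} \<times> {..<L'})"
        by (simp add: card_image[OF inj] card_cartesian_product flip: L'(1))
    qed auto
    then show ?thesis
    proof (rule harris_transport[OF _ harris_product[OF H2 H1]])
      fix x y :: nat
      assume "gcd (fst (h x)) (p ^ k) dvd gcd (fst (h y)) (p ^ k) \<and>
              gcd (snd (h x)) L' dvd gcd (snd (h y)) L'"
      then have 1: "gcd x (p ^ k) dvd y" and 2: "gcd x L' dvd y"
        using prime_gt_0_nat[OF p(1)] L'0 by (simp_all add: h_def dvd_mod_iff)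
      obtain u v where uv: "gcd x L = u * v" "u dvd p ^ k" "v dvd L'"
        using division_decomp[of "gcd x L" "p ^ k" L'] L'(1) by auto
      then have "u dvd x" "v dvd x" by (metis dvd_mult_left dvd_mult_right gcd_dvd1)+
      with 1 2 uv have "u dvd y" "v dvd y" by (meson dvd_trans gcd_greatest)+
      moreover have "coprime u v" using cop uv(2,3) by (meson coprime_divisors)
      ultimately show "gcd x L dvd gcd y L" using uv(1) by (metis divides_mult gcd_dvd2 gcd_greatest)
    qed auto
  qed
qed

section \<open>Logarithmic density\<close>

definition log_sum :: "int set \<Rightarrow> nat \<Rightarrow> real" where
  "log_sum A N = (\<Sum>a | a \<in> A \<and> 1 \<le> a \<and> a \<le> int N. 1 / real_of_int a)"

text \<open>
  The term \<^term>\<open>log_density A\<close> has some value even when the limit does not exist,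
  so the existence of the limit is a statement of its own.
\<close>

definition has_log_density :: "int set \<Rightarrow> real \<Rightarrow> bool" where
  "has_log_density A d \<longleftrightarrow> (\<lambda>N. log_sum A N / ln (real N)) \<longlonglongrightarrow> d"

lemma has_log_density_imp_eq: "has_log_density A d \<Longrightarrow> log_density A = d"
  unfolding has_log_density_def log_density_def log_sum_def by (rule limI)

lemma has_log_density_unique: "has_log_density A d \<Longrightarrow> has_log_density A e \<Longrightarrow> d = e"
  using has_log_density_imp_eq by blast

lemma log_sum_eq: "log_sum A N = (\<Sum>k=1..N. if int k \<in> A then 1 / real k else 0)"
proof -
  have "{a. a \<in> A \<and> 1 \<le> a \<and> a \<le> int N} \<subseteq> int ` {k\<in>{1..N}. int k \<in> A}"
  proof
    fix a assume "a \<in> {a. a \<in> A \<and> 1 \<le> a \<and> a \<le> int N}"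
    then have "a = int (nat a)" "nat a \<in> {k\<in>{1..N}. int k \<in> A}" by auto
    then show "a \<in> int ` {k\<in>{1..N}. int k \<in> A}" by blast
  qed
  then have "{a. a \<in> A \<and> 1 \<le> a \<and> a \<le> int N} = int ` {k\<in>{1..N}. int k \<in> A}" by auto
  then have "log_sum A N = (\<Sum>a\<in>int ` {k\<in>{1..N}. int k \<in> A}. 1 / real_of_int a)"
    by (simp add: log_sum_def)
  also have "\<dots> = (\<Sum>k=1..N. if int k \<in> A then 1 / real k else 0)"
    by (subst sum.reindex) (simp_all add: sum.inter_filter del: atLeastAtMost_iff)
  finally show ?thesis .
qed

lemma log_sum_mono: "A \<subseteq> A' \<Longrightarrow> log_sum A N \<le> log_sum A' N"
  unfolding log_sum_eq by (intro sum_mono) auto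

lemma log_sum_Un_le: "log_sum (A \<union> A') N \<le> log_sum A N + log_sum A' N"
  unfolding log_sum_eq sum.distrib[symmetric] by (intro sum_mono) auto

lemma log_sum_Diff: "A' \<subseteq> A \<Longrightarrow> log_sum (A - A') N = log_sum A N - log_sum A' N"
  unfolding log_sum_eq sum_subtractf[symmetric] by (intro sum.cong) auto

lemma log_sum_UNIV: "log_sum UNIV N = harm N"
  by (simp add: log_sum_eq harm_def divide_inverse)

lemma harm_div_ln_tendsto: "(\<lambda>N. harm N / ln (real N)) \<longlonglongrightarrow> 1"
proof -
  have lninf: "filterlim (\<lambda>N. ln (real N)) at_top sequentially"
    by (rule filterlim_compose[OF ln_at_top filterlim_real_sequentially])
  have "(\<lambda>N. (harm N - ln (real N)) / ln (real N) + 1) \<longlonglongrightarrow> 0 + 1"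
    by (intro tendsto_add tendsto_const tendsto_divide_0[OF euler_mascheroni_LIMSEQ])
       (rule filterlim_at_top_imp_at_infinity[OF lninf])
  moreover have "\<forall>\<^sub>F N in sequentially. (harm N - ln (real N)) / ln (real N) + 1 = harm N / ln (real N)"
    using eventually_ge_at_top[of 2] by eventually_elim (simp add: field_simps)
  ultimately show ?thesis using tendsto_cong by force
qed

lemma bounded_div_ln_tendsto_0:
  assumes "\<And>N. \<bar>f N\<bar> \<le> C"
  shows "(\<lambda>N. f N / ln (real N)) \<longlonglongrightarrow> 0"
proof -
  have lninf: "filterlim (\<lambda>N. ln (real N)) at_top sequentially"
    by (rule filterlim_compose[OF ln_at_top filterlim_real_sequentially])
  have "Bfun f sequentially" using assms by (intro BfunI[of _ C]) auto
  moreover have "((\<lambda>N. 1 / ln (real N)) \<longlongrightarrow> 0) sequentially"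
    by (intro tendsto_divide_0[OF tendsto_const]) (rule filterlim_at_top_imp_at_infinity[OF lninf])
  ultimately have "Zfun (\<lambda>N. f N * (1 / ln (real N))) sequentially"
    using bounded_bilinear.Bfun_prod_Zfun[OF bounded_bilinear_mult] tendsto_Zfun_iff by fastforce
  then show ?thesis by (simp add: tendsto_Zfun_iff)
qed

lemma has_log_density_cong_bounded:
  assumes A: "has_log_density A d" and bd: "\<And>N. \<bar>log_sum A' N - log_sum A N\<bar> \<le> C"
  shows "has_log_density A' d"
proof -
  have "(\<lambda>N. log_sum A N / ln (real N) + (log_sum A' N - log_sum A N) / ln (real N)) \<longlonglongrightarrow> d + 0"
    using A bounded_div_ln_tendsto_0[OF bd] unfolding has_log_density_def by (intro tendsto_add)
  then show ?thesis by (simp add: has_log_density_def flip: add_divide_distrib)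
qed

lemma has_log_density_Diff:
  assumes "has_log_density A d" "has_log_density A' d'" "A' \<subseteq> A"
  shows "has_log_density (A - A') (d - d')"
  using tendsto_diff[OF assms(1,2)[unfolded has_log_density_def]] log_sum_Diff[OF assms(3)]
  by (simp add: has_log_density_def flip: diff_divide_distrib)

lemma has_log_density_UNIV: "has_log_density UNIV 1"
  by (simp add: has_log_density_def log_sum_UNIV harm_div_ln_tendsto)

lemma has_log_density_Compl: "has_log_density A d \<Longrightarrow> has_log_density (- A) (1 - d)"
  using has_log_density_Diff[OF has_log_density_UNIV] by (simp add: Compl_eq_Diff_UNIV)

lemma has_log_density_mono:
  assumes "has_log_density A d" "has_log_density A' d'" "A \<subseteq> A'"
  shows "d \<le> d'"
proof (rule LIMSEQ_le)
  show "\<exists>N. \<forall>n\<ge>N. log_sum A n / ln (real n) \<le> log_sum A' n / ln (real n)"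
    using log_sum_mono[OF assms(3)] by (intro exI[of _ 1]) (auto intro!: divide_right_mono)
qed (use assms in \<open>auto simp: has_log_density_def\<close>)

text \<open>
  Summation by parts: moving a set by one changes the weight of each element \<open>k\<close> from
  \<open>1 / k\<close> to \<open>1 / (k - 1)\<close>, and these changes telescope.
\<close>

lemma log_sum_translate_1: "\<bar>log_sum {a. a + 1 \<in> A} N - log_sum A N\<bar> \<le> 2"
proof -
  define u where "u = (\<lambda>k. if int k \<in> A then 1 else 0 :: real)"
  have 1: "log_sum {a. a + 1 \<in> A} N = (\<Sum>k=1..N. u (Suc k) / real k)"
    unfolding log_sum_eq u_def by (intro sum.cong) (auto simp: add.commute)
  have 2: "log_sum A N = (\<Sum>k=1..N. u k / real k)"
    unfolding log_sum_eq u_def by (intro sum.cong) auto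
  have u: "0 \<le> u k" "u k \<le> 1" for k by (auto simp: u_def)
  have "- 1 \<le> (\<Sum>k=1..N. u (Suc k) / real k) - (\<Sum>k=1..N. u k / real k) - u (Suc N) / real (Suc N) \<and>
    (\<Sum>k=1..N. u (Suc k) / real k) - (\<Sum>k=1..N. u k / real k) - u (Suc N) / real (Suc N)
      \<le> 1 - 1 / real (Suc N)" for N
  proof (induction N)
    case 0
    show ?case using u[of 1] by simp
  next
    case (Suc N)
    let ?v = "u (Suc (Suc N))"
    have "?v / real (Suc N) - ?v / real (Suc (Suc N)) = ?v * (1 / real (Suc N) - 1 / real (Suc (Suc N)))"
      by (simp add: algebra_simps)
    moreover have "0 \<le> 1 / real (Suc N) - 1 / real (Suc (Suc N))" by (simp add: field_simps)
    then have "0 \<le> ?v * (1 / real (Suc N) - 1 / real (Suc (Suc N)))"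
      "?v * (1 / real (Suc N) - 1 / real (Suc (Suc N))) \<le> 1 / real (Suc N) - 1 / real (Suc (Suc N))"
      using u[of "Suc (Suc N)"] by (auto intro: mult_nonneg_nonneg mult_left_le_one_le)
    ultimately show ?case using Suc by simp
  qed
  moreover have "0 \<le> u (Suc N) / real (Suc N)" "u (Suc N) / real (Suc N) \<le> 1 / real (Suc N)"
    using u[of "Suc N"] by (auto intro: divide_right_mono)
  moreover have "1 / real (Suc N) \<le> 1" by simp
  ultimately show ?thesis
    unfolding 1 2 abs_le_iff by (smt (verit, best))
qed

lemma log_sum_translate: "\<bar>log_sum {a. a + j \<in> A} N - log_sum A N\<bar> \<le> 2 * \<bar>real_of_int j\<bar>"
proof -
  have nat: "\<bar>log_sum {a. a + int i \<in> A} N - log_sum A N\<bar> \<le> 2 * real i" for i A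
  proof (induction i)
    case (Suc i)
    have "{a. a + int (Suc i) \<in> A} = {a. a + 1 \<in> {a. a + int i \<in> A}}" by (simp add: algebra_simps)
    with Suc log_sum_translate_1[of "{a. a + int i \<in> A}" N] show ?case by simp
  qed simp
  show ?thesis
  proof (cases "j \<ge> 0")
    case True
    with nat[of "nat j" A] show ?thesis by simp
  next
    case False
    with nat[of "nat (- j)" "{a. a + j \<in> A}"] show ?thesis by (simp add: abs_minus_commute)
  qed
qed

lemma has_log_density_translate:
  "has_log_density A d \<Longrightarrow> has_log_density {a. a + j \<in> A} d"
  by (rule has_log_density_cong_bounded[OF _ log_sum_translate])

lemma sum_over_period:
  fixes f :: "int \<Rightarrow> 'a::cancel_comm_monoid_add" and L :: nat
  assumes per: "\<And>a. f (a + int L) = f a"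
  shows "(\<Sum>j<L. f (m + int j)) = (\<Sum>j<L. f (int j))"
proof -
  have step: "(\<Sum>j<L. f (m + 1 + int j)) = (\<Sum>j<L. f (m + int j))" for m
  proof -
    have "f m + (\<Sum>j<L. f (m + 1 + int j)) = (\<Sum>j<Suc L. f (m + int j))"
      by (subst sum.lessThan_Suc_shift) (simp add: algebra_simps)
    also have "\<dots> = f m + (\<Sum>j<L. f (m + int j))" by (simp add: per add.commute)
    finally show ?thesis by simp
  qed
  show ?thesis
  proof (induction m rule: int_induct[of _ 0])
    case (step1 i)
    then show ?case using step[of i] by simp
  next
    case (step2 i)
    then show ?case using step[of "i - 1"] by simp
  qed simp
qed

lemma card_over_period:
  fixes L :: nat
  assumes "\<And>a. P (a + int L) \<longleftrightarrow> P a"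
  shows "card {j. j < L \<and> P (m + int j)} = card {j. j < L \<and> P (int j)}"
proof -
  have "card {j. j < L \<and> Q j} = (\<Sum>j<L. of_bool (Q j) :: nat)" for Q
    by (simp add: Int_def)
  then show ?thesis using sum_over_period[of "\<lambda>a. of_bool (P a) :: nat"] assms by simp
qed

text \<open>
  Averaging over the translates by \<open>0, \<dots>, L - 1\<close> makes every integer equally
  likely to be counted, and a translation changes the logarithmic sums only by a bounded amount.
\<close>

lemma has_log_density_periodic:
  fixes L :: nat
  assumes L: "L > 0" and per: "\<And>a. a + int L \<in> A \<longleftrightarrow> a \<in> A"
  shows "has_log_density A (card {j. j < L \<and> int j \<in> A} / L)"
proof -
  let ?c = "card {j. j < L \<and> int j \<in> A}"
  have avg: "(\<Sum>j<L. log_sum {a. a + int j \<in> A} N) = ?c * harm N" for N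
  proof -
    have "(\<Sum>j<L. log_sum {a. a + int j \<in> A} N)
        = (\<Sum>k=1..N. \<Sum>j<L. if int k + int j \<in> A then 1 / real k else 0)"
      unfolding log_sum_eq by (subst sum.swap) simp
    also have "\<dots> = (\<Sum>k=1..N. real (card {j. j < L \<and> int k + int j \<in> A}) / real k)"
      by (intro sum.cong refl) (simp add: sum.If_cases Int_def)
    also have "\<dots> = (\<Sum>k=1..N. ?c / real k)"
      using card_over_period[of "\<lambda>a. a \<in> A" L] per by (intro sum.cong refl) simp
    finally show ?thesis by (simp add: harm_def sum_distrib_left divide_inverse)
  qed
  have bd: "\<bar>log_sum A N - ?c / L * harm N\<bar> \<le> 2 * real L" for N
  proof -
    have "\<bar>L * log_sum A N - ?c * harm N\<bar> = \<bar>\<Sum>j<L. log_sum A N - log_sum {a. a + int j \<in> A} N\<bar>"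
      by (simp add: sum_subtractf avg)
    also have "\<dots> \<le> (\<Sum>j<L. 2 * real L)"
    proof (intro order.trans[OF sum_abs] sum_mono)
      fix j assume "j \<in> {..<L}"
      then show "\<bar>log_sum A N - log_sum {a. a + int j \<in> A} N\<bar> \<le> 2 * real L"
        using log_sum_translate[of "int j" A N] by (simp add: abs_minus_commute)
    qed
    finally have "\<bar>real L * (log_sum A N - ?c / L * harm N)\<bar> \<le> real L * (2 * real L)"
      using L by (simp add: algebra_simps)
    then show ?thesis using L by (simp add: abs_mult)
  qed
  have "(\<lambda>N. (log_sum A N - ?c / L * harm N) / ln (real N) + ?c / L * (harm N / ln (real N)))
      \<longlonglongrightarrow> 0 + ?c / L * 1"
    by (intro tendsto_add tendsto_mult tendsto_const harm_div_ln_tendsto bounded_div_ln_tendsto_0[OF bd])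
  then show ?thesis
    unfolding has_log_density_def by (simp add: diff_divide_distrib)
qed

section \<open>The theorem of Davenport and Erdos\<close>

lemma multiples_of_iff: "n \<in> multiples_of B \<longleftrightarrow> (\<exists>b\<in>B. int b dvd n)"
  by (auto simp: multiples_of_def dvd_def)

lemma free_numbers_iff: "n \<in> free_numbers B \<longleftrightarrow> (\<forall>b\<in>B. \<not> int b dvd n)"
  by (auto simp: free_numbers_def multiples_of_iff)

lemma free_numbers_eq: "free_numbers B = - multiples_of B"
  by (auto simp: free_numbers_def)

text \<open>
  In a square a divisor of the root can be cancelled without losing a prime factor, so the totient
  scales exactly. This turns the distribution of the gcd into the weights \<open>1 / d\<close>.
\<close>

lemma totient_div_of_square:
  assumes "d dvd A" "A > 0"
  shows "real (totient (A\<^sup>2 div d)) = real (totient (A\<^sup>2)) / real d"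
proof -
  obtain m where m: "A = d * m" using assms(1) by blast
  have d: "d > 0" "m > 0" using assms m by auto
  have "A\<^sup>2 div d = A * m" using d by (simp add: m power2_eq_square)
  moreover have "prime_factors (A * m) = prime_factors A" "prime_factors (A\<^sup>2) = prime_factors A"
    using assms d by (auto simp: prime_factors_product prime_factors_power m)
  ultimately show ?thesis
    using d by (simp add: totient_formula2 m power2_eq_square mult_ac)
qed

text \<open>
  Harris's inequality for residues modulo \<open>A\<^sup>2\<close>, applied to the decreasing
  events that \<open>n\<close> is free and that its gcd with the modulus is at most
  \<open>N\<close>. The second event selects \<open>gcd = d\<close> with probability proportional
  to \<open>1 / d\<close> for each \<open>d\<close> up to \<open>N\<close>.
\<close>

lemma log_sum_free_numbers_ge_period:
  fixes A :: nat
  assumes A: "A > 0" and K: "\<And>c. c \<in> K \<Longrightarrow> c dvd A\<^sup>2" and N: "\<And>d. d \<in> {1..N} \<Longrightarrow> d dvd A"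
  shows "card {n. n < A\<^sup>2 \<and> int n \<in> free_numbers K} / real (A\<^sup>2) * harm N \<le> log_sum (free_numbers K) N"
proof -
  define L where "L = A\<^sup>2"
  have L: "L > 0" using A by (simp add: L_def)
  define f where "f = (\<lambda>n::nat. of_bool (int n \<in> free_numbers K) :: real)"
  define g where "g = (\<lambda>n::nat. of_bool (gcd n L \<le> N) :: real)"
  have fgcd: "f n = f (gcd n L)" for n
    using K by (auto simp: f_def free_numbers_iff L_def)
  have "antitone_wrt (\<lambda>m n. gcd m L dvd gcd n L) {..<L} f"
    unfolding antitone_wrt_def
  proof (intro ballI impI)
    fix x y assume "gcd x L dvd gcd y L"
    then have "f (gcd y L) \<le> f (gcd x L)"
      unfolding f_def free_numbers_iff int_dvd_int_iff of_bool_def by (smt (verit) dvd_trans)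
    then show "f y \<le> f x" by (simp flip: fgcd)
  qed
  moreover have "antitone_wrt (\<lambda>m n. gcd m L dvd gcd n L) {..<L} g"
    unfolding antitone_wrt_def
  proof (intro ballI impI)
    fix x y assume "gcd x L dvd gcd y L"
    then have "gcd x L \<le> gcd y L" using L by (intro dvd_imp_le) auto
    then show "g y \<le> g x" by (simp add: g_def)
  qed
  ultimately have H: "sum f {..<L} * sum g {..<L} \<le> real L * (\<Sum>n<L. f n * g n)"
    using harris_residues[OF L] by (simp add: harris_def)
  \<comment> \<open>The value \<open>d\<close> of the gcd is taken by \<open>totient (L div d)\<close> residues, which is \<open>totient L / d\<close>.\<close>
  have by_gcd: "(\<Sum>n<L. h (gcd n L) * g n) = totient L * (\<Sum>d=1..N. h d / d)" for h :: "nat \<Rightarrow> real"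
  proof -
    have "(\<Sum>n<L. h (gcd n L) * g n) = (\<Sum>n\<in>{0<..L}. h (gcd n L) * g n)"
    proof -
      have "{..<L} = insert 0 {0<..<L}" "{0<..L} = insert L {0<..<L}" using L by auto
      then have "sum F {..<L} = sum F {0<..L}" if "F 0 = F L" for F :: "nat \<Rightarrow> real"
        using that by simp
      then show ?thesis by (simp add: g_def del: sum_mult_of_bool_eq)
    qed
    also have "\<dots> = (\<Sum>n\<in>{n\<in>{0<..L}. gcd n L \<in> {1..N}}. h (gcd n L))"
      unfolding sum.inter_filter[OF finite_greaterThanAtMost]
      using L by (intro sum.cong) (auto simp: g_def Suc_le_eq)
    also have "\<dots> = (\<Sum>d=1..N. \<Sum>n\<in>{n\<in>{n\<in>{0<..L}. gcd n L \<in> {1..N}}. gcd n L = d}. h (gcd n L))"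
      by (rule sum.group[symmetric]) auto
    also have "\<dots> = (\<Sum>d=1..N. real (totient (L div d)) * h d)"
    proof (intro sum.cong refl)
      fix d assume d: "d \<in> {1..N}"
      then have "d dvd L" using N[OF d] by (simp add: L_def power2_eq_square)
      have "{n\<in>{n\<in>{0<..L}. gcd n L \<in> {1..N}}. gcd n L = d} = {n\<in>{0<..L}. gcd n L = d}" using d by auto
      then show "(\<Sum>n\<in>{n\<in>{n\<in>{0<..L}. gcd n L \<in> {1..N}}. gcd n L = d}. h (gcd n L)) = real (totient (L div d)) * h d"
        using card_gcd_eq_totient[OF L \<open>d dvd L\<close>] by simp
    qed
    also have "\<dots> = (\<Sum>d=1..N. totient L * (h d / d))"
      using totient_div_of_square[OF N A] by (intro sum.cong refl) (simp add: L_def)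
    finally show ?thesis by (simp add: sum_distrib_left)
  qed
  have "sum g {..<L} = totient L * harm N"
    using by_gcd[of "\<lambda>_. 1"] by (simp add: harm_def divide_inverse)
  moreover have "(\<Sum>n<L. f n * g n) = totient L * log_sum (free_numbers K) N"
  proof -
    have "(\<Sum>n<L. f n * g n) = (\<Sum>n<L. f (gcd n L) * g n)" 
      by (intro sum.cong refl) (subst fgcd, rule refl)
    also have "\<dots> = totient L * log_sum (free_numbers K) N"
      unfolding by_gcd log_sum_eq by (auto simp: f_def intro!: sum.cong arg_cong[of _ _ "(*) _"])
    finally show ?thesis .
  qed
  moreover have "sum f {..<L} = card {n. n < L \<and> int n \<in> free_numbers K}"
    by (simp add: f_def Int_def)
  ultimately have "real (totient L) * (card {n. n < L \<and> int n \<in> free_numbers K} * harm N)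
      \<le> real (totient L) * (L * log_sum (free_numbers K) N)"
    using H by (simp add: mult_ac)
  then have "card {n. n < L \<and> int n \<in> free_numbers K} * harm N \<le> L * log_sum (free_numbers K) N"
    using L by simp
  then show ?thesis using L unfolding L_def[symmetric] by (simp add: divide_le_eq mult_ac)
qed

lemma free_numbers_add_period:
  assumes "\<And>c. c \<in> K \<Longrightarrow> c dvd L"
  shows "a + int L \<in> free_numbers K \<longleftrightarrow> a \<in> free_numbers K"
proof -
  have "int c dvd a + int L \<longleftrightarrow> int c dvd a" if "c \<in> K" for c
    using assms[OF that] by (simp add: dvd_add_left_iff)
  then show ?thesis by (auto simp: free_numbers_iff)
qed

lemma has_log_density_multiples_finite:
  assumes "finite K" "0 \<notin> K"
  shows "has_log_density (multiples_of K) (log_density (multiples_of K))"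
proof -
  have per: "a + int (\<Prod>K) \<in> free_numbers K \<longleftrightarrow> a \<in> free_numbers K" for a
    by (rule free_numbers_add_period) (use assms in \<open>auto intro: dvd_prodI\<close>)
  have pos: "\<Prod>K > 0" using assms by (metis gr0I prod_zero_iff)
  from has_log_density_periodic[OF pos per]
  obtain d where "has_log_density (free_numbers K) d" by blast
  then have "has_log_density (multiples_of K) (1 - d)"
    using has_log_density_Compl[of "free_numbers K" d] by (simp add: free_numbers_eq)
  then show ?thesis using has_log_density_imp_eq by simp
qed

text \<open>
  The finite form of the Davenport-Erdos theorem: the bound holds for every \<open>N\<close>
  without an error term, hence it survives the passage to infinite sets.
\<close>

lemma log_sum_multiples_le:
  assumes K: "finite K" "0 \<notin> K"
  shows "log_sum (multiples_of K) N \<le> log_density (multiples_of K) * harm N"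
proof -
  \<comment> \<open>All \<open>d\<close> up to \<open>N\<close> have to divide \<open>A\<close>, and all elements of \<open>K\<close> the modulus \<open>A\<^sup>2\<close>.\<close>
  define A where "A = fact N * \<Prod>K"
  have pos: "\<Prod>K > 0" using K by (metis gr0I prod_zero_iff)
  then have A: "A > 0" by (simp add: A_def)
  have KA: "c dvd A\<^sup>2" if "c \<in> K" for c
  proof -
    have "c dvd A" using K(1) that by (auto simp: A_def intro!: dvd_mult dvd_prodI)
    then show ?thesis by (simp add: power2_eq_square)
  qed
  have "d dvd A" if "d \<in> {1..N}" for d
    using that by (auto simp: A_def intro!: dvd_mult2 dvd_fact)
  then have ge: "card {n. n < A\<^sup>2 \<and> int n \<in> free_numbers K} / real (A\<^sup>2) * harm N
      \<le> log_sum (free_numbers K) N"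
    by (intro log_sum_free_numbers_ge_period A KA)
  have "has_log_density (free_numbers K) (card {j. j < A\<^sup>2 \<and> int j \<in> free_numbers K} / real (A\<^sup>2))"
    using A free_numbers_add_period[OF KA] by (intro has_log_density_periodic) auto
  moreover have "has_log_density (free_numbers K) (1 - log_density (multiples_of K))"
    unfolding free_numbers_eq by (intro has_log_density_Compl has_log_density_multiples_finite K)
  ultimately have "card {j. j < A\<^sup>2 \<and> int j \<in> free_numbers K} / real (A\<^sup>2) = 1 - log_density (multiples_of K)"
    by (rule has_log_density_unique)
  from ge[unfolded this] have "(1 - log_density (multiples_of K)) * harm N \<le> log_sum (free_numbers K) N" .
  moreover have "log_sum (free_numbers K) N = harm N - log_sum (multiples_of K) N"
    using log_sum_Diff[of "multiples_of K" UNIV N] by (simp add: free_numbers_def log_sum_UNIV)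
  ultimately show ?thesis by (simp add: algebra_simps)
qed

text \<open>
  The lower bound comes from finite subsets. For the upper bound only the elements up to
  \<open>N\<close> matter for the sum up to \<open>N\<close>, and the finite bound has no error
  term.
\<close>

theorem davenport_erdos:
  assumes B: "0 \<notin> B"
  shows "has_log_density (multiples_of B) (SUP K\<in>{K. finite K \<and> K \<subseteq> B}. log_density (multiples_of K))"
    (is "has_log_density _ ?S")
proof -
  let ?F = "{K. finite K \<and> K \<subseteq> B}"
  have dens: "has_log_density (multiples_of K) (log_density (multiples_of K))" if "K \<in> ?F" for K
    using that B by (intro has_log_density_multiples_finite) auto
  have bdd: "bdd_above ((\<lambda>K. log_density (multiples_of K)) ` ?F)"
    using has_log_density_mono[OF dens has_log_density_UNIV] by (intro bdd_aboveI2[of _ _ 1]) auto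
  have upper: "log_sum (multiples_of B) N \<le> ?S * harm N" for N
  proof -
    \<comment> \<open>Larger elements of \<open>B\<close> have no multiples in \<open>{1..N}\<close>.\<close>
    let ?K = "B \<inter> {..N}"
    have "log_sum (multiples_of B) N = log_sum (multiples_of ?K) N"
      unfolding log_sum_eq
    proof (intro sum.cong refl)
      fix k assume "k \<in> {1..N}"
      then have "int k \<in> multiples_of B \<longleftrightarrow> int k \<in> multiples_of ?K"
        by (fastforce simp: multiples_of_iff int_dvd_int_iff dest: dvd_imp_le)
      then show "(if int k \<in> multiples_of B then 1 / real k else 0) =
          (if int k \<in> multiples_of ?K then 1 / real k else 0)" by simp
    qed
    also have "\<dots> \<le> log_density (multiples_of ?K) * harm N"
      using B by (intro log_sum_multiples_le) auto
    also have "\<dots> \<le> ?S * harm N"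
      by (intro mult_right_mono cSUP_upper bdd) (auto simp: harm_nonneg)
    finally show ?thesis .
  qed
  show ?thesis
    unfolding has_log_density_def
  proof (rule order_tendstoI)
    fix a assume "a < ?S"
    then obtain K where K: "K \<in> ?F" "a < log_density (multiples_of K)"
      using less_cSUP_iff[OF _ bdd] by auto
    have "\<forall>\<^sub>F N in sequentially. a < log_sum (multiples_of K) N / ln (real N)"
      using dens[OF K(1)] K(2) order_tendstoD(1) unfolding has_log_density_def by blast
    moreover have "log_sum (multiples_of K) N \<le> log_sum (multiples_of B) N" for N
      using K(1) by (intro log_sum_mono) (auto simp: multiples_of_def)
    then have "\<forall>\<^sub>F N in sequentially. log_sum (multiples_of K) N \<le> log_sum (multiples_of B) N"
      by simp
    ultimately show "\<forall>\<^sub>F N in sequentially. a < log_sum (multiples_of B) N / ln (real N)"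
      using eventually_ge_at_top[of 1]
    proof eventually_elim
      case (elim N)
      then have "log_sum (multiples_of K) N / ln (real N) \<le> log_sum (multiples_of B) N / ln (real N)"
        by (intro divide_right_mono) auto
      with elim show ?case by simp
    qed
  next
    fix a assume "?S < a"
    have "(\<lambda>N. ?S * (harm N / ln (real N))) \<longlonglongrightarrow> ?S * 1"
      by (intro tendsto_mult tendsto_const harm_div_ln_tendsto)
    with \<open>?S < a\<close> have "\<forall>\<^sub>F N in sequentially. ?S * (harm N / ln (real N)) < a"
      using order_tendstoD(2) by fastforce
    then show "\<forall>\<^sub>F N in sequentially. log_sum (multiples_of B) N / ln (real N) < a"
      using eventually_ge_at_top[of 1]
    proof eventually_elim
      case (elim N)
      have "log_sum (multiples_of B) N / ln (real N) \<le> ?S * harm N / ln (real N)"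
        using elim by (intro divide_right_mono upper) auto
      with elim show ?case by simp
    qed
  qed
qed

section \<open>Moving the zero class without creating divisors\<close>

lemma dvd_from_prime_powers:
  fixes c n :: nat
  assumes "c > 0" and "\<And>p k. prime p \<Longrightarrow> p ^ k dvd c \<Longrightarrow> p ^ k dvd n"
  shows "c dvd n"
proof (cases "n = 0")
  case False
  show ?thesis
  proof (rule multiplicity_le_imp_dvd)
    fix p :: nat assume "prime p"
    then show "multiplicity p c \<le> multiplicity p n"
      using False assms(2)[of p "multiplicity p c"] by (intro multiplicity_geI) (auto simp: multiplicity_dvd)
  qed (use assms(1) in simp)
qed simp

text \<open>
  Let \<open>q = b / gcd b s\<close> and \<open>t = s * (1 - q ^ M)\<close> with \<open>M\<close>
  divisible by many totients. For primes not dividing \<open>q\<close>, Euler's theorem makes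
  \<open>t\<close> divisible by all relevant prime powers, so divisibility of \<open>n + t\<close>
  and of \<open>n\<close> agree. For primes dividing \<open>q\<close>, the number \<open>s\<close>
  contains a lower power than \<open>b\<close> does, so \<open>n + t\<close> contains exactly that
  lower power, which divides \<open>n\<close> as well.
\<close>

lemma translation_into_class:
  fixes b :: nat and K :: "nat set" and s :: int
  assumes b: "b > 0" and K: "finite K" "0 \<notin> K" and s: "\<not> int b dvd s"
  obtains t where "[t = s] (mod int b)"
    and "\<And>n c. int b dvd n \<Longrightarrow> c \<in> K \<Longrightarrow> int c dvd n + t \<Longrightarrow> int c dvd n"
proof
  define d where "d = gcd b (nat \<bar>s\<bar>)"
  define q where "q = b div d"
  have d: "d dvd b" "int d dvd s"
    using dvd_nat_abs_iff[of d s] by (simp_all only: d_def gcd_dvd1 gcd_dvd2)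
  have bq: "b = q * d" using d by (simp add: q_def)
  have q0: "q > 0" using b bq by (metis mult_0 neq0_conv)
  define J where "J = Max (insert 1 K)"
  have J: "J \<ge> 1" "\<And>c. c \<in> K \<Longrightarrow> c \<le> J" using K(1) by (auto simp: J_def)
  \<comment> \<open>The totient of each prime power dividing an element of \<open>K\<close> is at most \<open>J\<close>, so it divides \<open>fact J\<close>.\<close>
  define t where "t = s * (1 - int q ^ fact J)"
  have bs: "int b dvd s * int q ^ fact J"
  proof -
    have "int b dvd s * int q"
      using d(2) unfolding bq by (auto simp: mult_ac intro: mult_dvd_mono)
    moreover have "int q dvd int q ^ fact J" by (simp add: dvd_power)
    ultimately show ?thesis by (meson dvd_trans mult_dvd_mono dvd_refl)
  qed
  show "[t = s] (mod int b)"
    using bs unfolding t_def cong_iff_dvd_diff by (simp add: algebra_simps)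
  show "int c dvd n" if n: "int b dvd n" and c: "c \<in> K" and cn: "int c dvd n + t" for n c
  proof -
    have c0: "c > 0" using c K(2) by (metis neq0_conv)
    have "c dvd nat \<bar>n\<bar>"
    proof (rule dvd_from_prime_powers[OF c0])
      fix p k :: nat assume p: "prime p" and pk: "p ^ k dvd c"
      have pkn: "int p ^ k dvd n + t" using pk cn by (metis dvd_trans int_dvd_int_iff of_nat_power)
      show "p ^ k dvd nat \<bar>n\<bar>"
      proof (cases "p dvd q")
        case False
        have "p ^ k \<le> J" using J(2)[OF c] dvd_imp_le[OF pk c0] by simp
        then have "totient (p ^ k) \<le> J" using totient_le le_trans by blast
        moreover have "totient (p ^ k) \<ge> 1" using p by (simp add: Suc_le_eq prime_gt_0_nat)
        ultimately have "totient (p ^ k) dvd fact J" by (simp add: dvd_fact)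
        then obtain m where m: "fact J = totient (p ^ k) * m" by blast
        have "coprime q (p ^ k)" using False p by (simp add: prime_imp_coprime coprime_commute)
        then have "[q ^ totient (p ^ k) = 1] (mod p ^ k)" by (rule euler_theorem)
        then have "[q ^ fact J = 1] (mod p ^ k)" unfolding m power_mult by (metis cong_pow power_one)
        then have "[int q ^ fact J = 1] (mod int p ^ k)"
          using cong_int_iff by (metis of_nat_1 of_nat_power)
        then have "int p ^ k dvd 1 - int q ^ fact J" by (metis cong_iff_dvd_diff cong_sym)
        then have "int p ^ k dvd t" by (simp add: t_def)
        with pkn have "int p ^ k dvd n" by (simp add: dvd_add_left_iff)
        then show ?thesis by (simp add: dvd_nat_abs_iff)
      next
        case True
        define e where "e = multiplicity p b"
        have s0: "s \<noteq> 0" using s by auto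
        have pu: "\<not> is_unit p" using p by auto
        have peb: "p ^ e dvd b" by (simp add: e_def multiplicity_dvd)
        have pes: "\<not> int p ^ e dvd s"
        proof
          assume "int p ^ e dvd s"
          then have "p ^ e dvd nat \<bar>s\<bar>"
            by (simp add: dvd_nat_abs_iff)
          then have "p ^ e dvd d" unfolding d_def by (rule gcd_greatest[OF peb])
          then have "p ^ e * p dvd b" using mult_dvd_mono[OF _ True] by (simp add: bq mult.commute[of q])
          then have "p ^ Suc e dvd b" by (simp add: mult.commute)
          then have "Suc e \<le> multiplicity p b" using b pu by (intro multiplicity_geI) auto
          then show False by (simp add: e_def)
        qed
        have en: "int p ^ e dvd n" using peb n by (metis dvd_trans int_dvd_int_iff of_nat_power)
        have es: "int p ^ e dvd s * int q ^ fact J" using peb bs by (metis dvd_trans int_dvd_int_iff of_nat_power)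
        have "k < e"
        proof (rule ccontr)
          assume "\<not> k < e"
          then have "int p ^ e dvd n + t" using pkn by (meson dvd_trans le_imp_power_dvd not_less)
          then have "int p ^ e dvd s - s * int q ^ fact J"
            using dvd_add_right_iff[OF en, of t] by (simp add: t_def right_diff_distrib)
          with es have "int p ^ e dvd s" by (metis diff_add_cancel dvd_add)
          with pes show False ..
        qed
        then have "int p ^ k dvd n" using en by (meson dvd_trans le_imp_power_dvd less_imp_le)
        then show ?thesis by (simp add: dvd_nat_abs_iff)
      qed
    qed
    then show "int c dvd n" by (simp add: dvd_nat_abs_iff)
  qed
qed

section \<open>The odometer and its Haar measure\<close>

definition residue_cylinder :: "nat set \<Rightarrow> nat set \<Rightarrow> int \<Rightarrow> (nat \<Rightarrow> int) set" where
  "residue_cylinder B K m = {g \<in> odometer_carrier B. \<forall>b\<in>K. g b = m mod int b}"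

lemma residue_carrier:
  assumes "0 \<notin> B" "b \<in> B"
  shows "carrier (integer_mod_group b) = {0..<int b}"
  using assms by (metis carrier_integer_mod_group)

lemma topspace_residue_topology:
  "topspace (residue_topology B) = (\<Pi>\<^sub>E b\<in>B. carrier (integer_mod_group b))"
  by (simp add: residue_topology_def)

lemma openin_residue_cylinder:
  assumes "finite K" "K \<subseteq> B" and g: "g \<in> topspace (residue_topology B)"
  shows "openin (residue_topology B) {h \<in> topspace (residue_topology B). \<forall>b\<in>K. h b = g b}"
proof -
  define X where "X = (\<lambda>b. if b \<in> K then {g b} else carrier (integer_mod_group b))"
  have "X b \<subseteq> carrier (integer_mod_group b)" for b
    using g assms(2) by (auto simp: X_def topspace_residue_topology)
  moreover have "finite {b. X b \<noteq> carrier (integer_mod_group b)}"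
    using assms(1) by (rule rev_finite_subset) (auto simp: X_def)
  ultimately have "openin (residue_topology B) (Pi\<^sub>E B X)"
    unfolding residue_topology_def by (intro product_topology_basis) auto
  moreover have "Pi\<^sub>E B X = {h \<in> topspace (residue_topology B). \<forall>b\<in>K. h b = g b}"
  proof (rule Set.set_eqI)
    fix h
    have "h \<in> Pi\<^sub>E B X \<longleftrightarrow> (\<forall>b\<in>B. h b \<in> X b) \<and> h \<in> extensional B" by (simp only: PiE_iff)
    also have "(\<forall>b\<in>B. h b \<in> X b) \<longleftrightarrow> (\<forall>b\<in>B. h b \<in> carrier (integer_mod_group b)) \<and> (\<forall>b\<in>K. h b = g b)"
      using assms(2) g unfolding X_def topspace_residue_topology PiE_iff
      by (metis (no_types, lifting) singleton_iff subsetD)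
    finally show "h \<in> Pi\<^sub>E B X \<longleftrightarrow> h \<in> {h \<in> topspace (residue_topology B). \<forall>b\<in>K. h b = g b}"
      unfolding topspace_residue_topology mem_Collect_eq PiE_iff by blast
  qed
  ultimately show ?thesis by simp
qed

lemma residue_topology_contains_cylinder:
  assumes "openin (residue_topology B) U" "g \<in> U"
  shows "\<exists>K. finite K \<and> K \<subseteq> B \<and> {h \<in> topspace (residue_topology B). \<forall>b\<in>K. h b = g b} \<subseteq> U"
proof -
  obtain X where X: "g \<in> Pi\<^sub>E B X"
      "finite {b. X b \<noteq> carrier (integer_mod_group b)}" "Pi\<^sub>E B X \<subseteq> U"
    using product_topology_open_contains_basis[OF assms[unfolded residue_topology_def]]
    unfolding topspace_discrete_topology by (elim exE conjE)
  show ?thesis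
  proof (intro exI conjI)
    let ?K = "B \<inter> {b. X b \<noteq> carrier (integer_mod_group b)}"
    show "finite ?K" "?K \<subseteq> B" using X(2) by auto
    show "{h \<in> topspace (residue_topology B). \<forall>b\<in>?K. h b = g b} \<subseteq> U"
    proof
      fix h assume "h \<in> {h \<in> topspace (residue_topology B). \<forall>b\<in>?K. h b = g b}"
      then have h: "h \<in> topspace (residue_topology B)" "\<And>b. b \<in> ?K \<Longrightarrow> h b = g b" by auto
      have "h \<in> Pi\<^sub>E B X"
      proof (rule PiE_I)
        fix b assume "b \<in> B"
        with h X(1) show "h b \<in> X b"
          by (cases "b \<in> ?K") (auto simp: topspace_residue_topology PiE_iff)
      next
        fix b assume "b \<notin> B"
        with h(1) show "h b = undefined" by (auto simp: topspace_residue_topology PiE_iff extensional_def)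
      qed
      with X(3) show "h \<in> U" by blast
    qed
  qed
qed

lemma residues_of_in_topspace:
  "0 \<notin> B \<Longrightarrow> residues_of B n \<in> topspace (residue_topology B)"
  by (auto simp: topspace_residue_topology residues_of_def residue_carrier)
     (metis gr0I of_nat_0_less_iff pos_mod_sign pos_mod_bound)+

text \<open>
  Neighbourhoods restrict finitely many coordinates, so a point lies in the closure if and only if
  each finite set of its coordinates comes from an integer.
\<close>

lemma odometer_carrier_iff:
  assumes B: "0 \<notin> B"
  shows "g \<in> odometer_carrier B \<longleftrightarrow>
    g \<in> extensional B \<and> (\<forall>K. finite K \<and> K \<subseteq> B \<longrightarrow> (\<exists>m. \<forall>b\<in>K. g b = m mod int b))"
    (is "_ \<longleftrightarrow> ?R")
proof
  assume g: "g \<in> odometer_carrier B"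
  then have top: "g \<in> topspace (residue_topology B)"
    and cl: "\<And>T. g \<in> T \<Longrightarrow> openin (residue_topology B) T \<Longrightarrow> \<exists>m. residues_of B m \<in> T"
    unfolding odometer_carrier_def in_closure_of by auto
  show ?R
  proof (intro conjI allI impI)
    show "g \<in> extensional B" using top by (simp add: topspace_residue_topology PiE_iff)
    fix K assume K: "finite K \<and> K \<subseteq> B"
    then obtain m where "\<forall>b\<in>K. residues_of B m b = g b"
      using cl[OF _ openin_residue_cylinder[OF _ _ top, of K]] top by auto
    then have "\<forall>b\<in>K. g b = m mod int b" using K unfolding residues_of_def
      by (metis restrict_apply' subsetD)
    then show "\<exists>m. \<forall>b\<in>K. g b = m mod int b" ..
  qed
next
  assume R: ?R
  have top: "g \<in> topspace (residue_topology B)"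
    unfolding topspace_residue_topology
  proof (rule PiE_I)
    fix b assume b: "b \<in> B"
    with R have "\<exists>m. \<forall>c\<in>{b}. g c = m mod int c" by blast
    moreover have "int b > 0" using b B by (metis neq0_conv of_nat_0_less_iff)
    ultimately show "g b \<in> carrier (integer_mod_group b)"
      using b B by (auto simp: residue_carrier)
  next
    fix b assume "b \<notin> B"
    with R show "g b = undefined" by (auto simp: extensional_def)
  qed
  show "g \<in> odometer_carrier B"
    unfolding odometer_carrier_def in_closure_of
  proof (intro conjI top allI impI)
    fix T assume T: "g \<in> T \<and> openin (residue_topology B) T"
    then obtain K where K: "finite K" "K \<subseteq> B"
      "{h \<in> topspace (residue_topology B). \<forall>b\<in>K. h b = g b} \<subseteq> T"
      using residue_topology_contains_cylinder[of B T g] by blast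
    from R K obtain m where "\<forall>b\<in>K. g b = m mod int b" by blast
    then have "\<forall>b\<in>K. residues_of B m b = g b" using K(2) by (auto simp: residues_of_def)
    with K(3) have "residues_of B m \<in> T" using residues_of_in_topspace[OF B] by blast
    then show "\<exists>y. y \<in> range (residues_of B) \<and> y \<in> T" by blast
  qed
qed

lemma odometer_carrier_subset: "odometer_carrier B \<subseteq> topspace (residue_topology B)"
  unfolding odometer_carrier_def by (rule closure_of_subset_topspace)

lemma residues_of_in_carrier: "0 \<notin> B \<Longrightarrow> residues_of B n \<in> odometer_carrier B"
  by (auto simp: odometer_carrier_iff residues_of_def)

lemma openin_odometer_cylinder:
  assumes "0 \<notin> B" "finite K" "K \<subseteq> B"
  shows "openin (odometer_topology B) (residue_cylinder B K m)"
proof -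
  have "residue_cylinder B K m =
      {h \<in> topspace (residue_topology B). \<forall>b\<in>K. h b = residues_of B m b} \<inter> odometer_carrier B"
    using assms odometer_carrier_subset[of B] by (auto simp: residue_cylinder_def residues_of_def)
  with openin_residue_cylinder[OF assms(2,3) residues_of_in_topspace[OF assms(1)]] show ?thesis
    unfolding odometer_topology_def openin_subtopology by blast
qed

text \<open>
  There are countably many cylinders, so this decomposition makes them generators of the Borel
  sets.
\<close>

lemma openin_odometer_imp_Union_cylinders:
  assumes B: "0 \<notin> B" and U: "openin (odometer_topology B) U"
  shows "U = (\<Union>(K, m) \<in> {(K, m). finite K \<and> K \<subseteq> B \<and> residue_cylinder B K m \<subseteq> U}. residue_cylinder B K m)"
proof (intro equalityI subsetI)
  fix g assume g: "g \<in> U"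
  obtain T where T: "openin (residue_topology B) T" "U = T \<inter> odometer_carrier B"
    using U unfolding odometer_topology_def openin_subtopology by blast
  then have "g \<in> T" using g by simp
  with T(1) obtain K where K: "finite K" "K \<subseteq> B"
      "{h \<in> topspace (residue_topology B). \<forall>b\<in>K. h b = g b} \<subseteq> T"
    using residue_topology_contains_cylinder[OF T(1) \<open>g \<in> T\<close>] by blast
  obtain m where m: "\<forall>b\<in>K. g b = m mod int b"
    using g K(1,2) T(2) odometer_carrier_iff[OF B, of g] by blast
  have "residue_cylinder B K m \<subseteq> U"
    using K(3) m odometer_carrier_subset[of B] by (auto simp: T(2) residue_cylinder_def)
  moreover have "g \<in> residue_cylinder B K m" using g m T(2) by (simp add: residue_cylinder_def)
  ultimately show "g \<in> (\<Union>(K, m) \<in> {(K, m). finite K \<and> K \<subseteq> B \<and> residue_cylinder B K m \<subseteq> U}. residue_cylinder B K m)"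
    using K by blast
qed auto

definition rotate_by :: "nat set \<Rightarrow> int \<Rightarrow> (nat \<Rightarrow> int) \<Rightarrow> (nat \<Rightarrow> int)" where
  "rotate_by B n g = (\<lambda>b\<in>B. (g b + n) mod int b)"

lemma odometer_rotation_eq: "odometer_rotation B = rotate_by B 1"
  by (auto simp: odometer_rotation_def rotate_by_def odometer_group_def residues_of_def fun_eq_iff mod_simps)

lemma odometer_mult_residues: "residues_of B n \<otimes>\<^bsub>odometer_group B\<^esub> g = rotate_by B n g"
  by (auto simp: rotate_by_def odometer_group_def residues_of_def fun_eq_iff mod_simps add.commute)

lemma rotate_by_add: "rotate_by B m (rotate_by B n g) = rotate_by B (m + n) g"
  by (auto simp: rotate_by_def fun_eq_iff mod_simps algebra_simps)

lemma rotate_by_apply: "b \<in> B \<Longrightarrow> rotate_by B n g b = (g b + n) mod int b"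
  by (simp add: rotate_by_def)

locale haar_odometer =
  fixes B :: "nat set" and P :: "(nat \<Rightarrow> int) measure"
  assumes zero_notin: "0 \<notin> B"
    and haar: "normalized_haar (odometer_group B) (odometer_topology B) P"
begin

abbreviation "G \<equiv> odometer_carrier B"

lemma carrier_odometer_group: "carrier (odometer_group B) = G"
  by (simp add: odometer_group_def)

lemma haarD:
  shows "prob_space P" and space_P: "space P = G"
    and sets_P_open: "sets P = sigma_sets G {U. openin (odometer_topology B) U}"
    and haar_invariant:
      "\<lbrakk>g \<in> G; A \<in> sets P\<rbrakk> \<Longrightarrow> emeasure P ((\<lambda>x. g \<otimes>\<^bsub>odometer_group B\<^esub> x) ` A) = emeasure P A"
  using haar unfolding normalized_haar_def carrier_odometer_group by blast+

sublocale prob_space P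
  by (rule haarD(1))

lemma carrier_representative:
  assumes "g \<in> G" "finite K" "K \<subseteq> B"
  obtains m where "\<forall>b\<in>K. g b = m mod int b"
  using assms odometer_carrier_iff[OF zero_notin, of g] by blast

lemma carrier_mod:
  assumes "g \<in> G" "b \<in> B"
  shows "g b mod int b = g b"
proof -
  have "finite {b} \<and> {b} \<subseteq> B" using assms by simp
  with assms(1) obtain m where "\<forall>c\<in>{b}. g c = m mod int c"
    unfolding odometer_carrier_iff[OF zero_notin] by blast
  then have "g b = m mod int b" by simp
  then show ?thesis by simp
qed

lemma carrier_range: "g \<in> G \<Longrightarrow> b \<in> B \<Longrightarrow> 0 \<le> g b \<and> g b < int b"
  using carrier_mod[of g b] zero_notin pos_mod_bound[of "int b" "g b"] pos_mod_sign[of "int b" "g b"]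
  by (cases "b = 0") auto

lemma rotate_by_0: "g \<in> G \<Longrightarrow> rotate_by B 0 g = g"
  using odometer_carrier_iff[OF zero_notin, of g]
  by (intro extensionalityI[of _ B]) (simp_all add: rotate_by_def carrier_mod)

lemma rotate_by_carrier: "g \<in> G \<Longrightarrow> rotate_by B n g \<in> G"
  unfolding odometer_carrier_iff[OF zero_notin]
proof (intro conjI allI impI)
  fix K assume g: "g \<in> extensional B \<and> (\<forall>K. finite K \<and> K \<subseteq> B \<longrightarrow> (\<exists>m. \<forall>b\<in>K. g b = m mod int b))"
    and K: "finite K \<and> K \<subseteq> B"
  then obtain m where "\<forall>b\<in>K. g b = m mod int b" by blast
  then have "\<forall>b\<in>K. rotate_by B n g b = (m + n) mod int b"
    using K by (auto simp: rotate_by_def mod_add_left_eq)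
  then show "\<exists>m. \<forall>b\<in>K. rotate_by B n g b = m mod int b" ..
qed (simp add: rotate_by_def)

lemma rotate_by_inverse: "g \<in> G \<Longrightarrow> rotate_by B (- n) (rotate_by B n g) = g"
  by (simp add: rotate_by_add rotate_by_0)

lemma rotate_by_image:
  assumes "A \<subseteq> G"
  shows "rotate_by B n ` A = {g \<in> G. rotate_by B (- n) g \<in> A}"
proof (intro equalityI subsetI)
  fix g assume "g \<in> {g \<in> G. rotate_by B (- n) g \<in> A}"
  then show "g \<in> rotate_by B n ` A"
    using rotate_by_inverse[of g "- n"] by (auto intro!: image_eqI[of _ _ "rotate_by B (- n) g"])
next
  fix g assume "g \<in> rotate_by B n ` A"
  then show "g \<in> {g \<in> G. rotate_by B (- n) g \<in> A}"
    using assms by (auto simp: rotate_by_inverse intro: rotate_by_carrier)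
qed

lemma residue_cylinder_measurable [measurable]:
  "finite K \<Longrightarrow> K \<subseteq> B \<Longrightarrow> residue_cylinder B K m \<in> sets P"
  unfolding sets_P_open by (intro sigma_sets.Basic CollectI openin_odometer_cylinder zero_notin)

lemma sets_P_cylinders: "sets P = sigma_sets G {residue_cylinder B K m |K m. finite K \<and> K \<subseteq> B}"
  unfolding sets_P_open
proof (rule sigma_sets_eqI)
  let ?C = "{residue_cylinder B K m |K m. finite K \<and> K \<subseteq> B}"
  fix U assume "U \<in> {U. openin (odometer_topology B) U}"
  then have U: "U = (\<Union>(K, m) \<in> {(K, m). finite K \<and> K \<subseteq> B \<and> residue_cylinder B K m \<subseteq> U}. residue_cylinder B K m)"
    using openin_odometer_imp_Union_cylinders[OF zero_notin] by blast
  have cnt: "countable {(K, m :: int). finite K \<and> K \<subseteq> B \<and> residue_cylinder B K m \<subseteq> U}"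
    by (rule countable_subset[of _ "{K. finite K} \<times> UNIV"])
       (auto intro!: countable_SIGMA countable_Collect_finite)
  have "(\<Union>(K, m) \<in> {(K, m). finite K \<and> K \<subseteq> B \<and> residue_cylinder B K m \<subseteq> U}. residue_cylinder B K m) \<in> sigma_sets G ?C"
    by (rule sigma_sets_UNION[OF countable_image[OF cnt]]) (auto intro!: sigma_sets.Basic)
  with U show "U \<in> sigma_sets G ?C" by simp
next
  fix a assume "a \<in> {residue_cylinder B K m |K m. finite K \<and> K \<subseteq> B}"
  then show "a \<in> sigma_sets G {U. openin (odometer_topology B) U}"
    using openin_odometer_cylinder[OF zero_notin] by (blast intro: sigma_sets.Basic)
qed

lemma measurable_into_P:
  assumes "f \<in> space M \<rightarrow> G"
    and "\<And>K m. finite K \<Longrightarrow> K \<subseteq> B \<Longrightarrow> {x \<in> space M. \<forall>b\<in>K. f x b = m mod int b} \<in> sets M"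
  shows "f \<in> M \<rightarrow>\<^sub>M P"
proof (rule measurable_sigma_sets[OF sets_P_cylinders])
  show "{residue_cylinder B K m |K m. finite K \<and> K \<subseteq> B} \<subseteq> Pow G"
    by (auto simp: residue_cylinder_def)
  fix A assume "A \<in> {residue_cylinder B K m |K m. finite K \<and> K \<subseteq> B}"
  then obtain K m where A: "A = residue_cylinder B K m" "finite K" "K \<subseteq> B" by blast
  have "f -` A \<inter> space M = {x \<in> space M. \<forall>b\<in>K. f x b = m mod int b}"
    using assms(1) by (auto simp: A residue_cylinder_def)
  with assms(2)[OF A(2,3)] show "f -` A \<inter> space M \<in> sets M" by simp
qed (rule assms(1))

lemma rotate_by_measurable [measurable]: "rotate_by B n \<in> P \<rightarrow>\<^sub>M P"
proof (rule measurable_into_P)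
  fix K m assume K: "finite K" "K \<subseteq> B"
  have "{g \<in> space P. \<forall>b\<in>K. rotate_by B n g b = m mod int b} = residue_cylinder B K (m - n)"
    unfolding residue_cylinder_def space_P
  proof (intro Collect_cong conj_cong ball_cong refl)
    fix g b assume "g \<in> G" "b \<in> K"
    then have "g b = g b mod int b" "b \<in> B" using carrier_mod K by auto
    then show "rotate_by B n g b = m mod int b \<longleftrightarrow> g b = (m - n) mod int b"
      by (metis rotate_by_apply add_diff_cancel_right' diff_add_cancel mod_add_left_eq mod_diff_left_eq)
  qed
  with K show "{g \<in> space P. \<forall>b\<in>K. rotate_by B n g b = m mod int b} \<in> sets P" by simp
qed (auto simp: space_P intro: rotate_by_carrier)

lemma distr_rotate_by: "distr P P (rotate_by B n) = P"
proof (rule measure_eqI)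
  fix A assume "A \<in> sets (distr P P (rotate_by B n))"
  then have A: "A \<in> sets P" by simp
  then have AG: "A \<subseteq> G" using sets.sets_into_space space_P by auto
  have "rotate_by B n -` A \<inter> space P = rotate_by B (- n) ` A"
    by (auto simp: rotate_by_image[OF AG] space_P)
  also have "\<dots> = (\<lambda>x. residues_of B (- n) \<otimes>\<^bsub>odometer_group B\<^esub> x) ` A"
    by (simp add: odometer_mult_residues)
  finally show "emeasure (distr P P (rotate_by B n)) A = emeasure P A"
    using A haar_invariant[OF residues_of_in_carrier[OF zero_notin] A]
    by (simp add: emeasure_distr del: mult_product_group)
qed simp

lemma prob_rotate_by: "A \<in> sets P \<Longrightarrow> prob {g \<in> G. rotate_by B n g \<in> A} = prob A"
  using measure_distr[OF rotate_by_measurable, of A n] distr_rotate_by[of n]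
  by (simp add: space_P vimage_def Int_def conj_commute)

text \<open>
  By invariance of the measure and of \<open>A\<close>, all rotates of \<open>V\<close> meet
  \<open>A\<close> in the same measure; the sum of the indicators of \<open>L\<close> rotates is
  constantly \<open>v\<close> on \<open>A\<close>.
\<close>

lemma averaging:
  fixes s :: int and L :: nat
  assumes A: "A \<in> sets P" and inv: "\<And>g j. g \<in> G \<Longrightarrow> rotate_by B (s * int j) g \<in> A \<longleftrightarrow> g \<in> A"
    and V: "V \<in> sets P" and v: "\<And>g. g \<in> A \<Longrightarrow> card {j. j < L \<and> rotate_by B (s * int j) g \<in> V} = v"
  shows "real L * prob (A \<inter> V) = real v * prob A"
proof -
  let ?E = "\<lambda>j. {g \<in> G. rotate_by B (s * int j) g \<in> A \<inter> V}"
  have E: "?E j \<in> sets P" for j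
    using measurable_sets[OF rotate_by_measurable[of "s * int j"], of "A \<inter> V"] A V
    by (simp add: space_P vimage_def Int_def conj_commute)
  have "real L * prob (A \<inter> V) = (\<Sum>j<L. prob (?E j))"
    using A V by (subst prob_rotate_by) auto
  also have "\<dots> = (\<integral>g. (\<Sum>j<L. indicator (?E j) g) \<partial>P)"
    using E by (subst Bochner_Integration.integral_sum) (auto simp: Int_absorb2 sets.sets_into_space emeasure_eq_measure)
  also have "\<dots> = (\<integral>g. real v * indicator A g \<partial>P)"
  proof (rule Bochner_Integration.integral_cong[OF refl])
    fix g assume g: "g \<in> space P"
    have "(\<Sum>j<L. indicator (?E j) g) = (if g \<in> A then real (card {j. j < L \<and> rotate_by B (s * int j) g \<in> V}) else 0)"
      using g inv[of g] by (auto simp: indicator_def space_P Int_def sum.If_cases)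
    then show "(\<Sum>j<L. indicator (?E j) g) = real v * indicator A g"
      using v by simp
  qed
  also have "\<dots> = real v * prob A" using A by (simp add: Int_absorb2 sets.sets_into_space)
  finally show ?thesis .
qed

end

section \<open>Logarithmic densities as Haar measures\<close>

context haar_odometer
begin

lemma prod_modulus:
  assumes "finite K" "K \<subseteq> B"
  shows "\<Prod>K > 0" "\<And>b. b \<in> K \<Longrightarrow> int b dvd int (\<Prod>K)"
proof -
  show "\<Prod>K > 0" using assms zero_notin by (metis gr0I prod_zero_iff subsetD)
  show "int b dvd int (\<Prod>K)" if "b \<in> K" for b
    using dvd_prodI[OF assms(1) that, of "\<lambda>x. x"] by (simp only: int_dvd_int_iff)
qed

text \<open>
  The truth of \<open>\<Phi>\<close> is constant on cylinders over \<open>K\<close>, and these are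
  indexed by integers, so the event is a countable union of cylinders.
\<close>

lemma cylinder_event_measurable:
  assumes K: "finite K" "K \<subseteq> B"
    and \<Phi>: "\<And>g h. (\<And>b. b \<in> K \<Longrightarrow> g b = h b) \<Longrightarrow> \<Phi> g \<longleftrightarrow> \<Phi> h"
  shows "{g \<in> G. \<Phi> g} \<in> sets P"
proof -
  have agree: "\<Phi> g \<longleftrightarrow> \<Phi> (residues_of B m)" if "g \<in> residue_cylinder B K m" for g m
    using that K(2) by (intro \<Phi>) (auto simp: residue_cylinder_def residues_of_def)
  have "{g \<in> G. \<Phi> g} = (\<Union>m\<in>{m. \<Phi> (residues_of B m)}. residue_cylinder B K m)"
  proof (intro equalityI subsetI)
    fix g assume g: "g \<in> {g \<in> G. \<Phi> g}"
    then obtain m where "\<forall>b\<in>K. g b = m mod int b" using carrier_representative[OF _ K] by blast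
    then have "g \<in> residue_cylinder B K m" using g by (simp add: residue_cylinder_def)
    with agree g show "g \<in> (\<Union>m\<in>{m. \<Phi> (residues_of B m)}. residue_cylinder B K m)" by blast
  next
    fix g assume "g \<in> (\<Union>m\<in>{m. \<Phi> (residues_of B m)}. residue_cylinder B K m)"
    with agree show "g \<in> {g \<in> G. \<Phi> g}" by (auto simp: residue_cylinder_def)
  qed
  then show ?thesis using K by auto
qed

text \<open>
  Both sides equal the proportion of good residues modulo the product of \<open>K\<close>: the
  density because the set is periodic, the measure by averaging over one period.
\<close>

lemma has_log_density_cylinder_event:
  assumes K: "finite K" "K \<subseteq> B"
    and \<Phi>: "\<And>g h. (\<And>b. b \<in> K \<Longrightarrow> g b = h b) \<Longrightarrow> \<Phi> g \<longleftrightarrow> \<Phi> h"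
  shows "has_log_density {n. \<Phi> (residues_of B n)} (prob {g \<in> G. \<Phi> g})"
proof -
  define L where "L = \<Prod>K"
  have L: "L > 0" using prod_modulus[OF K] by (simp add: L_def)
  define R where "R = (\<lambda>n. \<Phi> (residues_of B n))"
  have per: "R (a + int L) \<longleftrightarrow> R a" for a
    unfolding R_def
  proof (rule \<Phi>)
    fix b assume b: "b \<in> K"
    then obtain k where "int L = int b * k" using prod_modulus(2)[OF K] unfolding L_def by blast
    then show "residues_of B (a + int L) b = residues_of B a b" by (simp add: residues_of_def)
  qed
  have "real L * prob (G \<inter> {g \<in> G. \<Phi> g}) = real (card {j. j < L \<and> R (int j)}) * prob G"
  proof (rule averaging[where s = 1])
    show "G \<in> sets P" using sets.top[of P] by (simp add: space_P)
    show "{g \<in> G. \<Phi> g} \<in> sets P" using cylinder_event_measurable[OF K \<Phi>] .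
    fix g :: "nat \<Rightarrow> int" and j assume g: "g \<in> G"
    show "rotate_by B (1 * int j) g \<in> G \<longleftrightarrow> g \<in> G" using g rotate_by_carrier by blast
  next
    fix g assume g: "g \<in> G"
    then obtain m where m: "\<forall>b\<in>K. g b = m mod int b" using carrier_representative[OF _ K] by blast
    have "\<Phi> (rotate_by B (1 * int j) g) \<longleftrightarrow> R (m + int j)" for j
      unfolding R_def
    proof (rule \<Phi>)
      fix b assume "b \<in> K"
      then show "rotate_by B (1 * int j) g b = residues_of B (m + int j) b"
        using m K(2) by (auto simp: rotate_by_def residues_of_def mod_simps)
    qed
    then show "card {j. j < L \<and> rotate_by B (1 * int j) g \<in> {g \<in> G. \<Phi> g}} = card {j. j < L \<and> R (int j)}"
      using card_over_period[of R L m, OF per] rotate_by_carrier[OF g] by simp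
  qed
  moreover have "prob G = 1" using prob_space by (simp add: space_P)
  ultimately have "prob {g \<in> G. \<Phi> g} = card {j. j < L \<and> R (int j)} / L"
    using L by (simp add: field_simps Int_absorb1 Collect_conj_eq)
  moreover have "has_log_density {n. R n} (card {j. j < L \<and> int j \<in> {n. R n}} / L)"
    by (rule has_log_density_periodic[OF L]) (simp add: per)
  ultimately show ?thesis by (simp add: R_def)
qed

text \<open>
  For \<open>C = B\<close> this is the window of the coding: the points whose coding has a one at
  position 0.
\<close>

definition free_set :: "nat set \<Rightarrow> (nat \<Rightarrow> int) set" where
  "free_set C = {g \<in> G. \<forall>c\<in>C. g c \<noteq> 0}"

lemma class_measurable [measurable]:
  assumes "b \<in> B"
  shows "{g \<in> G. g b = j} \<in> sets P"
  by (rule cylinder_event_measurable[of "{b}"]) (use assms in auto)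

lemma free_set_measurable [measurable]:
  assumes "C \<subseteq> B"
  shows "free_set C \<in> sets P"
proof -
  have "free_set C = space P - (\<Union>c\<in>C. {g \<in> G. g c = 0})"
    by (auto simp: free_set_def space_P)
  also have "\<dots> \<in> sets P"
    using assms by (intro sets.Diff sets.top sets.countable_UN' class_measurable) auto
  finally show ?thesis .
qed

lemma prob_free_set_tendsto:
  assumes "C \<subseteq> B" "A \<in> sets P"
  shows "(\<lambda>N. prob (A \<inter> free_set (C \<inter> {..N}))) \<longlonglongrightarrow> prob (A \<inter> free_set C)"
proof -
  have "(\<lambda>N. prob (A \<inter> free_set (C \<inter> {..N}))) \<longlonglongrightarrow> prob (\<Inter>N. A \<inter> free_set (C \<inter> {..N}))"
  proof (rule finite_Lim_measure_decseq)
    show "range (\<lambda>N. A \<inter> free_set (C \<inter> {..N})) \<subseteq> sets P"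
      using assms by (auto intro!: sets.Int free_set_measurable)
    show "decseq (\<lambda>N. A \<inter> free_set (C \<inter> {..N}))" by (auto simp: decseq_def free_set_def)
  qed
  moreover have "(\<Inter>N. A \<inter> free_set (C \<inter> {..N})) = A \<inter> free_set C"
    by (auto simp: free_set_def)
  ultimately show ?thesis by simp
qed

lemma log_density_multiples_finite:
  assumes "finite K" "K \<subseteq> B"
  shows "log_density (multiples_of K) = 1 - prob (free_set K)"
proof -
  have "has_log_density {n. \<forall>c\<in>K. residues_of B n c \<noteq> 0} (prob (free_set K))"
    unfolding free_set_def
    by (rule has_log_density_cylinder_event[OF assms, of "\<lambda>g. \<forall>c\<in>K. g c \<noteq> 0"]) simp
  moreover have "{n. \<forall>c\<in>K. residues_of B n c \<noteq> 0} = - multiples_of K"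
  proof -
    have "residues_of B n c = 0 \<longleftrightarrow> int c dvd n" if "c \<in> K" for n c
      using that assms(2) by (auto simp: residues_of_def mod_eq_0_iff_dvd)
    then show ?thesis unfolding Compl_eq multiples_of_iff by blast
  qed
  ultimately have "has_log_density (multiples_of K) (1 - prob (free_set K))"
    using has_log_density_Compl[of "- multiples_of K"] by simp
  then show ?thesis by (rule has_log_density_imp_eq)
qed

text \<open>
  Tautness becomes a statement about Haar measure: the suprema over finite subsets in the
  Davenport-Erdos theorem are limits of measures of decreasing cylinder events.
\<close>

lemma has_log_density_multiples:
  assumes C: "C \<subseteq> B"
  shows "has_log_density (multiples_of C) (1 - prob (free_set C))"
proof -
  let ?F = "{K. finite K \<and> K \<subseteq> C}"
  have eq: "log_density (multiples_of K) = 1 - prob (free_set K)" if "K \<in> ?F" for K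
    using that C by (intro log_density_multiples_finite) auto
  have le: "log_density (multiples_of K) \<le> 1 - prob (free_set C)" if "K \<in> ?F" for K
    unfolding eq[OF that] using that C
    by (intro diff_left_mono finite_measure_mono free_set_measurable) (auto simp: free_set_def)
  have "(SUP K\<in>?F. log_density (multiples_of K)) = 1 - prob (free_set C)"
  proof (rule antisym)
    show "(SUP K\<in>?F. log_density (multiples_of K)) \<le> 1 - prob (free_set C)"
      using le by (intro cSUP_least) auto
    have "(\<lambda>N. 1 - prob (free_set (C \<inter> {..N}))) \<longlonglongrightarrow> 1 - prob (free_set C)"
      using prob_free_set_tendsto[OF C sets.top] C
      by (intro tendsto_intros) (simp add: Int_absorb1 free_set_def space_P Collect_conj_eq)
    moreover have "1 - prob (free_set (C \<inter> {..N})) \<le> (SUP K\<in>?F. log_density (multiples_of K))" for N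
      unfolding eq[of "C \<inter> {..N}", simplified, symmetric]
      using le by (intro cSUP_upper bdd_aboveI2[of _ _ "1 - prob (free_set C)"]) auto
    ultimately show "1 - prob (free_set C) \<le> (SUP K\<in>?F. log_density (multiples_of K))"
      by (intro LIMSEQ_le_const2) auto
  qed
  moreover have "0 \<notin> C" using C zero_notin by blast
  ultimately show ?thesis using davenport_erdos by metis
qed

section \<open>Tautness and the classes modulo an element of B\<close>

lemma taut_zero_class_pos:
  assumes taut: "taut B" and b: "b \<in> B"
  shows "prob ({g \<in> G. g b = 0} \<inter> free_set (B - {b})) > 0"
proof -
  have "log_density (multiples_of C) = 1 - prob (free_set C)" if "C \<subseteq> B" for C
    using has_log_density_multiples[OF that] by (rule has_log_density_imp_eq)
  then have "prob (free_set B) < prob (free_set (B - {b}))"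
    using taut b by (simp add: taut_def)
  moreover have "prob (free_set (B - {b}) - free_set B) = prob (free_set (B - {b})) - prob (free_set B)"
    by (intro finite_measure_Diff free_set_measurable) (auto simp: free_set_def)
  moreover have "free_set (B - {b}) - free_set B = {g \<in> G. g b = 0} \<inter> free_set (B - {b})"
    using b by (auto simp: free_set_def)
  ultimately show ?thesis by simp
qed

text \<open>
  For a finite part of \<open>B\<close>, a rotation by the integer of
  \<open>translation_into_class\<close> carries the left set into the right one; then pass to the
  limit.
\<close>

lemma zero_class_minimal:
  assumes b: "b \<in> B" and s: "\<not> int b dvd s"
  shows "prob ({g \<in> G. g b = 0} \<inter> free_set (B - {b})) \<le> prob ({g \<in> G. g b = s mod int b} \<inter> free_set B)"
proof (rule LIMSEQ_le_const)
  show "(\<lambda>N. prob ({g \<in> G. g b = s mod int b} \<inter> free_set (B \<inter> {..N})))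
      \<longlonglongrightarrow> prob ({g \<in> G. g b = s mod int b} \<inter> free_set B)"
    using b by (intro prob_free_set_tendsto class_measurable) auto
  have "prob ({g \<in> G. g b = 0} \<inter> free_set (B - {b}))
      \<le> prob ({g \<in> G. g b = s mod int b} \<inter> free_set (B \<inter> {..N}))" for N
  proof -
    let ?K = "B \<inter> {..N}" and ?Z = "{g \<in> G. g b = s mod int b} \<inter> free_set (B \<inter> {..N})"
    have b0: "b > 0" using b zero_notin by (metis neq0_conv)
    obtain t where t: "[t = s] (mod int b)"
      "\<And>n c. int b dvd n \<Longrightarrow> c \<in> ?K \<Longrightarrow> int c dvd n + t \<Longrightarrow> int c dvd n"
      using translation_into_class[of b ?K s] b0 s zero_notin by auto
    have tb: "t mod int b = s mod int b" using t(1) by (simp add: Cong.cong_def)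
    have Z: "?Z \<in> sets P" using b by (intro sets.Int class_measurable free_set_measurable) auto
    have "{g \<in> G. g b = 0} \<inter> free_set (B - {b}) \<subseteq> {g \<in> G. rotate_by B t g \<in> ?Z}"
    proof
      fix g assume g: "g \<in> {g \<in> G. g b = 0} \<inter> free_set (B - {b})"
      then have gG: "g \<in> G" and gb: "g b = 0" by auto
      have "finite (insert b ?K)" "insert b ?K \<subseteq> B" using b by auto
      then obtain m where m: "\<forall>c\<in>insert b ?K. g c = m mod int c"
        using carrier_representative[OF gG] by blast
      have bm: "int b dvd m" using m gb by (simp add: dvd_eq_mod_eq_0)
      have "rotate_by B t g b = s mod int b" using b gb tb by (simp add: rotate_by_apply)
      moreover have "rotate_by B t g c \<noteq> 0" if c: "c \<in> ?K" for c
      proof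
        assume "rotate_by B t g c = 0"
        then have "(m + t) mod int c = 0" using m c by (simp add: rotate_by_apply mod_simps)
        then have ct: "int c dvd m + t" by (simp add: dvd_eq_mod_eq_0)
        then have "int c dvd m" using t(2) bm c by blast
        then have "g c = 0" using m c by (simp add: dvd_eq_mod_eq_0)
        then have "c = b" using g c by (auto simp: free_set_def)
        then have "int b dvd t" using ct bm by (simp add: dvd_add_right_iff)
        with s tb show False by (metis dvd_eq_mod_eq_0)
      qed
      ultimately show "g \<in> {g \<in> G. rotate_by B t g \<in> ?Z}"
        using gG rotate_by_carrier[OF gG] by (simp add: free_set_def)
    qed
    moreover have "{g \<in> G. rotate_by B t g \<in> ?Z} \<in> sets P"
      using measurable_sets[OF rotate_by_measurable[of t] Z] by (simp add: space_P vimage_def Int_def conj_commute)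
    ultimately have "prob ({g \<in> G. g b = 0} \<inter> free_set (B - {b})) \<le> prob {g \<in> G. rotate_by B t g \<in> ?Z}"
      by (rule finite_measure_mono)
    also have "\<dots> = prob ?Z" using Z by (rule prob_rotate_by)
    finally show ?thesis .
  qed
  then show "\<exists>N. \<forall>n\<ge>N. prob ({g \<in> G. g b = 0} \<inter> free_set (B - {b}))
      \<le> prob ({g \<in> G. g b = s mod int b} \<inter> free_set (B \<inter> {..n}))" by blast
qed

text \<open>
  This replaces the ergodicity of the rotation by \<open>b\<close> on a class modulo
  \<open>b\<close>. For a finite part of \<open>B\<close> the number of visits to the free set
  during one period is the same for all points of the class, so averaging over \<open>A\<close>
  and over the whole class gives the same proportion.
\<close>

lemma invariant_set_independent_of_free_set:
  assumes b: "b \<in> B" and A: "A \<in> sets P" and sub: "A \<subseteq> {g \<in> G. g b = s mod int b}"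
    and inv: "\<And>g j. g \<in> G \<Longrightarrow> rotate_by B (int b * j) g \<in> A \<longleftrightarrow> g \<in> A"
  shows "prob (A \<inter> free_set B) * prob {g \<in> G. g b = s mod int b}
    = prob A * prob ({g \<in> G. g b = s mod int b} \<inter> free_set B)"
proof (rule LIMSEQ_unique)
  let ?S = "{g \<in> G. g b = s mod int b}"
  have S: "?S \<in> sets P" using b by (rule class_measurable)
  have invS: "rotate_by B (int b * j) g \<in> ?S \<longleftrightarrow> g \<in> ?S" if "g \<in> G" for g j
    using that b rotate_by_carrier[OF that] carrier_mod[OF that b] by (simp add: rotate_by_apply)
  show "(\<lambda>N. prob (A \<inter> free_set (B \<inter> {..N})) * prob ?S) \<longlonglongrightarrow> prob (A \<inter> free_set B) * prob ?S"
    using A by (intro tendsto_intros prob_free_set_tendsto) auto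
  have eq: "prob (A \<inter> free_set (B \<inter> {..N})) * prob ?S = prob A * prob (?S \<inter> free_set (B \<inter> {..N}))" for N
  proof -
    let ?K = "insert b (B \<inter> {..N})"
    have K: "finite ?K" "?K \<subseteq> B" using b by auto
    define L where "L = \<Prod>?K"
    have L: "L > 0" using prod_modulus[OF K] by (simp add: L_def)
    \<comment> \<open>\<open>R a\<close>: the integer \<open>s + b a\<close> of the class of \<open>s\<close> is free of the elements of \<open>B\<close> up to \<open>N\<close>\<close>
    define R where "R = (\<lambda>a. \<forall>c\<in>B \<inter> {..N}. \<not> int c dvd s + int b * a)"
    have per: "R (a + int L) \<longleftrightarrow> R a" for a
    proof -
      have "int c dvd s + int b * (a + int L) \<longleftrightarrow> int c dvd s + int b * a" if "c \<in> B \<inter> {..N}" for c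
      proof -
        have "int c dvd int b * int L" using prod_modulus(2)[OF K, of c] that by (simp add: L_def)
        moreover have "s + int b * (a + int L) = (s + int b * a) + int b * int L" by (simp add: algebra_simps)
        ultimately show ?thesis by (metis dvd_add_left_iff)
      qed
      then show ?thesis by (auto simp: R_def)
    qed
    define v where "v = card {j. j < L \<and> R (int j)}"
    have count: "card {j. j < L \<and> rotate_by B (int b * int j) g \<in> free_set (B \<inter> {..N})} = v" if g: "g \<in> ?S" for g
    proof -
      have gG: "g \<in> G" using g by simp
      obtain m where m: "\<forall>c\<in>?K. g c = m mod int c" using carrier_representative[OF gG K] by blast
      with g have "m mod int b = s mod int b" by simp
      then obtain i where i: "m = s + int b * i" by (metis mod_eqE mult.commute diff_add_cancel add.commute mod_eq_dvd_iff dvdE)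
      have "rotate_by B (int b * int j) g \<in> free_set (B \<inter> {..N}) \<longleftrightarrow> R (i + int j)" for j
      proof -
        have "rotate_by B (int b * int j) g c = (s + int b * (i + int j)) mod int c" if "c \<in> B \<inter> {..N}" for c
          using m that i by (simp add: rotate_by_apply mod_simps algebra_simps)
        then show ?thesis
          using rotate_by_carrier[OF gG] by (simp add: free_set_def R_def dvd_eq_mod_eq_0)
      qed
      then show ?thesis using card_over_period[of R L i, OF per] by (simp add: v_def)
    qed
    have V: "free_set (B \<inter> {..N}) \<in> sets P" by auto
    have 1: "real L * prob (A \<inter> free_set (B \<inter> {..N})) = real v * prob A"
      using sub by (intro averaging[where s = "int b"] A V inv count) auto
    have 2: "real L * prob (?S \<inter> free_set (B \<inter> {..N})) = real v * prob ?S"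
      by (intro averaging[where s = "int b"] S V invS count)
    have "real L * (prob (A \<inter> free_set (B \<inter> {..N})) * prob ?S)
        = real L * prob (A \<inter> free_set (B \<inter> {..N})) * prob ?S" by simp
    also have "\<dots> = prob A * (real v * prob ?S)" unfolding 1 by simp
    also have "\<dots> = real L * (prob A * prob (?S \<inter> free_set (B \<inter> {..N})))"
      unfolding 2[symmetric] by simp
    finally have "real L * (prob (A \<inter> free_set (B \<inter> {..N})) * prob ?S)
        = real L * (prob A * prob (?S \<inter> free_set (B \<inter> {..N})))" .
    then show ?thesis using L by simp
  qed
  show "(\<lambda>N. prob (A \<inter> free_set (B \<inter> {..N})) * prob ?S) \<longlonglongrightarrow> prob A * prob (?S \<inter> free_set B)"
    unfolding eq using S by (intro tendsto_intros prob_free_set_tendsto) auto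
qed

text \<open>
  The exceptional set \<open>A\<close> is invariant under rotation by \<open>b\<close> and
  disjoint from the free set, so the product formula forces it to be null.
\<close>

lemma AE_class_hits_free_set:
  assumes taut: "taut B" and b: "b \<in> B" and s: "\<not> int b dvd s"
  shows "AE g in P. g b = s mod int b \<longrightarrow> (\<exists>k. rotate_by B (int b * k) g \<in> free_set B)"
proof -
  let ?S = "{g \<in> G. g b = s mod int b}"
  define A where "A = {g \<in> G. g b = s mod int b \<and> (\<forall>k. rotate_by B (int b * k) g \<notin> free_set B)}"
  have "{g \<in> space P. rotate_by B (int b * k) g \<in> free_set B} \<in> sets P" for k
    by (rule measurable_sets_Collect[OF rotate_by_measurable, of "\<lambda>h. h \<in> free_set B"])
       (use free_set_measurable[of B] in \<open>simp add: Int_absorb1 sets.sets_into_space Collect_conj_eq\<close>)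
  then have "?S - (\<Union>k. {g \<in> space P. rotate_by B (int b * k) g \<in> free_set B}) \<in> sets P"
    using class_measurable[OF b] by (intro sets.Diff sets.countable_UN) auto
  also have "?S - (\<Union>k. {g \<in> space P. rotate_by B (int b * k) g \<in> free_set B}) = A"
    by (auto simp: A_def space_P)
  finally have A: "A \<in> sets P" .
  have inv: "rotate_by B (int b * j) g \<in> A \<longleftrightarrow> g \<in> A" if g: "g \<in> G" for g j
  proof -
    have "(\<forall>k. rotate_by B (int b * k) (rotate_by B (int b * j) g) \<notin> free_set B)
        \<longleftrightarrow> (\<forall>k. rotate_by B (int b * k) g \<notin> free_set B)"
      unfolding rotate_by_add
      by (metis distrib_left diff_add_cancel)
    then show ?thesis
      using g b rotate_by_carrier[OF g] carrier_mod[OF g b] by (simp add: A_def rotate_by_apply)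
  qed
  have "prob (A \<inter> free_set B) * prob ?S = prob A * prob (?S \<inter> free_set B)"
    by (rule invariant_set_independent_of_free_set[OF b A _ inv]) (auto simp: A_def)
  moreover have "A \<inter> free_set B = {}"
  proof -
    have False if "g \<in> A" "g \<in> free_set B" for g
    proof -
      have "rotate_by B (int b * 0) g = g" using that(1) rotate_by_0 by (simp add: A_def)
      with that show False unfolding A_def by (metis (mono_tags, lifting) mem_Collect_eq)
    qed
    then show ?thesis by blast
  qed
  moreover have "prob (?S \<inter> free_set B) > 0"
    using taut_zero_class_pos[OF taut b] zero_class_minimal[OF b s] by linarith
  ultimately have "prob A = 0" by simp
  then have "A \<in> null_sets P" using A by (simp add: null_sets_def emeasure_eq_measure)
  then have "AE g in P. g \<notin> A" by (rule AE_not_in)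
  then show ?thesis by (rule AE_mp) (auto intro!: AE_I2 simp: A_def space_P)
qed

end

section \<open>Sequences, the subshift and decoding\<close>

instance bool :: second_countable_topology
proof
  have "open = generate_topology (UNIV :: bool set set)"
    by (intro ext iffI) (auto simp: discrete_topology_class.open_discrete intro: generate_topology.Basis)
  moreover have "countable (UNIV :: bool set set)" by (intro countable_finite finite)
  ultimately show "\<exists>\<B>::bool set set. countable \<B> \<and> open = generate_topology \<B>" by blast
qed

text \<open>
  The product topology on sequences is second countable, so its Borel sets are generated by the
  coordinates.
\<close>

lemma measurable_into_sequences:
  assumes "\<And>n. {x \<in> space M. f x n} \<in> sets M"
  shows "f \<in> M \<rightarrow>\<^sub>M (borel :: (int \<Rightarrow> bool) measure)"
proof (rule measurable_coordinatewise_then_product)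
  fix n :: int
  have "(\<lambda>x. f x n) \<in> M \<rightarrow>\<^sub>M count_space UNIV" using assms[of n] by (simp add: pred_def)
  then show "(\<lambda>x. f x n) \<in> M \<rightarrow>\<^sub>M borel" by (rule measurable_compose) (simp add: measurable_count_space_eq1)
qed

lemma coordinate_sets: "{x. x n} \<in> sets (borel :: (int \<Rightarrow> bool) measure)"
proof -
  have "open ((\<lambda>x :: int \<Rightarrow> bool. x n) -` {True})"
    by (intro open_vimage discrete_topology_class.open_discrete continuous_on_product_coordinates)
  then show ?thesis by (simp add: vimage_def)
qed

lemma shift_by_measurable: "shift_by m \<in> borel \<rightarrow>\<^sub>M (borel :: (int \<Rightarrow> bool) measure)"
  by (rule measurable_into_sequences) (simp add: shift_by_def coordinate_sets)

lemma shift_by_continuous: "continuous_on UNIV (shift_by m)"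
  unfolding shift_by_def by (intro continuous_on_coordinatewise_then_product continuous_on_product_coordinates)

lemma shift_by_add: "shift_by m (shift_by n x) = shift_by (m + n) x"
  by (simp add: shift_by_def algebra_simps)

lemma free_subshift_measurable: "free_subshift B \<in> sets borel"
  by (simp add: free_subshift_def)

lemma shift_by_free_subshift:
  assumes "x \<in> free_subshift B"
  shows "shift_by m x \<in> free_subshift B"
proof -
  let ?S = "range (\<lambda>m. shift_by m (free_seq B))"
  have "shift_by m ` closure ?S \<subseteq> closure ?S"
  proof (rule image_closure_subset)
    show "continuous_on (closure ?S) (shift_by m)"
      by (rule continuous_on_subset[OF shift_by_continuous]) simp
    show "shift_by m ` ?S \<subseteq> closure ?S"
      using closure_subset[of ?S] by (auto simp: shift_by_add)
  qed simp
  with assms show ?thesis by (auto simp: free_subshift_def)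
qed

lemma shift_by_free_subshift_iff: "shift_by m x \<in> free_subshift B \<longleftrightarrow> x \<in> free_subshift B"
  using shift_by_free_subshift[of x B m] shift_by_free_subshift[of "shift_by m x" B "- m"]
  by (auto simp: shift_by_uminus)

lemma free_subshiftI:
  assumes "\<And>N :: nat. \<exists>m. \<forall>n\<in>{- int N..int N}. x n \<longleftrightarrow> free_seq B (n + m)"
  shows "x \<in> free_subshift B"
proof -
  let ?S = "range (\<lambda>m. shift_by m (free_seq B))"
  obtain m where m: "\<And>N n. n \<in> {- int N..int N} \<Longrightarrow> x n \<longleftrightarrow> free_seq B (n + m N)"
    using assms by metis
  define y where "y = (\<lambda>N. shift_by (m N) (free_seq B))"
  have "((\<lambda>N. y N n) \<longlongrightarrow> x n) sequentially" for n
  proof (rule tendsto_eventually)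
    show "\<forall>\<^sub>F N in sequentially. y N n = x n"
      using eventually_ge_at_top[of "nat \<bar>n\<bar>"]
    proof eventually_elim
      case (elim N)
      then have "n \<in> {- int N..int N}" by auto
      then show ?case using m by (simp add: y_def shift_by_def)
    qed
  qed
  then have "limitin (product_topology (\<lambda>_. euclidean) UNIV) y x sequentially"
    by (auto simp: limitin_componentwise)
  then have "y \<longlonglongrightarrow> x" by (simp add: euclidean_product_topology)
  moreover have "\<forall>\<^sub>F N in sequentially. y N \<in> closure ?S"
    by (intro always_eventually allI subsetD[OF closure_subset]) (auto simp: y_def)
  ultimately show ?thesis
    unfolding free_subshift_def by (intro Lim_in_closed_set[of "closure ?S"]) auto
qed

text \<open>
  The support of \<open>x\<close> avoids the class of \<open>- r\<close>; the sign is the one in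
  \<^const>\<open>window_coding\<close>, so that the coding of \<open>g\<close> misses class
  \<open>g b\<close>.
\<close>

definition misses_class :: "(int \<Rightarrow> bool) \<Rightarrow> nat \<Rightarrow> int \<Rightarrow> bool" where
  "misses_class x b r \<longleftrightarrow> (\<forall>n. x n \<longrightarrow> \<not> [n = - r] (mod int b))"

lemma misses_class_sets: "{x. misses_class x b r} \<in> sets borel"
proof -
  have "{x. misses_class x b r} = (\<Inter>n\<in>{n. [n = - r] (mod int b)}. - {x. x n})"
    by (auto simp: misses_class_def)
  also have "\<dots> \<in> sets borel"
    by (rule sets.countable_INT'') (use sets.compl_sets[OF coordinate_sets] in \<open>auto simp: Compl_eq_Diff_UNIV\<close>)
  finally show ?thesis .
qed

lemma misses_class_cong:
  "[r = r'] (mod int b) \<Longrightarrow> misses_class x b r \<longleftrightarrow> misses_class x b r'"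
  unfolding misses_class_def by (meson cong_minus_minus_iff cong_sym cong_trans)

lemma misses_class_shift_by: "misses_class (shift_by m x) b r \<longleftrightarrow> misses_class x b (r - m)"
proof -
  have "[n = - r] (mod int b) \<longleftrightarrow> [n + m = - (r - m)] (mod int b)" for n
    by (simp add: cong_iff_dvd_diff)
  then show ?thesis
    unfolding misses_class_def shift_by_def by (metis diff_add_cancel)
qed

lemma misses_class_window_coding: "b \<in> B \<Longrightarrow> misses_class (window_coding B g) b (g b)"
  by (auto simp: misses_class_def window_coding_def)

definition decode :: "nat set \<Rightarrow> (int \<Rightarrow> bool) \<Rightarrow> (nat \<Rightarrow> int)" where
  "decode B x = (\<lambda>b\<in>B. (SOME r. misses_class x b r) mod int b)"

text \<open>
  Inside the subshift, the conditions on \<open>x\<close> say in this order: the missed class is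
  unique for every \<open>b\<close>, so decoding is well defined; the missed classes are
  compatible, so they form a point of the odometer; every zero of \<open>x\<close> is explained by
  a missed class, so the coding of that point is \<open>x\<close>. Each of them is a countable
  combination of Borel conditions.
\<close>

definition decodable :: "nat set \<Rightarrow> (int \<Rightarrow> bool) set" where
  "decodable B = {x \<in> free_subshift B.
     (\<forall>b\<in>B. \<forall>r r'. misses_class x b r \<and> misses_class x b r' \<longrightarrow> [r = r'] (mod int b)) \<and>
     (\<forall>N. \<exists>m. \<forall>b\<in>B \<inter> {..N}. misses_class x b m) \<and>
     (\<forall>n. (\<forall>b\<in>B. \<not> misses_class x b (- n)) \<longrightarrow> x n)}"

lemma decodable_measurable: "decodable B \<in> sets borel"
proof -
  have m: "Measurable.pred borel (\<lambda>x. misses_class x b r)" for b r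
    using misses_class_sets[of b r] by (simp add: pred_def)
  have c: "Measurable.pred borel (\<lambda>x::int\<Rightarrow>bool. x n)" for n
    using coordinate_sets[of n] by (simp add: pred_def)
  have f: "Measurable.pred borel (\<lambda>x. x \<in> free_subshift B)"
    using free_subshift_measurable by (simp add: pred_def)
  have "Measurable.pred borel (\<lambda>x. x \<in> free_subshift B \<and>
     (\<forall>b\<in>B. \<forall>r r'. misses_class x b r \<and> misses_class x b r' \<longrightarrow> [r = r'] (mod int b)) \<and>
     (\<forall>N. \<exists>m. \<forall>b\<in>B \<inter> {..N}. misses_class x b m) \<and>
     (\<forall>n. (\<forall>b\<in>B. \<not> misses_class x b (- n)) \<longrightarrow> x n))"
    by (intro pred_intros_logic pred_intros_countable pred_intros_countable_bounded countableI_type m c f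
        measurable_const) simp_all
  then show ?thesis by (simp add: decodable_def pred_def Ball_def)
qed

lemma decode_eq:
  assumes "x \<in> decodable B" "b \<in> B" "misses_class x b m"
  shows "decode B x b = m mod int b"
proof -
  have "misses_class x b (SOME r. misses_class x b r)" using assms(3) by (rule someI)
  with assms have "[(SOME r. misses_class x b r) = m] (mod int b)" unfolding decodable_def by blast
  with assms(2) show ?thesis by (simp add: decode_def Cong.cong_def)
qed

lemma misses_class_decode:
  assumes "x \<in> decodable B" "b \<in> B"
  shows "misses_class x b (decode B x b)"
proof -
  have "b \<in> B \<inter> {..b}" using assms(2) by simp
  with assms(1) obtain m where m: "misses_class x b m" unfolding decodable_def by blast
  with decode_eq[OF assms m] show ?thesis
    by (subst misses_class_cong[of _ m]) (auto simp: Cong.cong_def)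
qed

lemma decode_in_carrier:
  assumes "0 \<notin> B" "x \<in> decodable B"
  shows "decode B x \<in> odometer_carrier B"
  unfolding odometer_carrier_iff[OF assms(1)]
proof (intro conjI allI impI)
  show "decode B x \<in> extensional B" by (simp add: decode_def)
  fix K assume K: "finite K \<and> K \<subseteq> B"
  then obtain N where "\<forall>k\<in>K. k \<le> N" using finite_nat_set_iff_bounded_le by blast
  with K have "K \<subseteq> B \<inter> {..N}" by auto
  moreover from assms(2) obtain m where "\<forall>b\<in>B \<inter> {..N}. misses_class x b m" unfolding decodable_def by blast
  ultimately have "\<forall>b\<in>K. misses_class x b m" by blast
  with K decode_eq[OF assms(2)] show "\<exists>m. \<forall>b\<in>K. decode B x b = m mod int b" by blast
qed

lemma window_coding_decode:
  assumes x: "x \<in> decodable B"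
  shows "window_coding B (decode B x) = x"
proof
  fix n
  show "window_coding B (decode B x) n = x n"
  proof
    assume w: "window_coding B (decode B x) n"
    show "x n"
    proof (rule ccontr)
      assume "\<not> x n"
      then obtain b where b: "b \<in> B" "misses_class x b (- n)" using x unfolding decodable_def by blast
      then have "[decode B x b = - n] (mod int b)" using decode_eq[OF x] by (simp add: Cong.cong_def)
      then have "[n = - decode B x b] (mod int b)" by (metis cong_minus_minus_iff cong_sym minus_minus)
      with w b show False by (auto simp: window_coding_def)
    qed
  next
    assume "x n"
    then show "window_coding B (decode B x) n"
      using misses_class_decode[OF x] by (auto simp: window_coding_def misses_class_def)
  qed
qed

lemma shift_by_decodable:
  assumes "x \<in> decodable B"
  shows "shift_by m x \<in> decodable B"
  unfolding decodable_def mem_Collect_eq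
proof (intro conjI ballI allI impI)
  show "shift_by m x \<in> free_subshift B"
    using assms shift_by_free_subshift by (auto simp: decodable_def)
next
  fix b r r' assume b: "b \<in> B" and "misses_class (shift_by m x) b r \<and> misses_class (shift_by m x) b r'"
  then have "misses_class x b (r - m)" "misses_class x b (r' - m)" by (auto simp: misses_class_shift_by)
  then have "[r - m = r' - m] (mod int b)" using assms b unfolding decodable_def by blast
  then show "[r = r'] (mod int b)" by (simp add: cong_iff_dvd_diff)
next
  fix N
  from assms obtain k where "\<forall>b\<in>B \<inter> {..N}. misses_class x b k" unfolding decodable_def by blast
  then show "\<exists>k. \<forall>b\<in>B \<inter> {..N}. misses_class (shift_by m x) b k"
    by (intro exI[of _ "k + m"]) (simp add: misses_class_shift_by)
next
  fix n assume "\<forall>b\<in>B. \<not> misses_class (shift_by m x) b (- n)"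
  then have "\<forall>b\<in>B. \<not> misses_class x b (- (n + m))" by (simp add: misses_class_shift_by)
  then have "x (n + m)" using assms unfolding decodable_def by blast
  then show "shift_by m x n" by (simp add: shift_by_def)
qed

lemma decode_shift_by:
  assumes "x \<in> decodable B"
  shows "decode B (shift_by m x) = rotate_by B m (decode B x)"
proof
  fix b
  show "decode B (shift_by m x) b = rotate_by B m (decode B x) b"
  proof (cases "b \<in> B")
    case True
    then have "misses_class (shift_by m x) b (decode B x b + m)"
      using misses_class_decode[OF assms True] by (simp add: misses_class_shift_by)
    then show ?thesis
      using decode_eq[OF shift_by_decodable[OF assms] True] True by (simp add: rotate_by_apply)
  qed (simp add: decode_def rotate_by_def)
qed

lemma window_coding_rotate_by: "window_coding B (rotate_by B m g) = shift_by m (window_coding B g)"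
proof -
  have "[n = - ((g b + m) mod int b)] (mod int b) \<longleftrightarrow> [n + m = - g b] (mod int b)" for n b
  proof -
    have "[n = - ((g b + m) mod int b)] (mod int b) \<longleftrightarrow> [n = - (g b + m)] (mod int b)"
      by (simp add: Cong.cong_def mod_minus_eq)
    then show ?thesis by (simp add: cong_iff_dvd_diff algebra_simps)
  qed
  then show ?thesis by (auto simp: window_coding_def shift_by_def rotate_by_def fun_eq_iff)
qed

section \<open>Codings of random points of the odometer\<close>

context haar_odometer
begin

lemma window_coding_iff:
  assumes "g \<in> G"
  shows "window_coding B g n \<longleftrightarrow> rotate_by B n g \<in> free_set B"
proof -
  have "[n = - g b] (mod int b) \<longleftrightarrow> (g b + n) mod int b = 0" for b
    by (simp add: cong_iff_dvd_diff mod_eq_0_iff_dvd add.commute)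
  then show ?thesis
    using rotate_by_carrier[OF assms] by (simp add: window_coding_def free_set_def rotate_by_apply)
qed

lemma rotated_event_measurable:
  assumes "A \<in> sets P"
  shows "{g \<in> G. rotate_by B n g \<in> A} \<in> sets P"
  using measurable_sets[OF rotate_by_measurable[of n] assms]
  by (simp add: space_P vimage_def Int_def conj_commute)

lemma window_coding_measurable: "window_coding B \<in> P \<rightarrow>\<^sub>M borel"
proof (rule measurable_into_sequences)
  fix n
  have "{g \<in> space P. window_coding B g n} = {g \<in> G. rotate_by B n g \<in> free_set B}"
    by (auto simp: space_P window_coding_iff)
  then show "{g \<in> space P. window_coding B g n} \<in> sets P"
    using rotated_event_measurable[OF free_set_measurable[of B]] by simp
qed

lemma AE_rotate_by: "AE g in P. Q g \<Longrightarrow> AE g in P. Q (rotate_by B n g)"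
  using AE_distrD[OF rotate_by_measurable[of n]] distr_rotate_by[of n] by metis

text \<open>
  Rotating by \<open>- r\<close> moves the missed class to the class of 0, where a coordinate
  different from 0 is excluded almost surely because the orbit under rotation by \<open>b\<close>
  visits the free set.
\<close>

lemma AE_misses_unique_class:
  assumes taut: "taut B"
  shows "AE g in P. \<forall>b\<in>B. \<forall>r. misses_class (window_coding B g) b r \<longrightarrow> [r = g b] (mod int b)"
proof -
  have one: "AE g in P. misses_class (window_coding B g) b r \<longrightarrow> [r = g b] (mod int b)" if b: "b \<in> B" for b r
  proof -
    have "AE h in P. \<forall>s\<in>{1..<int b}. h b = s mod int b \<longrightarrow> (\<exists>k. rotate_by B (int b * k) h \<in> free_set B)"
    proof (rule AE_finite_allI)
      fix s assume "s \<in> {1..<int b}"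
      then have "\<not> int b dvd s" by (auto dest: zdvd_imp_le)
      then show "AE h in P. h b = s mod int b \<longrightarrow> (\<exists>k. rotate_by B (int b * k) h \<in> free_set B)"
        by (rule AE_class_hits_free_set[OF taut b])
    qed simp
    then have "AE g in P. \<forall>s\<in>{1..<int b}. rotate_by B (- r) g b = s mod int b \<longrightarrow>
        (\<exists>k. rotate_by B (int b * k) (rotate_by B (- r) g) \<in> free_set B)"
      by (rule AE_rotate_by)
    then show ?thesis
    proof (rule AE_mp, intro AE_I2 impI)
      fix g assume g: "g \<in> space P" and miss: "misses_class (window_coding B g) b r"
        and hits: "\<forall>s\<in>{1..<int b}. rotate_by B (- r) g b = s mod int b \<longrightarrow>
          (\<exists>k. rotate_by B (int b * k) (rotate_by B (- r) g) \<in> free_set B)"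
      have gG: "g \<in> G" using g by (simp add: space_P)
      let ?h = "rotate_by B (- r) g"
      have hG: "?h \<in> G" using gG by (rule rotate_by_carrier)
      have "?h b = 0"
      proof (rule ccontr)
        assume "?h b \<noteq> 0"
        then have "?h b \<in> {1..<int b}" using carrier_range[OF hG b] by auto
        moreover have "?h b = ?h b mod int b" using carrier_mod[OF hG b] by simp
        ultimately obtain k where "rotate_by B (int b * k) ?h \<in> free_set B" using hits by blast
        then have "window_coding B g (int b * k - r)"
          by (simp add: window_coding_iff[OF gG] rotate_by_add)
        with miss have "\<not> [int b * k - r = - r] (mod int b)" unfolding misses_class_def by blast
        then show False by (simp add: cong_iff_dvd_diff)
      qed
      then have "[g b = r] (mod int b)"
        using b by (simp add: rotate_by_apply cong_iff_dvd_diff mod_eq_0_iff_dvd)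
      then show "[r = g b] (mod int b)" by (rule cong_sym)
    qed
  qed
  have "AE g in P. \<forall>b. b \<in> B \<longrightarrow> (\<forall>r. misses_class (window_coding B g) b r \<longrightarrow> [r = g b] (mod int b))"
    unfolding AE_all_countable using one by (auto simp: AE_all_countable)
  then show ?thesis by (simp add: Ball_def)
qed

end

section \<open>Almost every coding lies in the subshift\<close>

lemma has_log_density_subset_UN:
  assumes A: "has_log_density A d" and C: "\<And>i. i \<in> I \<Longrightarrow> has_log_density (C i) e"
    and fin: "finite I" and sub: "A \<subseteq> (\<Union>i\<in>I. C i)"
  shows "d \<le> real (card I) * e"
proof -
  have UN: "log_sum (\<Union>i\<in>J. C i) N \<le> (\<Sum>i\<in>J. log_sum (C i) N)" if "finite J" for J N
    using that
  proof induction
    case empty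
    show ?case by (simp add: log_sum_def)
  next
    case (insert j J)
    then show ?case using log_sum_Un_le[of "C j" "\<Union>i\<in>J. C i" N] by simp
  qed
  have le: "log_sum A N / ln (real N) \<le> (\<Sum>i\<in>I. log_sum (C i) N / ln (real N))" if "N \<ge> 1" for N
  proof -
    have "log_sum A N \<le> (\<Sum>i\<in>I. log_sum (C i) N)"
      using log_sum_mono[OF sub, of N] UN[OF fin, of N] by linarith
    then show ?thesis using that by (simp add: divide_right_mono flip: sum_divide_distrib)
  qed
  have "d \<le> (\<Sum>i\<in>I. e)"
  proof (rule LIMSEQ_le)
    show "(\<lambda>N. log_sum A N / ln (real N)) \<longlonglongrightarrow> d" using A by (simp add: has_log_density_def)
    show "(\<lambda>N. \<Sum>i\<in>I. log_sum (C i) N / ln (real N)) \<longlonglongrightarrow> (\<Sum>i\<in>I. e)"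
      using C by (intro tendsto_sum) (simp add: has_log_density_def)
    show "\<exists>N. \<forall>n\<ge>N. log_sum A n / ln (real n) \<le> (\<Sum>i\<in>I. log_sum (C i) n / ln (real n))"
      using le by blast
  qed
  then show ?thesis by simp
qed

context haar_odometer
begin

text \<open>
  Let \<open>K j\<close> exhaust \<open>B\<close> and let \<open>e j\<close> be the density of the
  multiples of \<open>B\<close> that are not multiples of \<open>K j\<close>. The integers showing
  the pattern \<open>w\<close> with respect to \<open>K j\<close> do not show it with respect to
  \<open>B\<close>, so each such integer \<open>m\<close> has \<open>m + n\<close> in that thin
  set for some \<open>n\<close> in \<open>W\<close>. This bounds their density, which is the
  measure of a cylinder event, by \<open>e j\<close> times the size of \<open>W\<close>; replacing
  \<open>K j\<close> by \<open>B\<close> in the event costs the same again.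
\<close>

lemma absent_pattern_null:
  assumes win: "finite W" and absent: "\<And>m. {n \<in> W. free_seq B (n + m)} \<noteq> w"
  shows "prob {g \<in> G. {n \<in> W. window_coding B g n} = w} = 0"
proof -
  define K where "K = (\<lambda>j::nat. B \<inter> {..j})"
  define e where "e = (\<lambda>j. prob (free_set (K j)) - prob (free_set B))"
  define \<Phi> where "\<Phi> = (\<lambda>j g. {n \<in> W. \<forall>c\<in>K j. (g c + n) mod int c \<noteq> 0} = w)"
  have K: "finite (K j)" "K j \<subseteq> B" for j by (auto simp: K_def)
  have fs: "free_set (K j) \<in> sets P" "free_set B \<in> sets P" for j using K by auto
  have e_diff: "e j = prob (free_set (K j) - free_set B)" for j
  proof -
    have "free_set B \<subseteq> free_set (K j)" by (auto simp: free_set_def K_def)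
    from finite_measure_Diff[OF fs(1) fs(2) this] show ?thesis by (simp add: e_def)
  qed
  have e0: "e \<longlonglongrightarrow> 0"
  proof -
    have "(\<lambda>j. prob (space P \<inter> free_set (B \<inter> {..j})) - prob (free_set B)) \<longlonglongrightarrow> prob (space P \<inter> free_set B) - prob (free_set B)"
      by (intro tendsto_intros prob_free_set_tendsto) auto
    moreover have "space P \<inter> free_set C = free_set C" for C by (auto simp: space_P free_set_def)
    ultimately show ?thesis by (simp add: e_def[abs_def] K_def)
  qed
  have \<Phi>_local: "\<Phi> j g \<longleftrightarrow> \<Phi> j h" if "\<And>c. c \<in> K j \<Longrightarrow> g c = h c" for j g h
  proof -
    have "{n \<in> W. \<forall>c\<in>K j. (g c + n) mod int c \<noteq> 0} = {n \<in> W. \<forall>c\<in>K j. (h c + n) mod int c \<noteq> 0}"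
      using that by auto
    then show ?thesis by (simp add: \<Phi>_def)
  qed
  have cyl: "prob {g \<in> G. \<Phi> j g} \<le> real (card W) * e j" for j
  proof (rule has_log_density_subset_UN[OF has_log_density_cylinder_event[OF K \<Phi>_local] _ win])
    fix n
    have "has_log_density (multiples_of B - multiples_of (K j)) ((1 - prob (free_set B)) - (1 - prob (free_set (K j))))"
      using K by (intro has_log_density_Diff has_log_density_multiples) (auto simp: multiples_of_def)
    then have "has_log_density (multiples_of B - multiples_of (K j)) (e j)" by (simp add: e_def)
    then show "has_log_density {m. m + n \<in> multiples_of B - multiples_of (K j)} (e j)"
      by (rule has_log_density_translate)
  next
    show "{m. \<Phi> j (residues_of B m)} \<subseteq> (\<Union>n\<in>W. {m. m + n \<in> multiples_of B - multiples_of (K j)})"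
    proof
      fix m assume "m \<in> {m. \<Phi> j (residues_of B m)}"
      moreover have "(residues_of B m c + n) mod int c \<noteq> 0 \<longleftrightarrow> \<not> int c dvd m + n" if "c \<in> K j" for c n
      proof -
        have "c \<in> B" using that K(2) by blast
        then show ?thesis
          unfolding mod_eq_0_iff_dvd[symmetric] residues_of_def by (simp only: restrict_apply' mod_add_left_eq)
      qed
      ultimately have w: "{n \<in> W. m + n \<notin> multiples_of (K j)} = w"
        by (auto simp: \<Phi>_def multiples_of_iff)
      have "{n \<in> W. m + n \<notin> multiples_of B} \<noteq> w"
        using absent[of m] by (simp add: free_seq_def free_numbers_eq add.commute)
      with w have "{n \<in> W. m + n \<notin> multiples_of (K j)} \<noteq> {n \<in> W. m + n \<notin> multiples_of B}" by simp
      moreover have "multiples_of (K j) \<subseteq> multiples_of B" using K by (auto simp: multiples_of_def)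
      ultimately show "m \<in> (\<Union>n\<in>W. {m. m + n \<in> multiples_of B - multiples_of (K j)})" by blast
    qed
  qed
  \<comment> \<open>Passing from \<open>K j\<close> to \<open>B\<close> changes the entry at each single position with probability \<open>e j\<close>.\<close>
  have bound: "prob {g \<in> G. {n \<in> W. window_coding B g n} = w} \<le> 2 * real (card W) * e j" for j
  proof -
    let ?D = "\<lambda>n. {g \<in> G. rotate_by B n g \<in> free_set (K j) - free_set B}"
    have D: "?D n \<in> sets P" for n using fs by (intro rotated_event_measurable) auto
    have R: "{g \<in> G. \<Phi> j g} \<in> sets P" by (rule cylinder_event_measurable[OF K \<Phi>_local])
    have sub: "{g \<in> G. {n \<in> W. window_coding B g n} = w} \<subseteq> {g \<in> G. \<Phi> j g} \<union> (\<Union>n\<in>W. ?D n)"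
    proof
      fix g assume "g \<in> {g \<in> G. {n \<in> W. window_coding B g n} = w}"
      then have g: "g \<in> G" and w: "{n \<in> W. window_coding B g n} = w" by auto
      have "(\<forall>c\<in>K j. (g c + n) mod int c \<noteq> 0) \<longleftrightarrow> rotate_by B n g \<in> free_set (K j)" for n
        using K(2)[of j] rotate_by_carrier[OF g] by (auto simp: free_set_def rotate_by_apply subset_iff)
      then have \<Phi>: "\<Phi> j g \<longleftrightarrow> {n \<in> W. rotate_by B n g \<in> free_set (K j)} = w" by (simp add: \<Phi>_def)
      have w': "w = {n \<in> W. rotate_by B n g \<in> free_set B}" using w window_coding_iff[OF g] by simp
      show "g \<in> {g \<in> G. \<Phi> j g} \<union> (\<Union>n\<in>W. ?D n)"
      proof (cases "\<Phi> j g")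
        case False
        then have "{n \<in> W. rotate_by B n g \<in> free_set (K j)} \<noteq> {n \<in> W. rotate_by B n g \<in> free_set B}"
          using \<Phi> w' by simp
        moreover have "free_set B \<subseteq> free_set (K j)" by (auto simp: free_set_def K_def)
        ultimately have "\<exists>n\<in>W. rotate_by B n g \<in> free_set (K j) - free_set B" by blast
        with g show ?thesis by blast
      qed (use g in simp)
    qed
    have "prob {g \<in> G. {n \<in> W. window_coding B g n} = w} \<le> prob ({g \<in> G. \<Phi> j g} \<union> (\<Union>n\<in>W. ?D n))"
      using sub R D win by (intro finite_measure_mono) auto
    also have "\<dots> \<le> prob {g \<in> G. \<Phi> j g} + prob (\<Union>n\<in>W. ?D n)"
      using R D win by (intro measure_Un_le) auto
    also have "prob (\<Union>n\<in>W. ?D n) \<le> (\<Sum>n\<in>W. prob (?D n))"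
      using D win by (intro finite_measure_subadditive_finite) auto
    also have "(\<Sum>n\<in>W. prob (?D n)) = (\<Sum>n\<in>W. e j)"
      using fs unfolding e_diff by (intro sum.cong refl prob_rotate_by) auto
    finally show ?thesis using cyl[of j] by simp
  qed
  have "(\<lambda>j. 2 * real (card W) * e j) \<longlonglongrightarrow> 2 * real (card W) * 0"
    by (intro tendsto_intros e0)
  then have "prob {g \<in> G. {n \<in> W. window_coding B g n} = w} \<le> 2 * real (card W) * 0"
    using bound by (intro LIMSEQ_le_const) auto
  then show ?thesis using measure_nonneg[of P] by (simp add: order_antisym)
qed

lemma window_pattern_measurable:
  assumes "finite W"
  shows "{g \<in> G. {n \<in> W. window_coding B g n} = w} \<in> sets P"
proof -
  have pred: "Measurable.pred P (\<lambda>g. window_coding B g n)" for n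
    using measurable_sets[OF window_coding_measurable coordinate_sets[of n]]
    by (simp add: pred_def vimage_def Int_def conj_commute)
  have "Measurable.pred P (\<lambda>g. w \<subseteq> W \<and> (\<forall>n\<in>W. window_coding B g n \<longleftrightarrow> n \<in> w))"
    by (intro pred_intros_logic pred_intros_countable_bounded countableI_type pred measurable_const) simp_all
  moreover have "{n \<in> W. window_coding B g n} = w \<longleftrightarrow> w \<subseteq> W \<and> (\<forall>n\<in>W. window_coding B g n \<longleftrightarrow> n \<in> w)" for g
    by blast
  ultimately show ?thesis by (simp add: pred_def space_P)
qed

text \<open>
  On each finite window there are finitely many patterns, and those that do not occur in the free
  sequence are null.
\<close>

lemma AE_window_in_free_subshift: "AE g in P. window_coding B g \<in> free_subshift B"
proof -
  have "AE g in P. \<exists>m. \<forall>n\<in>{- int N..int N}. window_coding B g n \<longleftrightarrow> free_seq B (n + m)" for N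
  proof -
    let ?W = "{- int N..int N}"
    have "AE g in P. \<forall>w\<in>Pow ?W. {n \<in> ?W. window_coding B g n} = w \<longrightarrow> (\<exists>m. {n \<in> ?W. free_seq B (n + m)} = w)"
    proof (rule AE_finite_allI)
      fix w
      show "AE g in P. {n \<in> ?W. window_coding B g n} = w \<longrightarrow> (\<exists>m. {n \<in> ?W. free_seq B (n + m)} = w)"
      proof (cases "\<exists>m. {n \<in> ?W. free_seq B (n + m)} = w")
        case False
        then have "prob {g \<in> G. {n \<in> ?W. window_coding B g n} = w} = 0"
          by (intro absent_pattern_null) auto
        then have "{g \<in> G. {n \<in> ?W. window_coding B g n} = w} \<in> null_sets P"
          using window_pattern_measurable[of ?W w] by (simp add: null_sets_def emeasure_eq_measure)
        then show ?thesis by (rule AE_I') (auto simp: space_P)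
      qed simp
    qed simp
    then show ?thesis
    proof (rule AE_mp, intro AE_I2 impI)
      fix g assume "\<forall>w\<in>Pow ?W. {n \<in> ?W. window_coding B g n} = w \<longrightarrow> (\<exists>m. {n \<in> ?W. free_seq B (n + m)} = w)"
      then obtain m where "{n \<in> ?W. free_seq B (n + m)} = {n \<in> ?W. window_coding B g n}" by blast
      then have "\<forall>n\<in>?W. window_coding B g n \<longleftrightarrow> free_seq B (n + m)" by blast
      then show "\<exists>m. \<forall>n\<in>?W. window_coding B g n \<longleftrightarrow> free_seq B (n + m)" ..
    qed
  qed
  then have "AE g in P. \<forall>N. \<exists>m. \<forall>n\<in>{- int N..int N}. window_coding B g n \<longleftrightarrow> free_seq B (n + m)"
    by (simp add: AE_all_countable)
  then show ?thesis by (rule AE_mp) (auto intro!: AE_I2 free_subshiftI)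
qed

lemma window_coding_decodable:
  assumes g: "g \<in> G" and X: "window_coding B g \<in> free_subshift B"
    and uniq: "\<forall>b\<in>B. \<forall>r. misses_class (window_coding B g) b r \<longrightarrow> [r = g b] (mod int b)"
  shows "window_coding B g \<in> decodable B"
  unfolding decodable_def mem_Collect_eq
proof (intro conjI ballI allI impI X)
  fix b r r' assume "b \<in> B" "misses_class (window_coding B g) b r \<and> misses_class (window_coding B g) b r'"
  with uniq have "[r = g b] (mod int b)" "[r' = g b] (mod int b)" by blast+
  then show "[r = r'] (mod int b)" by (meson cong_sym cong_trans)
next
  fix N
  have "finite (B \<inter> {..N})" "B \<inter> {..N} \<subseteq> B" by auto
  then obtain m where m: "\<forall>b\<in>B \<inter> {..N}. g b = m mod int b" using carrier_representative[OF g] by blast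
  have "misses_class (window_coding B g) b m" if "b \<in> B \<inter> {..N}" for b
  proof -
    have "misses_class (window_coding B g) b (g b)" using that by (intro misses_class_window_coding) simp
    moreover have "[g b = m] (mod int b)" using m that by (simp add: Cong.cong_def)
    ultimately show ?thesis using misses_class_cong by blast
  qed
  then show "\<exists>m. \<forall>b\<in>B \<inter> {..N}. misses_class (window_coding B g) b m" by blast
next
  fix n assume *: "\<forall>b\<in>B. \<not> misses_class (window_coding B g) b (- n)"
  show "window_coding B g n"
  proof (rule ccontr)
    assume "\<not> window_coding B g n"
    then obtain b where b: "b \<in> B" "[n = - g b] (mod int b)" by (auto simp: window_coding_def)
    then have "[g b = - n] (mod int b)" by (metis cong_minus_minus_iff cong_sym minus_minus)
    with misses_class_window_coding[OF b(1)] misses_class_cong * b(1) show False by blast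
  qed
qed

lemma decode_window_coding:
  assumes g: "g \<in> G" and "window_coding B g \<in> decodable B"
  shows "decode B (window_coding B g) = g"
proof
  fix b
  show "decode B (window_coding B g) b = g b"
  proof (cases "b \<in> B")
    case True
    then show ?thesis
      using decode_eq[OF assms(2) True misses_class_window_coding[OF True]] carrier_mod[OF g True] by simp
  next
    case False
    then show ?thesis using g odometer_carrier_iff[OF zero_notin, of g] by (simp add: decode_def extensional_def)
  qed
qed

lemma AE_window_decodable:
  assumes "taut B"
  shows "AE g in P. window_coding B g \<in> decodable B"
  using AE_window_in_free_subshift AE_misses_unique_class[OF assms] AE_space
  by eventually_elim (auto simp: space_P intro!: window_coding_decodable)

end

section \<open>The isomorphism\<close>

context haar_odometer
begin

abbreviation "X \<equiv> free_subshift B"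
abbreviation "M \<equiv> mirsky_on_subshift B P"

lemma space_M: "space M = X"
  by (simp add: mirsky_on_subshift_def mirsky_measure_def space_restrict_space)

lemma sets_M_iff: "A \<in> sets M \<longleftrightarrow> A \<subseteq> X \<and> A \<in> sets borel"
  unfolding mirsky_on_subshift_def mirsky_measure_def
  by (subst sets_restrict_space_iff) (simp_all add: free_subshift_measurable)

lemma window_event_measurable: "A \<in> sets borel \<Longrightarrow> {g \<in> G. window_coding B g \<in> A} \<in> sets P"
  using measurable_sets[OF window_coding_measurable, of A]
  by (simp add: space_P vimage_def Int_def conj_commute)

lemma emeasure_M:
  assumes "A \<in> sets M"
  shows "emeasure M A = emeasure P {g \<in> G. window_coding B g \<in> A}"
proof -
  have A: "A \<subseteq> X" "A \<in> sets borel" using assms sets_M_iff by auto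
  have "emeasure M A = emeasure (mirsky_measure B P) A"
    unfolding mirsky_on_subshift_def
    by (rule emeasure_restrict_space) (use A in \<open>simp_all add: mirsky_measure_def free_subshift_measurable\<close>)
  also have "\<dots> = emeasure P (window_coding B -` A \<inter> space P)"
    unfolding mirsky_measure_def by (rule emeasure_distr[OF window_coding_measurable A(2)])
  also have "window_coding B -` A \<inter> space P = {g \<in> G. window_coding B g \<in> A}"
    by (auto simp: space_P)
  finally show ?thesis .
qed

lemma emeasure_M_AE:
  assumes "A \<in> sets M" "AE g in P. window_coding B g \<in> A"
  shows "emeasure M A = 1"
proof -
  have "AE g in P. g \<in> {g \<in> G. window_coding B g \<in> A}"
    using assms(2) AE_space by eventually_elim (simp add: space_P)
  then show ?thesis
    unfolding emeasure_M[OF assms(1)]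
    using assms(1) window_event_measurable sets_M_iff by (intro emeasure_eq_1_AE) auto
qed

lemma prob_space_M: "prob_space M"
proof (rule prob_spaceI)
  have "X \<in> sets M" using sets_M_iff free_subshift_measurable by auto
  then show "emeasure M (space M) = 1"
    unfolding space_M by (rule emeasure_M_AE[OF _ AE_window_in_free_subshift])
qed

lemma measure_preserving_rotation: "measure_preserving_system P (odometer_rotation B)"
  unfolding measure_preserving_system_def odometer_rotation_eq
  using prob_space_axioms distr_rotate_by by simp

lemma measure_preserving_shift: "measure_preserving_system M left_shift"
  unfolding measure_preserving_system_def
proof (intro conjI prob_space_M)
  have shift_sets: "shift_by 1 -` A \<inter> X \<in> sets M" if "A \<in> sets M" for A
  proof -
    have "shift_by 1 -` A \<inter> space borel \<in> sets borel"
      using that sets_M_iff by (intro measurable_sets[OF shift_by_measurable]) auto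
    then show ?thesis using free_subshift_measurable by (simp add: sets_M_iff)
  qed
  show meas: "left_shift \<in> M \<rightarrow>\<^sub>M M"
    by (rule measurableI) (auto simp: space_M shift_by_free_subshift shift_sets)
  show "distr M M left_shift = M"
  proof (rule measure_eqI)
    fix A assume "A \<in> sets (distr M M left_shift)"
    then have A: "A \<in> sets M" by simp
    then have AX: "A \<subseteq> X" and Ab: "A \<in> sets borel" using sets_M_iff by auto
    have "emeasure (distr M M left_shift) A = emeasure M (shift_by 1 -` A \<inter> X)"
      by (simp add: emeasure_distr[OF meas A] space_M)
    also have "\<dots> = emeasure P {g \<in> G. window_coding B g \<in> shift_by 1 -` A \<inter> X}"
      by (rule emeasure_M[OF shift_sets[OF A]])
    also have "{g \<in> G. window_coding B g \<in> shift_by 1 -` A \<inter> X} = {g \<in> G. rotate_by B 1 g \<in> {g \<in> G. window_coding B g \<in> A}}"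
      using AX shift_by_free_subshift_iff[of 1 _ B]
      by (auto simp: window_coding_rotate_by rotate_by_carrier)
    also have "emeasure P \<dots> = emeasure P {g \<in> G. window_coding B g \<in> A}"
      using prob_rotate_by[OF window_event_measurable[OF Ab]] by (simp add: emeasure_eq_measure)
    also have "\<dots> = emeasure M A" by (rule emeasure_M[OF A, symmetric])
    finally show "emeasure (distr M M left_shift) A = emeasure M A" .
  qed simp
qed

text \<open>
  The decoding map is the isomorphism, with the coding as its inverse; the full sets are the
  decodable sequences and the points whose codings are decodable.
\<close>

lemma mirsky_isomorphic_odometer:
  assumes taut: "taut B"
  shows "mps_isomorphic M left_shift P (odometer_rotation B)"
  unfolding mps_isomorphic_def
proof (intro conjI exI measure_preserving_shift measure_preserving_rotation)
  let ?M' = "decodable B" and ?N' = "{g \<in> G. window_coding B g \<in> decodable B}" and ?f = "decode B"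
  let ?RM = "restrict_space M ?M'" and ?RP = "restrict_space P ?N'"
  show M': "?M' \<in> sets M"
    using decodable_measurable by (auto simp: sets_M_iff decodable_def)
  show "emeasure M ?M' = 1" by (rule emeasure_M_AE[OF M' AE_window_decodable[OF taut]])
  then show "emeasure P ?N' = 1" using emeasure_M[OF M'] by simp
  show "left_shift ` ?M' \<subseteq> ?M'" using shift_by_decodable by blast
  show N': "?N' \<in> sets P" by (rule window_event_measurable[OF decodable_measurable])
  show "odometer_rotation B ` ?N' \<subseteq> ?N'"
    by (auto simp: odometer_rotation_eq rotate_by_carrier window_coding_rotate_by shift_by_decodable)
  show bij: "bij_betw ?f ?M' ?N'"
  proof (rule bij_betw_byWitness[where f' = "window_coding B"])
    show "\<forall>x\<in>?M'. window_coding B (?f x) = x" using window_coding_decode by blast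
    show "\<forall>g\<in>?N'. ?f (window_coding B g) = g" using decode_window_coding by blast
    show "?f ` ?M' \<subseteq> ?N'" using decode_in_carrier[OF zero_notin] window_coding_decode by auto
  qed auto
  have space_RM: "space ?RM = ?M'" using M' by (auto simp: space_restrict_space space_M decodable_def)
  have space_RP: "space ?RP = ?N'" by (auto simp: space_restrict_space space_P)
  have sets_RM: "A \<in> sets ?RM \<longleftrightarrow> A \<subseteq> ?M' \<and> A \<in> sets borel" for A
    using M' by (subst sets_restrict_space_iff) (auto simp: sets_M_iff sets.Int_space_eq2)
  have sets_RP: "A \<in> sets ?RP \<longleftrightarrow> A \<subseteq> ?N' \<and> A \<in> sets P" for A
    using N' by (subst sets_restrict_space_iff) (auto simp: sets.Int_space_eq2)
  show f: "?f \<in> ?RM \<rightarrow>\<^sub>M ?RP"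
    unfolding measurable_restrict_space2_iff
  proof (intro conjI measurable_into_P)
    show "?f \<in> space ?RM \<rightarrow> G" using decode_in_carrier[OF zero_notin] by (auto simp: space_RM)
    show "?f \<in> space ?RM \<rightarrow> ?N'" using bij by (auto simp: space_RM dest: bij_betwE)
    fix K m assume K: "finite K" "K \<subseteq> B"
    have "?f x b = m mod int b \<longleftrightarrow> misses_class x b m" if "x \<in> ?M'" "b \<in> K" for x b
    proof -
      have b: "b \<in> B" using K that by blast
      show ?thesis
      proof
        assume "?f x b = m mod int b"
        then have "[?f x b = m] (mod int b)" by (simp add: Cong.cong_def)
        with misses_class_decode[OF that(1) b] misses_class_cong show "misses_class x b m" by blast
      qed (rule decode_eq[OF that(1) b])
    qed
    then have "{x \<in> space ?RM. \<forall>b\<in>K. ?f x b = m mod int b} = ?M' - (\<Union>b\<in>K. - {x. misses_class x b m})"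
      unfolding space_RM by blast
    also have "\<dots> \<in> sets ?RM"
      unfolding sets_RM using misses_class_sets K decodable_measurable
      by (auto intro!: sets.Diff sets.finite_UN)
    finally show "{x \<in> space ?RM. \<forall>b\<in>K. ?f x b = m mod int b} \<in> sets ?RM" .
  qed
  have inv: "the_inv_into ?M' ?f g = window_coding B g" if "g \<in> ?N'" for g
    using that bij decode_window_coding[of g]
    by (intro the_inv_into_f_eq) (auto dest: bij_betw_imp_inj_on)
  have "window_coding B \<in> ?RP \<rightarrow>\<^sub>M ?RM"
  proof (rule measurableI)
    fix A assume "A \<in> sets ?RM"
    then have A: "A \<subseteq> ?M'" "A \<in> sets borel" by (auto simp: sets_RM)
    have "window_coding B -` A \<inter> space ?RP = {g \<in> G. window_coding B g \<in> A}"
      using A(1) by (auto simp: space_RP)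
    with A window_event_measurable show "window_coding B -` A \<inter> space ?RP \<in> sets ?RP"
      by (auto simp: sets_RP)
  qed (auto simp: space_RP space_RM)
  then show "the_inv_into ?M' ?f \<in> ?RP \<rightarrow>\<^sub>M ?RM"
    by (subst measurable_cong[where g = "window_coding B"]) (use inv space_RP in auto)
  show "distr ?RM ?RP ?f = ?RP"
  proof (rule measure_eqI)
    fix A assume "A \<in> sets (distr ?RM ?RP ?f)"
    then have A: "A \<in> sets ?RP" by simp
    then have A': "A \<subseteq> ?N'" "A \<in> sets P" using sets_RP by auto
    have pre: "?f -` A \<inter> ?M' \<in> sets ?RM" using measurable_sets[OF f A] by (simp add: space_RM)
    then have preM: "?f -` A \<inter> ?M' \<in> sets M" using M' sets_M_iff by (auto simp: sets_RM)
    have "emeasure (distr ?RM ?RP ?f) A = emeasure ?RM (?f -` A \<inter> ?M')"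
      by (simp add: emeasure_distr[OF f A] space_RM)
    also have "\<dots> = emeasure M (?f -` A \<inter> ?M')"
      using M' by (intro emeasure_restrict_space) (auto simp: sets.Int_space_eq2)
    also have "\<dots> = emeasure P {g \<in> G. window_coding B g \<in> ?f -` A \<inter> ?M'}" by (rule emeasure_M[OF preM])
    also have "{g \<in> G. window_coding B g \<in> ?f -` A \<inter> ?M'} = A"
      using A'(1) decode_window_coding by auto
    also have "emeasure P A = emeasure ?RP A"
      using N' A' by (intro emeasure_restrict_space[symmetric]) (auto simp: sets.Int_space_eq2)
    finally show "emeasure (distr ?RM ?RP ?f) A = emeasure ?RP A" .
  qed simp
  show "\<forall>x\<in>?M'. ?f (left_shift x) = odometer_rotation B (?f x)"
    using decode_shift_by by (auto simp: odometer_rotation_eq)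
qed

end

section \<open>Entropy of patterns of events\<close>

text \<open>
  The set of those events that occur at \<open>x\<close>: a random variable that encodes a whole
  family of events.
\<close>

definition pattern :: "('i \<Rightarrow> 'a set) \<Rightarrow> 'i set \<Rightarrow> 'a \<Rightarrow> 'i set" where
  "pattern C I x = {i \<in> I. x \<in> C i}"

definition binary_entropy :: "real \<Rightarrow> real \<Rightarrow> real" where
  "binary_entropy b t = - (t * log b t + (1 - t) * log b (1 - t))"

context information_space
begin

lemma simple_function_pattern:
  assumes I: "finite I" and C: "\<And>i. i \<in> I \<Longrightarrow> C i \<in> sets M"
  shows "simple_function M (pattern C I)"
  unfolding simple_function_def
proof (intro conjI ballI)
  show "finite (pattern C I ` space M)"
    by (rule finite_subset[of _ "Pow I"]) (use I in \<open>auto simp: pattern_def\<close>)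
  fix s assume "s \<in> pattern C I ` space M"
  then have s: "s \<subseteq> I" by (auto simp: pattern_def)
  have "pattern C I -` {s} \<inter> space M = space M - (\<Union>i\<in>I. if i \<in> s then space M - C i else C i)"
  proof -
    have "pattern C I x = s \<longleftrightarrow> (\<forall>i\<in>I. i \<in> s \<longleftrightarrow> x \<in> C i)" for x
      using s unfolding pattern_def by blast
    then show ?thesis by (fastforce split: if_splits)
  qed
  also have "\<dots> \<in> sets M" using I C by (intro sets.Diff sets.finite_UN) auto
  finally show "pattern C I -` {s} \<inter> space M \<in> sets M" .
qed

lemma entropy_eq_sum:
  assumes X: "simple_function M X" and V: "finite V" "X ` space M \<subseteq> V"
  shows "\<H>(X) = - (\<Sum>v\<in>V. prob (X -` {v} \<inter> space M) * log b (prob (X -` {v} \<inter> space M)))"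
proof -
  have "\<H>(X) = - (\<Sum>v\<in>X ` space M. prob (X -` {v} \<inter> space M) * log b (prob (X -` {v} \<inter> space M)))"
    by (rule entropy_simple_distributed[OF simple_distributedI[OF X measure_nonneg refl]])
  also have "(\<Sum>v\<in>X ` space M. prob (X -` {v} \<inter> space M) * log b (prob (X -` {v} \<inter> space M)))
      = (\<Sum>v\<in>V. prob (X -` {v} \<inter> space M) * log b (prob (X -` {v} \<inter> space M)))"
  proof (rule sum.mono_neutral_left[OF V], intro ballI)
    fix v assume "v \<in> V - X ` space M"
    then have "X -` {v} \<inter> space M = {}" by auto
    then show "prob (X -` {v} \<inter> space M) * log b (prob (X -` {v} \<inter> space M)) = 0" by simp
  qed
  finally show ?thesis .
qed

lemma entropy_le_log_card:
  assumes X: "simple_function M X" and V: "finite V" "X ` space M \<subseteq> V"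
  shows "\<H>(X) \<le> log b (card V)"
proof -
  have "\<H>(X) \<le> log b (card (X ` space M))"
    by (rule entropy_le_card[OF simple_distributedI[OF X measure_nonneg refl]])
  also have "\<dots> \<le> log b (card V)"
  proof -
    have "card (X ` space M) > 0"
      using not_empty finite_subset[OF V(2,1)] by (simp add: card_gt_0_iff)
    moreover have "card (X ` space M) \<le> card V" by (rule card_mono[OF V])
    ultimately show ?thesis using b_gt_1 by simp
  qed
  finally show ?thesis .
qed

lemma entropy_function_of_pair_le:
  assumes X: "simple_function M X" and Y: "simple_function M Y"
    and Z: "Z = (\<lambda>x. f (X x) (Y x))"
  shows "\<H>(Z) \<le> \<H>(X) + \<H>(Y)"
proof -
  have XY: "simple_function M (\<lambda>x. (X x, Y x))" by (rule simple_function_Pair[OF X Y])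
  have "\<H>((\<lambda>(u, v). f u v) \<circ> (\<lambda>x. (X x, Y x))) \<le> \<H>(\<lambda>x. (X x, Y x))"
    by (rule entropy_data_processing[OF XY])
  also have "\<dots> = \<H>(X) + \<H>(Y | X)" by (rule entropy_chain_rule[OF X Y])
  also have "\<H>(Y | X) \<le> \<H>(Y)" by (rule conditional_entropy_less_eq_entropy[OF Y X])
  finally show ?thesis by (simp add: Z comp_def)
qed

lemma entropy_pattern_singleton:
  assumes "C i \<in> sets M"
  shows "\<H>(pattern C {i}) = binary_entropy b (prob (C i))"
proof -
  have "\<H>(pattern C {i}) = - (\<Sum>v\<in>{{}, {i}}. prob (pattern C {i} -` {v} \<inter> space M) * log b (prob (pattern C {i} -` {v} \<inter> space M)))"
    using assms by (intro entropy_eq_sum simple_function_pattern) (auto simp: pattern_def)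
  moreover have "pattern C {i} -` {{i}} \<inter> space M = C i"
    using sets.sets_into_space[OF assms] by (auto simp: pattern_def)
  moreover have "pattern C {i} -` {{}} \<inter> space M = space M - C i" by (auto simp: pattern_def)
  ultimately show ?thesis using prob_compl[OF assms] by (simp add: binary_entropy_def)
qed

lemma entropy_pattern_le_sum:
  assumes "finite I" and "\<And>i. i \<in> I \<Longrightarrow> C i \<in> sets M"
  shows "\<H>(pattern C I) \<le> (\<Sum>i\<in>I. binary_entropy b (prob (C i)))"
  using assms
proof (induction I rule: finite_induct)
  case empty
  have "\<H>(pattern C {}) \<le> log b (card {{} :: 'b set})"
    by (intro entropy_le_log_card simple_function_pattern) (auto simp: pattern_def)
  then show ?case by simp
next
  case (insert i I)
  have "\<H>(pattern C (insert i I)) \<le> \<H>(pattern C I) + \<H>(pattern C {i})"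
    by (rule entropy_function_of_pair_le[where f = "(\<union>)"])
       (use insert in \<open>auto intro!: simple_function_pattern simp: pattern_def fun_eq_iff\<close>)
  also have "\<dots> \<le> (\<Sum>i\<in>I. binary_entropy b (prob (C i))) + binary_entropy b (prob (C i))"
    using insert by (intro add_mono) (auto simp: entropy_pattern_singleton)
  finally show ?case using insert by simp
qed

text \<open>
  The symmetric differences tell how to correct the pattern of \<open>C'\<close> to that of
  \<open>C\<close>, and each of them costs at most its own binary entropy.
\<close>

lemma entropy_pattern_perturb:
  assumes I: "finite I" and C: "\<And>i. i \<in> I \<Longrightarrow> C i \<in> sets M" "\<And>i. i \<in> I \<Longrightarrow> C' i \<in> sets M"
  shows "\<H>(pattern C I) \<le> \<H>(pattern C' I) + (\<Sum>i\<in>I. binary_entropy b (prob (sym_diff (C i) (C' i))))"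
proof -
  let ?E = "\<lambda>i. sym_diff (C i) (C' i)"
  have E: "?E i \<in> sets M" if "i \<in> I" for i using C that by auto
  have "\<H>(pattern C I) \<le> \<H>(pattern C' I) + \<H>(pattern ?E I)"
  proof (rule entropy_function_of_pair_le[where f = sym_diff])
    show "pattern C I = (\<lambda>x. sym_diff (pattern C' I x) (pattern ?E I x))"
      by (auto simp: pattern_def fun_eq_iff)
  qed (use I C E in \<open>auto intro: simple_function_pattern\<close>)
  also have "\<H>(pattern ?E I) \<le> (\<Sum>i\<in>I. binary_entropy b (prob (?E i)))"
    by (rule entropy_pattern_le_sum[OF I E])
  finally show ?thesis by simp
qed

end

text \<open>
  The atoms of the join are the nonempty level sets of the itinerary up to time \<open>n\<close>.
\<close>

lemma partition_entropy_dynamical_join: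
  fixes M :: "'a measure"
  assumes "information_space M (exp 1)" and Q: "finite_measurable_partition M Q"
    and T: "T \<in> M \<rightarrow>\<^sub>M M" and n: "n \<ge> 1"
    and C_def: "C = (\<lambda>(A, k). (T ^^ k) -` A \<inter> space M)"
  shows "partition_entropy M (dynamical_join M T Q n) =
    prob_space.entropy M (exp 1) (count_space (pattern C (Q \<times> {..<n}) ` space M)) (pattern C (Q \<times> {..<n}))"
proof -
  interpret information_space M "exp 1" by fact
  let ?p = "pattern C (Q \<times> {..<n})"
  let ?cell = "\<lambda>s. ?p -` {s} \<inter> space M"
  have Qfin: "finite Q" and Qsets: "Q \<subseteq> sets M" and Qpart: "partition_on (space M) Q"
    using Q by (auto simp: finite_measurable_partition_def)
  have Tk: "T ^^ k \<in> M \<rightarrow>\<^sub>M M" for k by (rule measurable_compose_n[OF T])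
  have Tk_space: "(T ^^ k) x \<in> space M" if "x \<in> space M" for k x
    using measurable_space[OF Tk that] .
  have Q_unique: "A = A'" if "A \<in> Q" "A' \<in> Q" "x \<in> A" "x \<in> A'" for A A' x
    using Qpart that by (meson disjointD disjoint_iff partition_onD2)
  have Q_cover: "\<exists>A\<in>Q. x \<in> A" if "x \<in> space M" for x
    using partition_onD1[OF Qpart] that by blast
  let ?Qk = "\<lambda>k. (\<lambda>A. (T ^^ k) -` A \<inter> space M) ` Q"
  have join: "dynamical_join M T Q n = ?cell ` ?p ` space M"
  proof (intro equalityI subsetI)
    fix D assume "D \<in> dynamical_join M T Q n"
    then obtain f where f: "f \<in> (\<Pi> R\<in>?Qk ` {..<n}. R)" and D: "D = \<Inter> (f ` ?Qk ` {..<n})" and "D \<noteq> {}"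
      unfolding dynamical_join_def common_refinement by auto
    then obtain x where xD: "x \<in> D" by blast
    have fk: "\<exists>A\<in>Q. f (?Qk k) = (T ^^ k) -` A \<inter> space M" if "k < n" for k
    proof -
      have "f (?Qk k) \<in> ?Qk k" using f that by (intro Pi_mem[OF f]) blast
      then show ?thesis by blast
    qed
    have Dk: "D \<subseteq> f (?Qk k)" if "k < n" for k using D that by blast
    have D_space: "D \<subseteq> space M"
    proof -
      obtain A where "f (?Qk 0) = (T ^^ 0) -` A \<inter> space M" using fk[of 0] n by auto
      then show ?thesis using Dk[of 0] n by auto
    qed
    have x: "x \<in> space M" using xD D_space by blast
    have "D = ?cell (?p x)"
    proof (intro equalityI subsetI)
      fix y assume y: "y \<in> D"
      have ys: "y \<in> space M" using y D_space by blast
      have "y \<in> C (A, k) \<longleftrightarrow> x \<in> C (A, k)" if "A \<in> Q" "k < n" for A k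
      proof -
        obtain A' where A': "A' \<in> Q" "f (?Qk k) = (T ^^ k) -` A' \<inter> space M" using fk \<open>k < n\<close> by blast
        have "x \<in> f (?Qk k)" "y \<in> f (?Qk k)" using xD y Dk[OF \<open>k < n\<close>] by blast+
        then have "(T ^^ k) x \<in> A'" "(T ^^ k) y \<in> A'" using A' by auto
        then show ?thesis using Q_unique[OF \<open>A \<in> Q\<close> A'(1)] x ys by (auto simp: C_def)
      qed
      then show "y \<in> ?cell (?p x)" using ys by (auto simp: pattern_def)
    next
      fix y assume y: "y \<in> ?cell (?p x)"
      have "y \<in> f (?Qk k)" if "k < n" for k
      proof -
        obtain A' where A': "A' \<in> Q" "f (?Qk k) = (T ^^ k) -` A' \<inter> space M" using fk \<open>k < n\<close> by blast
        have "x \<in> f (?Qk k)" using xD Dk[OF that] by blast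
        then have "(A', k) \<in> ?p x" using A' that by (auto simp: pattern_def C_def)
        moreover have "?p y = ?p x" using y by simp
        ultimately have "(A', k) \<in> ?p y" by simp
        then show ?thesis using A' by (simp add: pattern_def C_def)
      qed
      then show "y \<in> D" using D by auto
    qed
    with x show "D \<in> ?cell ` ?p ` space M" by blast
  next
    fix D assume "D \<in> ?cell ` ?p ` space M"
    then obtain x where x: "x \<in> space M" and D: "D = ?cell (?p x)" by blast
    have "\<exists>A\<in>Q. (T ^^ k) x \<in> A" for k using Q_cover Tk_space[OF x] by blast
    then obtain a where a: "\<And>k. a k \<in> Q" "\<And>k. (T ^^ k) x \<in> a k" by metis
    define f where "f = (\<lambda>R. SOME S. S \<in> R \<and> x \<in> S)"
    have f: "f (?Qk k) = (T ^^ k) -` a k \<inter> space M" for k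
      unfolding f_def
    proof (rule some_equality)
      show "(T ^^ k) -` a k \<inter> space M \<in> ?Qk k \<and> x \<in> (T ^^ k) -` a k \<inter> space M" using a x by blast
      fix S assume "S \<in> ?Qk k \<and> x \<in> S"
      then show "S = (T ^^ k) -` a k \<inter> space M" using a Q_unique by blast
    qed
    have "?cell (?p x) = \<Inter> (f ` ?Qk ` {..<n})"
    proof (intro equalityI subsetI)
      fix y assume y: "y \<in> ?cell (?p x)"
      have "y \<in> f (?Qk k)" if "k < n" for k
      proof -
        have "(a k, k) \<in> ?p x" using a x that by (simp add: pattern_def C_def)
        then have "(a k, k) \<in> ?p y" using y by simp
        then show ?thesis by (simp add: f pattern_def C_def)
      qed
      then show "y \<in> \<Inter> (f ` ?Qk ` {..<n})" by auto
    next
      fix y assume "y \<in> \<Inter> (f ` ?Qk ` {..<n})"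
      then have y: "y \<in> space M \<and> (T ^^ k) y \<in> a k" if "k < n" for k
        using that f[of k] by auto
      then have ys: "y \<in> space M" using n by auto
      have "y \<in> C (A, k) \<longleftrightarrow> x \<in> C (A, k)" if "A \<in> Q" "k < n" for A k
        using y[OF \<open>k < n\<close>] a Q_unique[OF \<open>A \<in> Q\<close> a(1)[of k]] x ys by (auto simp: C_def)
      then show "y \<in> ?cell (?p x)" using ys by (auto simp: pattern_def)
    qed
    moreover have "x \<in> ?cell (?p x)" using x by simp
    moreover have "f \<in> (\<Pi> R\<in>?Qk ` {..<n}. R)" using f a by (auto simp: Pi_iff)
    ultimately show "D \<in> dynamical_join M T Q n"
      unfolding dynamical_join_def common_refinement D by blast
  qed
  have C: "C i \<in> sets M" if "i \<in> Q \<times> {..<n}" for i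
    using that Qsets measurable_sets[OF Tk] by (auto simp: C_def)
  have sf: "simple_function M ?p" by (intro simple_function_pattern finite_SigmaI Qfin C) auto
  have inj: "inj_on ?cell (?p ` space M)"
  proof (rule inj_onI)
    fix s t assume s: "s \<in> ?p ` space M" and t: "t \<in> ?p ` space M" and eq: "?cell s = ?cell t"
    then obtain x where "x \<in> space M" "s = ?p x" by blast
    then have "x \<in> ?cell t" using eq by auto
    then show "s = t" using \<open>s = ?p x\<close> by simp
  qed
  have "entropy (exp 1) (count_space (?p ` space M)) ?p = - (\<Sum>s\<in>?p ` space M. prob (?cell s) * log (exp 1) (prob (?cell s)))"
    by (rule entropy_simple_distributed[OF simple_distributedI[OF sf measure_nonneg refl]])
  also have "\<dots> = partition_entropy M (dynamical_join M T Q n)"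
    unfolding partition_entropy_def join by (simp add: sum.reindex[OF inj] log_ln)
  finally show ?thesis by simp
qed

section \<open>Periodic approximation and zero entropy\<close>

definition periodic_set :: "'a measure \<Rightarrow> ('a \<Rightarrow> 'a) \<Rightarrow> nat \<Rightarrow> 'a set \<Rightarrow> bool" where
  "periodic_set M T L A \<longleftrightarrow> A \<in> sets M \<and> L > 0 \<and> (T ^^ L) -` A \<inter> space M = A"

definition periodically_approximable :: "'a measure \<Rightarrow> ('a \<Rightarrow> 'a) \<Rightarrow> 'a set \<Rightarrow> bool" where
  "periodically_approximable M T A \<longleftrightarrow> A \<in> sets M \<and>
     (\<forall>e>0. \<exists>A' L. periodic_set M T L A' \<and> measure M (sym_diff A A') < e)"

lemma periodic_set_mult:
  assumes "periodic_set M T L A" "T \<in> M \<rightarrow>\<^sub>M M" "m > 0"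
  shows "periodic_set M T (m * L) A"
proof -
  have L: "A \<in> sets M" "L > 0" "(T ^^ L) -` A \<inter> space M = A"
    using assms(1) by (auto simp: periodic_set_def)
  have sp: "(T ^^ k) x \<in> space M" if "x \<in> space M" for k x
    using measurable_space[OF measurable_compose_n[OF assms(2)] that] .
  have "(T ^^ (k * L)) x \<in> A \<longleftrightarrow> x \<in> A" if "x \<in> space M" for k x
  proof (induction k)
    case (Suc k)
    have "(T ^^ (Suc k * L)) x = (T ^^ L) ((T ^^ (k * L)) x)" by (simp add: funpow_add)
    moreover have "(T ^^ L) y \<in> A \<longleftrightarrow> y \<in> A" if "y \<in> space M" for y
      using that by (subst (2) L(3)[symmetric]) simp
    ultimately have "(T ^^ (Suc k * L)) x \<in> A \<longleftrightarrow> (T ^^ (k * L)) x \<in> A" using sp[OF that] by metis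
    with Suc show ?case by simp
  qed simp
  note inv = this
  have "(T ^^ (m * L)) -` A \<inter> space M = A"
  proof (intro equalityI subsetI)
    fix x assume "x \<in> A"
    moreover from this have "x \<in> space M" using sets.sets_into_space[OF L(1)] by (rule rev_subsetD)
    ultimately show "x \<in> (T ^^ (m * L)) -` A \<inter> space M" using inv[of x m] by simp
  qed (use inv[of _ m] in auto)
  with L assms(3) show ?thesis by (simp add: periodic_set_def)
qed

lemma periodic_set_Un:
  assumes A: "periodic_set M T L A" and B: "periodic_set M T K B" and T: "T \<in> M \<rightarrow>\<^sub>M M"
  shows "periodic_set M T (K * L) (A \<union> B)"
proof -
  have pos: "L > 0" "K > 0" using A B by (simp_all add: periodic_set_def)
  have "periodic_set M T (K * L) A" by (rule periodic_set_mult[OF A T pos(2)])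
  moreover have "periodic_set M T (K * L) B"
    using periodic_set_mult[OF B T pos(1)] by (simp add: mult.commute)
  ultimately show ?thesis
    unfolding periodic_set_def vimage_Un Int_Un_distrib2 by (metis sets.Un)
qed

lemma periodic_set_Compl:
  assumes A: "periodic_set M T L A" and T: "T \<in> M \<rightarrow>\<^sub>M M"
  shows "periodic_set M T L (space M - A)"
proof -
  have L: "A \<in> sets M" "L > 0" "(T ^^ L) -` A \<inter> space M = A"
    using A by (auto simp: periodic_set_def)
  have "(T ^^ L) x \<in> space M" if "x \<in> space M" for x
    using measurable_space[OF measurable_compose_n[OF T] that] .
  then have "(T ^^ L) -` (space M - A) \<inter> space M = space M - ((T ^^ L) -` A \<inter> space M)" by auto
  then have "(T ^^ L) -` (space M - A) \<inter> space M = space M - A" unfolding L(3) .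
  with L show ?thesis by (auto simp: periodic_set_def)
qed

lemma periodically_approximable_periodic:
  "periodic_set M T L A \<Longrightarrow> periodically_approximable M T A"
  unfolding periodically_approximable_def
proof (intro conjI allI impI)
  assume A: "periodic_set M T L A"
  then show "A \<in> sets M" by (simp add: periodic_set_def)
  fix e :: real assume "e > 0"
  then have "measure M (sym_diff A A) < e" by simp
  with A show "\<exists>A' L. periodic_set M T L A' \<and> measure M (sym_diff A A') < e" by blast
qed

context prob_space
begin

lemma prob_sym_diff_triangle:
  assumes "A \<in> sets M" "B \<in> sets M" "C \<in> sets M"
  shows "prob (sym_diff A C) \<le> prob (sym_diff A B) + prob (sym_diff B C)"
proof -
  have "prob (sym_diff A C) \<le> prob (sym_diff A B \<union> sym_diff B C)"
    using assms by (intro finite_measure_mono) auto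
  also have "\<dots> \<le> prob (sym_diff A B) + prob (sym_diff B C)"
    using assms by (intro measure_Un_le) auto
  finally show ?thesis .
qed

lemma periodically_approximable_limit:
  assumes A: "A \<in> sets M"
    and close: "\<And>e. e > 0 \<Longrightarrow> \<exists>B. periodically_approximable M T B \<and> prob (sym_diff A B) < e"
  shows "periodically_approximable M T A"
  unfolding periodically_approximable_def
proof (intro conjI A allI impI)
  fix e :: real assume "e > 0"
  then obtain B where B: "periodically_approximable M T B" "prob (sym_diff A B) < e / 2"
    using close[of "e / 2"] by auto
  have "e / 2 > 0" using \<open>e > 0\<close> by simp
  with B(1) obtain C L where C: "periodic_set M T L C" "prob (sym_diff B C) < e / 2"
    unfolding periodically_approximable_def by blast
  have "prob (sym_diff A C) \<le> prob (sym_diff A B) + prob (sym_diff B C)"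
    using A B C by (intro prob_sym_diff_triangle) (auto simp: periodically_approximable_def periodic_set_def)
  with B C have "prob (sym_diff A C) < e" by simp
  with C show "\<exists>A' L. periodic_set M T L A' \<and> prob (sym_diff A A') < e" by blast
qed

lemma periodically_approximable_Compl:
  assumes A: "periodically_approximable M T A" and T: "T \<in> M \<rightarrow>\<^sub>M M"
  shows "periodically_approximable M T (space M - A)"
  unfolding periodically_approximable_def
proof (intro conjI allI impI)
  have As: "A \<in> sets M" using A by (simp add: periodically_approximable_def)
  then show "space M - A \<in> sets M" by auto
  fix e :: real assume "e > 0"
  then obtain C L where C: "periodic_set M T L C" "prob (sym_diff A C) < e"
    using A unfolding periodically_approximable_def by blast
  have "C \<in> sets M" using C(1) by (simp add: periodic_set_def)
  then have "sym_diff (space M - A) (space M - C) = sym_diff A C"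
    using sets.sets_into_space As by blast
  with C periodic_set_Compl[OF C(1) T]
  show "\<exists>A' L. periodic_set M T L A' \<and> prob (sym_diff (space M - A) A') < e" by metis
qed

lemma periodically_approximable_Un:
  assumes A: "periodically_approximable M T A" and B: "periodically_approximable M T B"
    and T: "T \<in> M \<rightarrow>\<^sub>M M"
  shows "periodically_approximable M T (A \<union> B)"
  unfolding periodically_approximable_def
proof (intro conjI allI impI)
  have AB: "A \<in> sets M" "B \<in> sets M" using A B by (auto simp: periodically_approximable_def)
  then show "A \<union> B \<in> sets M" by auto
  fix e :: real assume "e > 0"
  then have e2: "e / 2 > 0" by simp
  obtain C L where C: "periodic_set M T L C" "prob (sym_diff A C) < e / 2"
    using A e2 unfolding periodically_approximable_def by blast
  obtain D K where D: "periodic_set M T K D" "prob (sym_diff B D) < e / 2"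
    using B e2 unfolding periodically_approximable_def by blast
  have CD: "C \<in> sets M" "D \<in> sets M" using C D by (auto simp: periodic_set_def)
  have "prob (sym_diff (A \<union> B) (C \<union> D)) \<le> prob (sym_diff A C \<union> sym_diff B D)"
    using AB CD by (intro finite_measure_mono) auto
  also have "\<dots> \<le> prob (sym_diff A C) + prob (sym_diff B D)"
    using AB CD by (intro measure_Un_le) auto
  finally have "prob (sym_diff (A \<union> B) (C \<union> D)) < e" using C D by simp
  with periodic_set_Un[OF C(1) D(1) T]
  show "\<exists>A' L. periodic_set M T L A' \<and> prob (sym_diff (A \<union> B) A') < e" by blast
qed

lemma periodically_approximable_empty: "periodically_approximable M T {}"
  by (rule periodically_approximable_periodic[of _ _ 1]) (simp add: periodic_set_def)

text \<open>
  Finitely many of the sets exhaust the union up to small measure, and a finite union of periodic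
  sets is periodic with the product of the periods.
\<close>

lemma periodically_approximable_UN:
  fixes A :: "nat \<Rightarrow> 'a set"
  assumes A: "\<And>i. periodically_approximable M T (A i)" and T: "T \<in> M \<rightarrow>\<^sub>M M"
  shows "periodically_approximable M T (\<Union>i. A i)"
proof (rule periodically_approximable_limit)
  have As: "A i \<in> sets M" for i using A by (simp add: periodically_approximable_def)
  then show "(\<Union>i. A i) \<in> sets M" by auto
  fix e :: real assume e: "e > 0"
  have fin: "periodically_approximable M T (\<Union>i<m. A i)" for m
  proof (induction m)
    case (Suc m)
    then show ?case using periodically_approximable_Un[OF A[of m] Suc T] by (simp add: lessThan_Suc)
  qed (simp add: periodically_approximable_empty)
  have "(\<lambda>m. prob (\<Union>i<m. A i)) \<longlonglongrightarrow> prob (\<Union>m. \<Union>i<m. A i)"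
    using As by (intro finite_Lim_measure_incseq) (fastforce simp: incseq_def)+
  moreover have "(\<Union>m. \<Union>i<m. A i) = (\<Union>i. A i)" by blast
  ultimately have "\<forall>\<^sub>F m in sequentially. dist (prob (\<Union>i<m. A i)) (prob (\<Union>i. A i)) < e"
    using tendstoD e by fastforce
  then obtain m where m: "dist (prob (\<Union>i<m. A i)) (prob (\<Union>i. A i)) < e"
    using eventually_happens'[OF sequentially_bot] by blast
  have "sym_diff (\<Union>i. A i) (\<Union>i<m. A i) = (\<Union>i. A i) - (\<Union>i<m. A i)" by blast
  also have "prob \<dots> = prob (\<Union>i. A i) - prob (\<Union>i<m. A i)"
    using As by (intro finite_measure_Diff) auto
  also have "\<dots> < e" using m by (simp add: dist_real_def)
  finally show "\<exists>B. periodically_approximable M T B \<and> prob (sym_diff (\<Union>i. A i) B) < e"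
    using fin by blast
qed

lemma periodically_approximable_AE_eq:
  assumes B: "periodically_approximable M T B" and A: "A \<in> sets M"
    and eq: "AE x in M. x \<in> A \<longleftrightarrow> x \<in> B"
  shows "periodically_approximable M T A"
proof (rule periodically_approximable_limit[OF A])
  fix e :: real assume "e > 0"
  have "B \<in> sets M" using B by (simp add: periodically_approximable_def)
  then have "prob (sym_diff A B) = 0"
    using A eq by (subst prob_eq_0) (auto elim: eventually_mono)
  with \<open>e > 0\<close> B show "\<exists>B. periodically_approximable M T B \<and> prob (sym_diff A B) < e"
    by (intro exI[of _ B]) simp
qed

end

lemma binary_entropy_small:
  assumes "e > 0"
  obtains d where "d > 0" "\<And>t. 0 \<le> t \<Longrightarrow> t < d \<Longrightarrow> binary_entropy (exp 1) t < e"
proof -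
  have "((\<lambda>t::real. - (t * ln t + (1 - t) * ln (1 - t))) \<longlongrightarrow> 0) (at_right 0)" by real_asymp
  then have "\<forall>\<^sub>F t in at_right 0. - (t * ln t + (1 - t) * ln (1 - t)) < e"
    using assms by (rule order_tendstoD(2))
  then obtain d where d: "d > 0" "\<And>t. 0 < t \<Longrightarrow> t < d \<Longrightarrow> - (t * ln t + (1 - t) * ln (1 - t)) < e"
    unfolding eventually_at_right_field by auto
  show ?thesis
  proof (rule that[OF d(1)])
    fix t :: real assume "0 \<le> t" "t < d"
    then show "binary_entropy (exp 1) t < e"
      using d(2)[of t] assms by (cases "t = 0") (auto simp: binary_entropy_def log_ln[symmetric])
  qed
qed

lemma measure_preserving_funpow:
  assumes "measure_preserving_system M T"
  shows "distr M M (T ^^ k) = M"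
proof (induction k)
  case 0
  show ?case by (simp add: id_def distr_id)
next
  case (Suc k)
  have T: "T \<in> M \<rightarrow>\<^sub>M M" "distr M M T = M" using assms by (auto simp: measure_preserving_system_def)
  have "distr M M (T ^^ Suc k) = distr (distr M M (T ^^ k)) M T"
    using distr_distr[OF T(1) measurable_compose_n[OF T(1), of k]] by (simp add: comp_def)
  with Suc T show ?case by (simp add: comp_def)
qed

text \<open>
  Approximate the cells of a partition by sets with a common period \<open>p\<close>. The
  itinerary of length \<open>n\<close> with respect to the approximations is a function of the one
  of length \<open>p\<close>, so its entropy is bounded; the errors contribute at most
  \<open>n\<close> times an arbitrarily small constant.
\<close>

theorem zero_entropy_of_periodic_approximation:
  fixes M :: "'a measure"
  assumes mps: "measure_preserving_system M T"
    and approx: "\<And>A. A \<in> sets M \<Longrightarrow> periodically_approximable M T A"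
  shows "kolmogorov_entropy M T = 0"
proof -
  interpret prob_space M using mps by (simp add: measure_preserving_system_def)
  interpret information_space M "exp 1" by unfold_locales simp
  have T: "T \<in> M \<rightarrow>\<^sub>M M" using mps by (simp add: measure_preserving_system_def)
  have Tk: "T ^^ k \<in> M \<rightarrow>\<^sub>M M" for k by (rule measurable_compose_n[OF T])
  have Tk_prob: "prob ((T ^^ k) -` A \<inter> space M) = prob A" if "A \<in> sets M" for A k
    using measure_distr[OF Tk that] measure_preserving_funpow[OF mps] by simp
  have zero: "entropy_wrt_partition M T Q = 0" if Q: "finite_measurable_partition M Q" for Q
  proof -
    have Qfin: "finite Q" and Qsets: "Q \<subseteq> sets M" using Q by (auto simp: finite_measurable_partition_def)
    define C where "C = (\<lambda>(A, k). (T ^^ k) -` A \<inter> space M)"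
    let ?h = "\<lambda>Y :: 'a \<Rightarrow> ('a set \<times> nat) set. entropy (exp 1) (count_space (Y ` space M)) Y"
    define H where "H = (\<lambda>n. partition_entropy M (dynamical_join M T Q n))"
    have H: "H n = ?h (pattern C (Q \<times> {..<n}))" if "n \<ge> 1" for n
      unfolding H_def
      by (rule partition_entropy_dynamical_join[OF information_space_axioms Q T that C_def])
    have Csets: "C i \<in> sets M" if "i \<in> Q \<times> {..<n}" for i n
      using that Qsets measurable_sets[OF Tk] by (auto simp: C_def)
    have nonneg: "H n \<ge> 0" if "n \<ge> 1" for n
    proof -
      have sf: "simple_function M (pattern C (Q \<times> {..<n}))"
        by (intro simple_function_pattern finite_SigmaI Qfin Csets) auto
      have "H n = - (\<Sum>s\<in>pattern C (Q \<times> {..<n}) ` space M. prob (pattern C (Q \<times> {..<n}) -` {s} \<inter> space M) *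
          log (exp 1) (prob (pattern C (Q \<times> {..<n}) -` {s} \<inter> space M)))"
        unfolding H[OF that]
        by (rule entropy_simple_distributed[OF simple_distributedI[OF sf measure_nonneg refl]])
      moreover have "p * log (exp 1) p \<le> 0" if "0 \<le> p" "p \<le> 1" for p :: real
        using that by (cases "p = 0") (auto intro: mult_nonneg_nonpos)
      ultimately show ?thesis by (simp add: sum_nonpos)
    qed
    have "(\<lambda>n. H n / real n) \<longlonglongrightarrow> 0"
    proof (rule order_tendstoI)
      fix a :: real assume "a < 0"
      show "\<forall>\<^sub>F n in sequentially. a < H n / real n"
        using eventually_ge_at_top[of 1]
      proof eventually_elim
        case (elim n)
        then have "0 \<le> H n / real n" using nonneg by simp
        with \<open>a < 0\<close> show ?case by linarith
      qed
    next
      fix a :: real assume a: "0 < a"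
      define e where "e = a / (2 * real (card Q + 1))"
      have e: "e > 0" using a by (simp add: e_def)
      obtain d where d: "d > 0" "\<And>t. 0 \<le> t \<Longrightarrow> t < d \<Longrightarrow> binary_entropy (exp 1) t < e"
        using binary_entropy_small[OF e] by blast
      have "\<forall>A\<in>Q. \<exists>A' L. periodic_set M T L A' \<and> prob (sym_diff A A') < d"
        using approx Qsets d(1) unfolding periodically_approximable_def by blast
      then obtain R L where RL: "\<And>A. A \<in> Q \<Longrightarrow> periodic_set M T (L A) (R A)"
        "\<And>A. A \<in> Q \<Longrightarrow> prob (sym_diff A (R A)) < d" by metis
      \<comment> \<open>a common period of all the approximating sets\<close>
      define p where "p = (\<Prod>A\<in>Q. L A)"
      have p: "p > 0" using RL(1) by (auto simp: p_def periodic_set_def intro: prod_pos)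
      have Rp: "periodic_set M T p (R A)" if A: "A \<in> Q" for A
      proof -
        have "p = (\<Prod>A\<in>Q - {A}. L A) * L A" using Qfin A by (simp add: p_def prod.remove mult.commute)
        with p periodic_set_mult[OF RL(1)[OF A] T, of "\<Prod>A\<in>Q - {A}. L A"] show ?thesis by simp
      qed
      have Rsets: "R A \<in> sets M" if "A \<in> Q" for A using RL(1)[OF that] by (simp add: periodic_set_def)
      define D where "D = (\<lambda>(A, k). (T ^^ k) -` R A \<inter> space M)"
      have Dsets: "D i \<in> sets M" if "i \<in> Q \<times> {..<n}" for i n
        using that Rsets measurable_sets[OF Tk] by (auto simp: D_def)
      have Dmod: "D (A, k) = D (A, k mod p)" if A: "A \<in> Q" for A k
      proof -
        have sp: "(T ^^ (k mod p)) x \<in> space M" if "x \<in> space M" for x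
          using measurable_space[OF Tk that] .
        have "(T ^^ k) x \<in> R A \<longleftrightarrow> (T ^^ (k mod p)) x \<in> R A" if "x \<in> space M" for x
        proof (cases "k div p = 0")
          case True
          then show ?thesis using div_mult_mod_eq[of k p] by simp
        next
          case False
          then have "(T ^^ (k div p * p)) -` R A \<inter> space M = R A"
            using periodic_set_mult[OF Rp[OF A] T, of "k div p"] by (simp add: periodic_set_def)
          moreover have "(T ^^ k) x = (T ^^ (k div p * p)) ((T ^^ (k mod p)) x)"
            by (metis comp_apply div_mult_mod_eq funpow_add)
          ultimately show ?thesis using sp[OF that] by auto
        qed
        then show ?thesis by (auto simp: D_def)
      qed
      \<comment> \<open>The first term bounds the entropy of the periodic itinerary, the second one the corrections.\<close>
      have bound: "H n \<le> real (card Q * p) * ln 2 + real n * (real (card Q) * e)" if n: "n \<ge> 1" for n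
      proof -
        have "H n \<le> ?h (pattern D (Q \<times> {..<n})) + (\<Sum>i\<in>Q \<times> {..<n}. binary_entropy (exp 1) (prob (sym_diff (C i) (D i))))"
          unfolding H[OF n] by (intro entropy_pattern_perturb finite_SigmaI Qfin Csets Dsets) auto
        also have "?h (pattern D (Q \<times> {..<n})) \<le> ?h (pattern D (Q \<times> {..<p}))"
        proof -
          have "pattern D (Q \<times> {..<n}) = (\<lambda>s. {(A, k) \<in> Q \<times> {..<n}. (A, k mod p) \<in> s}) \<circ> pattern D (Q \<times> {..<p})"
          proof (intro ext Set.set_eqI)
            fix x and i :: "'a set \<times> nat"
            obtain A k where i: "i = (A, k)" by (cases i)
            show "i \<in> pattern D (Q \<times> {..<n}) x \<longleftrightarrow>
                i \<in> ((\<lambda>s. {(A, k) \<in> Q \<times> {..<n}. (A, k mod p) \<in> s}) \<circ> pattern D (Q \<times> {..<p})) x"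
              unfolding i by (cases "A \<in> Q") (use p Dmod[of A k] in \<open>simp_all add: pattern_def\<close>)
          qed
          moreover have "simple_function M (pattern D (Q \<times> {..<p}))"
            by (intro simple_function_pattern finite_SigmaI Qfin Dsets) auto
          ultimately show ?thesis using entropy_data_processing by simp
        qed
        also have "\<dots> \<le> log (exp 1) (card (Pow (Q \<times> {..<p})))"
          by (intro entropy_le_log_card simple_function_pattern finite_SigmaI Qfin Dsets)
             (use Qfin in \<open>auto simp: pattern_def\<close>)
        also have "\<dots> = real (card Q * p) * ln 2"
          using Qfin by (simp add: card_Pow card_cartesian_product ln_realpow flip: log_ln)
        also have "(\<Sum>i\<in>Q \<times> {..<n}. binary_entropy (exp 1) (prob (sym_diff (C i) (D i)))) \<le> (\<Sum>i\<in>Q \<times> {..<n}. e)"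
        proof (rule sum_mono)
          fix i assume "i \<in> Q \<times> {..<n}"
          then obtain A k where i: "i = (A, k)" "A \<in> Q" by auto
          have "sym_diff (C i) (D i) = (T ^^ k) -` sym_diff A (R A) \<inter> space M"
            by (auto simp: i C_def D_def)
          then have "prob (sym_diff (C i) (D i)) = prob (sym_diff A (R A))"
            using Tk_prob[of "sym_diff A (R A)" k] i(2) Qsets Rsets by auto
          then show "binary_entropy (exp 1) (prob (sym_diff (C i) (D i))) \<le> e"
            using d(2)[of "prob (sym_diff A (R A))"] RL(2)[OF i(2)] by simp
        qed
        finally show ?thesis by (simp add: card_cartesian_product mult_ac)
      qed
      have small: "real (card Q) * e \<le> a / 2"
        using a by (simp add: e_def field_simps)
      have "(\<lambda>n. real (card Q * p) * ln 2 / real n) \<longlonglongrightarrow> 0" by real_asymp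
      then have "\<forall>\<^sub>F n in sequentially. real (card Q * p) * ln 2 / real n < a / 2"
        using a by (intro order_tendstoD(2)) auto
      then show "\<forall>\<^sub>F n in sequentially. H n / real n < a"
        using eventually_ge_at_top[of 1]
      proof eventually_elim
        case (elim n)
        have "H n / real n \<le> (real (card Q * p) * ln 2 + real n * (real (card Q) * e)) / real n"
          using bound elim by (intro divide_right_mono) auto
        also have "\<dots> = real (card Q * p) * ln 2 / real n + real (card Q) * e"
          using elim by (simp add: add_divide_distrib)
        finally show ?case using elim small by linarith
      qed
    qed
    then show ?thesis unfolding entropy_wrt_partition_def H_def by (rule limI)
  qed
  have "finite_measurable_partition M {space M}"
    using not_empty by (auto simp: finite_measurable_partition_def partition_on_def disjoint_def)
  then have ne: "{Q. finite_measurable_partition M Q} \<noteq> {}" by blast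
  have "kolmogorov_entropy M T = (SUP Q \<in> {Q. finite_measurable_partition M Q}. 0 :: ereal)"
    unfolding kolmogorov_entropy_def using zero by (intro SUP_cong refl) (simp add: zero_ereal_def)
  with ne show ?thesis by simp
qed

section \<open>Zero entropy of the Mirsky measure\<close>

context haar_odometer
begin

lemma misses_class_periodic:
  assumes "b \<in> B"
  shows "periodic_set M left_shift b {x \<in> X. misses_class x b r}"
  unfolding periodic_set_def
proof (intro conjI)
  show "{x \<in> X. misses_class x b r} \<in> sets M"
    using free_subshift_measurable misses_class_sets[of b r]
    by (auto simp: sets_M_iff Collect_conj_eq)
  show "b > 0" using assms zero_notin by (metis neq0_conv)
  have "misses_class (shift_by (int b) x) b r \<longleftrightarrow> misses_class x b r" for x
    unfolding misses_class_shift_by by (rule misses_class_cong) (simp add: cong_iff_dvd_diff)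
  then show "(left_shift ^^ b) -` {x \<in> X. misses_class x b r} \<inter> space M = {x \<in> X. misses_class x b r}"
    by (auto simp: left_shift_funpow space_M shift_by_free_subshift_iff)
qed

text \<open>
  A decodable point has a zero at \<open>n\<close> exactly if it misses the class of
  \<open>n\<close> modulo some \<open>b\<close>, so the event is almost surely a countable
  combination of periodic ones.
\<close>

lemma coordinate_periodically_approximable:
  assumes "taut B"
  shows "periodically_approximable M left_shift {x \<in> X. x n}"
proof -
  interpret M: prob_space M by (rule prob_space_M)
  have shift: "left_shift \<in> M \<rightarrow>\<^sub>M M"
    using measure_preserving_shift by (simp add: measure_preserving_system_def)
  define Z where "Z = (\<lambda>b. if b \<in> B then {x \<in> X. misses_class x b (- n)} else {})"
  have "periodically_approximable M left_shift (Z b)" for b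
    using periodically_approximable_periodic[OF misses_class_periodic] M.periodically_approximable_empty
    by (simp add: Z_def)
  then have "periodically_approximable M left_shift (space M - (\<Union>b. Z b))"
    by (intro M.periodically_approximable_Compl M.periodically_approximable_UN shift)
  then show ?thesis
  proof (rule M.periodically_approximable_AE_eq)
    show "{x \<in> X. x n} \<in> sets M"
      using free_subshift_measurable coordinate_sets[of n] by (auto simp: sets_M_iff Collect_conj_eq)
    have "decodable B \<in> sets M"
      using decodable_measurable by (auto simp: sets_M_iff decodable_def)
    then have "AE x in M. x \<in> decodable B"
      using emeasure_M_AE[OF _ AE_window_decodable[OF assms]]
      by (subst M.prob_eq_1[symmetric]) (simp_all add: M.emeasure_eq_measure)
    then show "AE x in M. x \<in> {x \<in> X. x n} \<longleftrightarrow> x \<in> space M - (\<Union>b. Z b)"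
    proof (rule AE_mp, intro AE_I2 impI)
      fix x assume "x \<in> decodable B"
      then have "x n" if "\<forall>b\<in>B. \<not> misses_class x b (- n)" using that by (auto simp: decodable_def)
      moreover have "\<not> misses_class x b (- n)" if "x n" for b using that by (auto simp: misses_class_def)
      ultimately show "x \<in> {x \<in> X. x n} \<longleftrightarrow> x \<in> space M - (\<Union>b. Z b)"
        by (auto simp: Z_def space_M split: if_splits)
    qed
  qed
qed

lemma sets_M_periodically_approximable:
  assumes taut: "taut B" and A: "A \<in> sets M"
  shows "periodically_approximable M left_shift A"
proof -
  interpret M: prob_space M by (rule prob_space_M)
  have shift: "left_shift \<in> M \<rightarrow>\<^sub>M M"
    using measure_preserving_shift by (simp add: measure_preserving_system_def)
  let ?C = "range (\<lambda>n. {x :: int \<Rightarrow> bool. x n})"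
  have A': "A \<subseteq> X" "A \<in> sets borel" using A sets_M_iff by auto
  have "(\<lambda>x. x) \<in> sigma UNIV ?C \<rightarrow>\<^sub>M (borel :: (int \<Rightarrow> bool) measure)"
    by (rule measurable_into_sequences) auto
  from measurable_sets[OF this A'(2)] have "A \<in> sigma_sets UNIV ?C" by simp
  then have "periodically_approximable M left_shift (X \<inter> A)"
  proof induction
    case (Basic a)
    then show ?case
      using coordinate_periodically_approximable[OF taut] by (auto simp: Collect_conj_eq)
  next
    case Empty
    show ?case using M.periodically_approximable_empty by simp
  next
    case (Compl a)
    have "X \<inter> (UNIV - a) = space M - X \<inter> a" by (auto simp: space_M)
    then show ?case using M.periodically_approximable_Compl[OF Compl.IH shift] by simp
  next
    case (Union a)
    then show ?case using M.periodically_approximable_UN[OF Union.IH shift] by simp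
  qed
  with A'(1) show ?thesis by (simp add: Int_absorb1)
qed

end

theorem theorem6:
  fixes B :: "nat set" and P :: "(nat \<Rightarrow> int) measure"
  assumes "0 \<notin> B"
    and "taut B"
    and "normalized_haar (odometer_group B) (odometer_topology B) P"
  shows "mps_isomorphic (mirsky_on_subshift B P) left_shift P (odometer_rotation B) \<and>
    kolmogorov_entropy (mirsky_on_subshift B P) left_shift = 0"
proof -
  interpret haar_odometer B P using assms(1,3) by unfold_locales
  show ?thesis
    using mirsky_isomorphic_odometer[OF assms(2)]
      zero_entropy_of_periodic_approximation[OF measure_preserving_shift
        sets_M_periodically_approximable[OF assms(2)]]
    by blast
qed

end
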